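(* Let $\alpha>0$ be irrational, and consider dissipative flow of slope $\alpha$ on a system $\mathcal{P}$ obtained from a finite polysquare translation surface by the inclusion of a one-sided barrier $B$ on the common vertical edge of two neighbouring atomic squares, in the form of a union of finitely many vertical intervals, where a set $A$ corresponding to $B$ has been chosen on a different vertical edge on the same horizontal street that contains $B$. Then the recurrent set $\mathcal{R}(\mathcal{P};\alpha)$ and the transient set $\mathcal{W}(\mathcal{P};\alpha)$ are constructed by the extension process: with the sets $A=A_0\supset A_1\supset A_2\supset\cdots$, $A_\infty=\bigcap_{i\ge1}A_i$ and the first return strips $\mathcal{F}(\cdot)$ of that process, $$\mathcal{R}(\mathcal{P};\alpha)=\mathcal{F}(A_\infty)\quad\text{and}\quad \mathcal{W}(\mathcal{P};\alpha)=\mathcal{F}(B)\cup\bigcup_{i=1}^\infty\mathcal{F}(A_{i-1}\setminus A_i),$$ apart from exceptional sets of $2$-dimensional Lebesgue measure $0$. Furthermore, this process is finite, and both sets $\mathcal{R}(\mathcal{P};\alpha)$ and $\mathcal{W}(\mathcal{P};\alpha)$ are finite unions of polygons with boundary edges that are vertical or of slope $\alpha$.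
   Context: A finite polysquare translation surface is a connected surface obtained from finitely many axis-parallel unit squares (atomic squares) by identifying right edges with left edges, and top edges with bottom edges, in pairs by translation. A horizontal street is a maximal (cyclic) chain of atomic squares successively adjacent through vertical edges. Each vertical edge is identified with $[0,1)$ by relative height $y$. The barrier is $B=J$ on one vertical edge (common to two neighbouring atomic squares) and $A$ is the corresponding copy of $J$, at the same heights, on a different vertical edge of the same horizontal street, where $J\subset[0,1)$ is a union of finitely many intervals of positive length. Dissipative flow of slope $\alpha$ on $\mathcal{P}$: a flow line moves from left to right at unit speed in direction $(1,\alpha)$ as the ordinary geodesic flow on the surface, except that whenever it hits a point of $B$ from the left it continues, in the same direction, from the corresponding point (same height) of $A$. (A flow line that starts on $B$ emanates from the right side of $B$.) Flow lines that hit a singularity where the continuation is undefined come from a set of measure $0$ and are ignored. For $t\ge0$, $\mathbf{T}_\alpha^{(t)}$ advances a point along its dissipative flow line by time $t$. A point $P\in\mathcal{P}$ is wandering if there exist an open neighbourhood $D$ of $P$ and $t_0\ge0$ with $D\cap\mathbf{T}_\alpha^{(t)}(D)=\emptyset$ for every $t>t_0$; otherwise it is non-wandering. $\mathcal{W}(\mathcal{P};\alpha)$ (transient set) is the set of wandering points and $\mathcal{R}(\mathcal{P};\alpha)$ (recurrent set) is the set of non-wandering points. Extension process. Let $X$ be the union of the left vertical edges of all atomic squares, and let $\mathbf{T}:X\to X$ be the discretization of the ordinary (barrier-free) geodesic flow of slope $\alpha$ on the surface, i.e. each point is mapped to the next point of $X$ on its geodesic. For $x\in A\cup B$ let $n(x)=\min\{n\ge1:\mathbf{T}^n(x)\in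 A\cup B\}$ and $\mathbf{T}^*(x)=\mathbf{T}^{n(x)}(x)$, so $\mathbf{T}^*:A\cup B\to A\cup B$ is the first return map (defined almost everywhere). For $S\subset A\cup B$ let $\mathcal{F}(S)$ be the first return strip of $S$: the set of all points of $\mathcal{P}$ swept out by starting from the points of $S$ and moving with the ordinary geodesic flow of slope $\alpha$ until $A\cup B$ is hit again for the first time. For $H\subset A\cup B$ let $y(H)$ be the set of heights of points of $H$. Put $A_0=A$ and, for $i\ge1$, let $A_i\subset A_{i-1}$ be defined by $y(A_i)=y(\mathbf{T}^*(A_{i-1})\cap(A\cup B))$. The process starts with $\mathcal{F}(B)$, which extends the no-go zone $\mathcal{N}(\mathcal{P};\alpha)$ (the open set swept out from $B$ without its endpoints by the flow of slope $\alpha$), and in the $i$-th step the set $\mathcal{F}(A_{i-1}\setminus A_i)$ is added to it. The process is finite if $A_{i-1}\setminus A_i$ has measure $0$ for some $i\ge1$ (so that it terminates). In the description of sets as finite unions of polygons, sets of $2$-dimensional Lebesgue measure $0$ are disregarded. *)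

theory Defs
  imports "HOL-Analysis.Analysis"
begin

section \<open>Finite polysquare translation surfaces\<close>

text \<open>
  The right edge of a square \<open>s\<close> is glued to the left edge of \<open>right_of S s\<close>, its top edge to the
  bottom edge of \<open>above S s\<close>.  A triple \<open>(s, x, y)\<close> with \<open>x, y\<close> in \<open>[0,1]\<close> is the point with local
  coordinates \<open>(x, y)\<close> of the closed square \<open>s\<close>; a point of the surface is a class of glued triples.
\<close>

record 's polysquare =
  squares :: "'s set"
  right_of :: "'s \<Rightarrow> 's"
  above :: "'s \<Rightarrow> 's"

type_synonym 's local_point = "'s \<times> real \<times> real"
type_synonym 's point = "'s local_point set"

definition adjacent :: "'s polysquare \<Rightarrow> 's rel" where
  "adjacent S = {(s, s'). s \<in> squares S \<and> (s' = right_of S s \<or> s' = above S s)}"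

definition polysquare_surface :: "'s polysquare \<Rightarrow> bool" where
  "polysquare_surface S \<longleftrightarrow>
     finite (squares S) \<and> squares S \<noteq> {} \<and>
     bij_betw (right_of S) (squares S) (squares S) \<and>
     bij_betw (above S) (squares S) (squares S) \<and>
     (\<forall>s\<in>squares S. \<forall>s'\<in>squares S. (s, s') \<in> (adjacent S \<union> (adjacent S)\<inverse>)\<^sup>*)"

definition local_points :: "'s polysquare \<Rightarrow> 's local_point set" where
  "local_points S = squares S \<times> {0..1} \<times> {0..1}"

definition gluing :: "'s polysquare \<Rightarrow> 's local_point rel" where
  "gluing S =
     {((s, 1, y), (right_of S s, 0, y)) | s y. s \<in> squares S \<and> y \<in> {0..1}} \<union>
     {((s, x, 1), (above S s, x, 0)) | s x. s \<in> squares S \<and> x \<in> {0..1}}"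

definition pt :: "'s polysquare \<Rightarrow> 's local_point \<Rightarrow> 's point" where
  "pt S z = (gluing S \<union> (gluing S)\<inverse>)\<^sup>* `` {z}"

definition surface :: "'s polysquare \<Rightarrow> 's point set" where
  "surface S = pt S ` local_points S"

definition local_topology :: "'s polysquare \<Rightarrow> 's local_point topology" where
  "local_topology S =
     prod_topology (discrete_topology (squares S)) (top_of_set ({0..1} \<times> {0..1}))"

definition surface_topology :: "'s polysquare \<Rightarrow> 's point topology" where
  "surface_topology S =
     topology (\<lambda>U. U \<subseteq> surface S \<and> openin (local_topology S) {z \<in> local_points S. pt S z \<in> U})"

lemma topspace_local_topology: "topspace (local_topology S) = local_points S"
  by (simp add: local_topology_def local_points_def)

lemma openin_surface_topology:
  "openin (surface_topology S) U \<longleftrightarrow>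
     U \<subseteq> surface S \<and> openin (local_topology S) {z \<in> local_points S. pt S z \<in> U}"
proof -
  let ?P = "\<lambda>U. U \<subseteq> surface S \<and> openin (local_topology S) {z \<in> local_points S. pt S z \<in> U}"
  have "?P (U \<inter> V)" if "?P U" "?P V" for U V
  proof -
    have "{z \<in> local_points S. pt S z \<in> U \<inter> V} =
        {z \<in> local_points S. pt S z \<in> U} \<inter> {z \<in> local_points S. pt S z \<in> V}"
      by blast
    with that show ?thesis
      by (metis (no_types, lifting) le_infI1 openin_Int)
  qed
  moreover have "?P (\<Union>\<K>)" if "\<And>U. U \<in> \<K> \<Longrightarrow> ?P U" for \<K>
  proof -
    have "{z \<in> local_points S. pt S z \<in> \<Union>\<K>} = (\<Union>U\<in>\<K>. {z \<in> local_points S. pt S z \<in> U})"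
      by blast
    with that show ?thesis by auto
  qed
  ultimately have "istopology ?P"
    unfolding istopology_def by blast
  then show ?thesis
    by (simp add: surface_topology_def topology_inverse')
qed

lemma topspace_surface_topology: "topspace (surface_topology S) = surface S"
proof -
  have "{z \<in> local_points S. pt S z \<in> surface S} = local_points S"
    by (auto simp: surface_def)
  then have "openin (surface_topology S) (surface S)"
    using openin_topspace[of "local_topology S"]
    by (simp add: openin_surface_topology topspace_local_topology)
  then show ?thesis
    by (metis openin_subset openin_surface_topology openin_topspace subset_antisym)
qed

lemma quotient_map_pt: "quotient_map (local_topology S) (surface_topology S) (pt S)"
  by (auto simp: quotient_map_def topspace_local_topology topspace_surface_topology
      openin_surface_topology surface_def)

text \<open>
  The total angle at a vertex is \<open>2\<pi>k\<close>, where \<open>k\<close> is the number of squares having it as their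
  lower left corner.  It is a singularity iff \<open>k > 1\<close>.
\<close>

definition singular :: "'s point \<Rightarrow> bool" where
  "singular p \<longleftrightarrow> (\<exists>s s'. s \<noteq> s' \<and> (s, 0, 0) \<in> p \<and> (s', 0, 0) \<in> p)"

text \<open>Two-dimensional Lebesgue null sets of the surface.\<close>

definition surface_null :: "'s polysquare \<Rightarrow> 's point set \<Rightarrow> bool" where
  "surface_null S N \<longleftrightarrow>
     (\<forall>s\<in>squares S. negligible {(x, y). x \<in> {0..1} \<and> y \<in> {0..1} \<and> pt S (s, x, y) \<in> N})"

definition equal_ae :: "'s polysquare \<Rightarrow> 's point set \<Rightarrow> 's point set \<Rightarrow> bool" where
  "equal_ae S M N \<longleftrightarrow> surface_null S ((M - N) \<union> (N - M))"


section \<open>Flows\<close>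

text \<open>
  The position, in the closed square finally reached, of the line of slope \<open>\<alpha>\<close> starting at
  \<open>(s, x, y)\<close> after horizontal displacement \<open>d \<le> 1 - x\<close>: it has crossed \<open>\<lfloor>y + \<alpha> d\<rfloor>\<close> top edges and no
  vertical edge, reaching a right edge for \<open>d = 1 - x\<close>.
\<close>

definition develop :: "'s polysquare \<Rightarrow> real \<Rightarrow> 's local_point \<Rightarrow> real \<Rightarrow> 's local_point" where
  "develop S \<alpha> z d =
     (case z of (s, x, y) \<Rightarrow>
       ((above S ^^ nat \<lfloor>y + \<alpha> * d\<rfloor>) s, x + d, frac (y + \<alpha> * d)))"

text \<open>
  \<open>flows S \<alpha> jmp p t q\<close>: the flow line from \<open>p\<close> in direction \<open>(1, \<alpha>)\<close> is at \<open>q\<close> at time \<open>t\<close>.  A line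
  arriving from the left at height \<open>h\<close> of the left edge of a square \<open>s\<close> continues from height \<open>h\<close> of
  the left edge of \<open>jmp s h\<close>; at the time of arrival its position is already the latter point.  The
  factor \<open>sqrt (1 + \<alpha>\<^sup>2)\<close> turns horizontal displacement into time at unit speed.  The line ends when it
  meets a singularity.
\<close>

inductive flows ::
  "'s polysquare \<Rightarrow> real \<Rightarrow> ('s \<Rightarrow> real \<Rightarrow> 's) \<Rightarrow> 's point \<Rightarrow> real \<Rightarrow> 's point \<Rightarrow> bool"
  for S \<alpha> jmp where
  within:
    "\<lbrakk>s \<in> squares S; x \<in> {0..<1}; y \<in> {0..<1}; \<not> singular (pt S (s, x, y));
      0 \<le> d; x + d < 1\<rbrakk>
     \<Longrightarrow> flows S \<alpha> jmp (pt S (s, x, y)) (sqrt (1 + \<alpha>\<^sup>2) * d) (pt S (develop S \<alpha> (s, x, y) d))"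
| cross:
    "\<lbrakk>s \<in> squares S; x \<in> {0..<1}; y \<in> {0..<1}; \<not> singular (pt S (s, x, y));
      develop S \<alpha> (s, x, y) (1 - x) = (s', 1, h);
      \<not> singular (pt S (right_of S s', 0, h));
      flows S \<alpha> jmp (pt S (jmp (right_of S s') h, 0, h)) t q\<rbrakk>
     \<Longrightarrow> flows S \<alpha> jmp (pt S (s, x, y)) (sqrt (1 + \<alpha>\<^sup>2) * (1 - x) + t) q"

definition geodesic :: "'s polysquare \<Rightarrow> real \<Rightarrow> 's point \<Rightarrow> real \<Rightarrow> 's point \<Rightarrow> bool" where
  "geodesic S \<alpha> = flows S \<alpha> (\<lambda>s h. s)"

text \<open>
  The barrier consists of the heights \<open>J\<close> on the left edge of the square \<open>b\<close>, which is also the right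
  edge of its left neighbour; its copy lies on the left edge of the square \<open>a\<close>.
\<close>

definition edge_part :: "'s polysquare \<Rightarrow> 's \<Rightarrow> real set \<Rightarrow> 's point set" where
  "edge_part S s J = {pt S (s, 0, h) | h. h \<in> J}"

definition same_horizontal_street :: "'s polysquare \<Rightarrow> 's \<Rightarrow> 's \<Rightarrow> bool" where
  "same_horizontal_street S s s' \<longleftrightarrow> (\<exists>k. (right_of S ^^ k) s = s')"

definition one_sided_barrier :: "'s polysquare \<Rightarrow> 's \<Rightarrow> 's \<Rightarrow> real set \<Rightarrow> bool" where
  "one_sided_barrier S a b J \<longleftrightarrow>
     a \<in> squares S \<and> b \<in> squares S \<and> a \<noteq> b \<and> same_horizontal_street S a b \<and>
     (\<exists>\<I>. finite \<I> \<and> \<I> \<noteq> {} \<and> J = \<Union>\<I> \<and>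
        (\<forall>I\<in>\<I>. is_interval I \<and> I \<subseteq> {0..<1} \<and> (\<exists>u\<in>I. \<exists>v\<in>I. u < v)))"

definition dissipative ::
  "'s polysquare \<Rightarrow> real \<Rightarrow> 's \<Rightarrow> 's \<Rightarrow> real set \<Rightarrow> 's point \<Rightarrow> real \<Rightarrow> 's point \<Rightarrow> bool" where
  "dissipative S \<alpha> a b J = flows S \<alpha> (\<lambda>s h. if s = b \<and> h \<in> J then a else s)"

definition dissipative_image ::
  "'s polysquare \<Rightarrow> real \<Rightarrow> 's \<Rightarrow> 's \<Rightarrow> real set \<Rightarrow> real \<Rightarrow> 's point set \<Rightarrow> 's point set" where
  "dissipative_image S \<alpha> a b J t D = {q. \<exists>p\<in>D. dissipative S \<alpha> a b J p t q}"

definition wandering ::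
  "'s polysquare \<Rightarrow> real \<Rightarrow> 's \<Rightarrow> 's \<Rightarrow> real set \<Rightarrow> 's point \<Rightarrow> bool" where
  "wandering S \<alpha> a b J p \<longleftrightarrow>
     (\<exists>D t\<^sub>0. openin (surface_topology S) D \<and> p \<in> D \<and> t\<^sub>0 \<ge> 0 \<and>
        (\<forall>t>t\<^sub>0. D \<inter> dissipative_image S \<alpha> a b J t D = {}))"

definition transient_set ::
  "'s polysquare \<Rightarrow> real \<Rightarrow> 's \<Rightarrow> 's \<Rightarrow> real set \<Rightarrow> 's point set" where
  "transient_set S \<alpha> a b J = {p \<in> surface S. wandering S \<alpha> a b J p}"

definition recurrent_set ::
  "'s polysquare \<Rightarrow> real \<Rightarrow> 's \<Rightarrow> 's \<Rightarrow> real set \<Rightarrow> 's point set" where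
  "recurrent_set S \<alpha> a b J = {p \<in> surface S. \<not> wandering S \<alpha> a b J p}"


section \<open>The extension process\<close>

definition left_edges :: "'s polysquare \<Rightarrow> 's point set" where
  "left_edges S = {pt S (s, 0, h) | s h. s \<in> squares S \<and> h \<in> {0..<1}}"

text \<open>
  The partial maps of the process (they are undefined on the geodesics that run into a singularity)
  are given by their graphs.
\<close>

definition discretization :: "'s polysquare \<Rightarrow> real \<Rightarrow> 's point \<Rightarrow> 's point \<Rightarrow> bool" where
  "discretization S \<alpha> p q \<longleftrightarrow>
     p \<in> left_edges S \<and> q \<in> left_edges S \<and>
     (\<exists>t>0. geodesic S \<alpha> p t q \<and>
        (\<forall>u r. 0 < u \<and> u < t \<and> geodesic S \<alpha> p u r \<longrightarrow> r \<notin> left_edges S))"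

definition first_return ::
  "'s polysquare \<Rightarrow> real \<Rightarrow> 's point set \<Rightarrow> 's point \<Rightarrow> 's point \<Rightarrow> bool" where
  "first_return S \<alpha> C p q \<longleftrightarrow>
     p \<in> C \<and> q \<in> C \<and>
     (\<exists>n\<ge>1. (discretization S \<alpha> ^^ n) p q \<and>
        (\<forall>m r. 1 \<le> m \<and> m < n \<and> (discretization S \<alpha> ^^ m) p r \<longrightarrow> r \<notin> C))"

definition first_return_strip ::
  "'s polysquare \<Rightarrow> real \<Rightarrow> 's point set \<Rightarrow> 's point set \<Rightarrow> 's point set" where
  "first_return_strip S \<alpha> C H =
     {q. \<exists>p\<in>H. \<exists>t\<ge>0. geodesic S \<alpha> p t q \<and>
        (\<forall>u r. 0 < u \<and> u < t \<and> geodesic S \<alpha> p u r \<longrightarrow> r \<notin> C)}"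

definition heights :: "'s polysquare \<Rightarrow> 's point set \<Rightarrow> real set" where
  "heights S H = {h \<in> {0..<1}. \<exists>s\<in>squares S. pt S (s, 0, h) \<in> H}"

definition barrier_and_copy :: "'s polysquare \<Rightarrow> 's \<Rightarrow> 's \<Rightarrow> real set \<Rightarrow> 's point set" where
  "barrier_and_copy S a b J = edge_part S a J \<union> edge_part S b J"

primrec extension_sets ::
  "'s polysquare \<Rightarrow> real \<Rightarrow> 's \<Rightarrow> 's \<Rightarrow> real set \<Rightarrow> nat \<Rightarrow> 's point set" where
  "extension_sets S \<alpha> a b J 0 = edge_part S a J"
| "extension_sets S \<alpha> a b J (Suc i) =
     edge_part S a (J \<inter> heights S {q. \<exists>p\<in>extension_sets S \<alpha> a b J i.
       first_return S \<alpha> (barrier_and_copy S a b J) p q})"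

lemma extension_sets_decreasing:
  "extension_sets S \<alpha> a b J (Suc i) \<subseteq> extension_sets S \<alpha> a b J i"
proof (induction i)
  case 0
  show ?case by (auto simp: edge_part_def)
next
  case (Suc i)
  then show ?case
    by (subst (1 2) extension_sets.simps(2)) (unfold edge_part_def heights_def, blast)
qed

definition limit_set :: "'s polysquare \<Rightarrow> real \<Rightarrow> 's \<Rightarrow> 's \<Rightarrow> real set \<Rightarrow> 's point set" where
  "limit_set S \<alpha> a b J = (\<Inter>i\<in>{1..}. extension_sets S \<alpha> a b J i)"

text \<open>One-dimensional Lebesgue null subsets of the vertical edges.\<close>

definition edge_null :: "'s polysquare \<Rightarrow> 's point set \<Rightarrow> bool" where
  "edge_null S H \<longleftrightarrow> (\<forall>s\<in>squares S. negligible {h \<in> {0..<1}. pt S (s, 0, h) \<in> H})"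

definition finite_process :: "'s polysquare \<Rightarrow> real \<Rightarrow> 's \<Rightarrow> 's \<Rightarrow> real set \<Rightarrow> bool" where
  "finite_process S \<alpha> a b J \<longleftrightarrow>
     (\<exists>i\<ge>1. edge_null S (extension_sets S \<alpha> a b J (i - 1) - extension_sets S \<alpha> a b J i))"


section \<open>Polygons on the surface\<close>

fun poly_path :: "(real \<times> real) list \<Rightarrow> real \<Rightarrow> real \<times> real" where
  "poly_path [] = linepath 0 0"
| "poly_path [v] = linepath v v"
| "poly_path [v, w] = linepath v w"
| "poly_path (v # w # vs) = linepath v w +++ poly_path (w # vs)"

text \<open>
  A planar polygon is a simple closed polygonal curve together with its interior; the list of its
  vertices begins and ends with the same vertex.
\<close>

definition planar_polygon :: "real \<Rightarrow> (real \<times> real) set \<Rightarrow> bool" where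
  "planar_polygon \<alpha> Q \<longleftrightarrow>
     (\<exists>vs. simple_path (poly_path vs) \<and> pathfinish (poly_path vs) = pathstart (poly_path vs) \<and>
        Q = path_image (poly_path vs) \<union> inside (path_image (poly_path vs)) \<and>
        (\<forall>i. Suc i < length vs \<longrightarrow>
           fst (vs ! Suc i) = fst (vs ! i) \<or>
           snd (vs ! Suc i) - snd (vs ! i) = \<alpha> * (fst (vs ! Suc i) - fst (vs ! i))))"

text \<open>
  A polygon on the surface is laid out in the plane, with the grid of unit squares matching the
  integer grid.  The surface is a branched covering of the unit torus; a continuous map that
  preserves the coordinates modulo 1 is a lift of the projection of the plane to the torus, and thus
  locally a translation.
\<close>

definition surface_polygon :: "'s polysquare \<Rightarrow> real \<Rightarrow> 's point set \<Rightarrow> bool" where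
  "surface_polygon S \<alpha> M \<longleftrightarrow>
     (\<exists>Q \<phi>. planar_polygon \<alpha> Q \<and>
        continuous_map (top_of_set Q) (surface_topology S) \<phi> \<and>
        (\<forall>(x, y)\<in>Q. \<exists>s\<in>squares S. \<phi> (x, y) = pt S (s, frac x, frac y)) \<and>
        inj_on \<phi> (interior Q) \<and> M = \<phi> ` Q)"

definition finite_union_of_polygons :: "'s polysquare \<Rightarrow> real \<Rightarrow> 's point set \<Rightarrow> bool" where
  "finite_union_of_polygons S \<alpha> M \<longleftrightarrow>
     (\<exists>\<M>. finite \<M> \<and> (\<forall>N\<in>\<M>. surface_polygon S \<alpha> N) \<and> equal_ae S M (\<Union>\<M>))"

end

(*
  Recording where flow lines cross the left edges turns both flows into skew products over the
  rotation by alpha, whose fibre maps act on the finite set of squares and are piecewise constant in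
  the height.  A monotone family of such fibrewise set maps stabilizes after finitely many steps off
  a countable set of heights: the smallest cardinality of an image is attained on an interval, which
  every rotation orbit enters within a bounded time.  For the dissipative flow this gives the core,
  the squares over each height that have preimages of all orders; finitely many steps suffice and
  the core is piecewise constant.  Off the core points wander, and on the core recurrence of the
  rotation and the pigeonhole principle produce returns.  For the geodesics that have avoided A in
  the past, the same stabilization yields an invariant piecewise constant family of sets of squares;
  its jumps could only sit at the vertices, so it is constant, and connectedness makes it empty.
  Hence almost every point has a last visit to A or B in its past, and whether it is recurrent can be
  read off there.
*)
theory Submission
  imports Defs
begin

section \<open>Rotations and piecewise constant fibre maps\<close>

text \<open>The dissipative step is neither injective nor measure preserving, so recurrence cannot
  be drawn from an invariant measure. Finiteness of the fibres takes over: the cardinality of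
  iterated images can drop only finitely often. The stabilization is stated for an abstract monotone
  \<open>F\<close> that does not raise cardinality because it is used twice: for images under the
  dissipative step, and for images under the geodesic step with the square \<open>a\<close> deleted
  over the heights in \<open>J\<close>.

  Null sets enter only through a countable set of heights that is closed under the rotation and
  under integer translations; every other height has an orbit free of vertices and of endpoints of
  \<open>J\<close>. Wandering, however, is a topological condition, and neighbourhoods contain
  exceptional heights. Hence escape is derived from inclusions that hold at every height, and nearby
  heights are compared through local constancy.

  One constant \<open>N\<close> bounds both the number of steps after which no return is possible
  off the core and the length of the extension process: each first return takes at least one step,
  so a height that survives \<open>i\<close> stages has preimages of order at least
  \<open>i\<close>.\<close>

definition int_translates :: "real set \<Rightarrow> real set" where
  "int_translates D = {x + of_int k | x k. x \<in> D}"

definition rotation_orbit :: "real \<Rightarrow> real set \<Rightarrow> real set" where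
  "rotation_orbit \<alpha> D = {x + of_int k + of_int j * \<alpha> | x k j. x \<in> D}"

lemma rotation_orbit_shift:
  "h + of_int k + of_int j * \<alpha> \<in> rotation_orbit \<alpha> D \<longleftrightarrow> h \<in> rotation_orbit \<alpha> D"
proof -
  have "h + of_int k + of_int j * \<alpha> \<in> rotation_orbit \<alpha> D" if "h \<in> rotation_orbit \<alpha> D" for h k j
  proof -
    from that obtain x m i where "x \<in> D" "h = x + of_int m + of_int i * \<alpha>"
      unfolding rotation_orbit_def by blast
    then have "h + of_int k + of_int j * \<alpha> = x + of_int (m + k) + of_int (i + j) * \<alpha>"
      by (simp add: algebra_simps)
    with \<open>x \<in> D\<close> show ?thesis unfolding rotation_orbit_def by blast
  qed
  from this[of h k j] this[of "h + of_int k + of_int j * \<alpha>" "- k" "- j"] show ?thesis by auto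
qed

lemma rotation_orbit_diff: "h - real n * \<alpha> \<in> rotation_orbit \<alpha> D \<longleftrightarrow> h \<in> rotation_orbit \<alpha> D"
  using rotation_orbit_shift[of h 0 "- int n" \<alpha> D] by simp

lemma rotation_orbit_add: "h + real n * \<alpha> \<in> rotation_orbit \<alpha> D \<longleftrightarrow> h \<in> rotation_orbit \<alpha> D"
  using rotation_orbit_shift[of h 0 "int n" \<alpha> D] by simp

lemma rotation_orbit_int: "h + of_int k \<in> rotation_orbit \<alpha> D \<longleftrightarrow> h \<in> rotation_orbit \<alpha> D"
  using rotation_orbit_shift[of h k 0 \<alpha> D] by simp

lemma rotation_orbit_frac: "frac h \<in> rotation_orbit \<alpha> D \<longleftrightarrow> h \<in> rotation_orbit \<alpha> D"
  using rotation_orbit_int[of "frac h" "\<lfloor>h\<rfloor>" \<alpha> D] by (simp add: frac_def)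

lemma int_translates_subset_orbit: "int_translates D \<subseteq> rotation_orbit \<alpha> D"
proof
  fix y assume "y \<in> int_translates D"
  then obtain x k where "x \<in> D" "y = x + of_int k + of_int 0 * \<alpha>"
    unfolding int_translates_def by auto
  then show "y \<in> rotation_orbit \<alpha> D" unfolding rotation_orbit_def by blast
qed

lemma countable_rotation_orbit:
  assumes "countable D"
  shows "countable (rotation_orbit \<alpha> D)"
proof -
  have "rotation_orbit \<alpha> D = (\<Union>x\<in>D. \<Union>k. range (\<lambda>j. x + of_int k + of_int j * \<alpha>))"
    unfolding rotation_orbit_def by auto
  with assms show ?thesis by simp
qed

text \<open>Kronecker's theorem gives each height some backward time of visit. The heights with a
  visit at time \<open>k\<close> form an open set, so compactness of the unit interval bounds the
  time for all heights at once.\<close>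

lemma uniform_rotation_hits:
  fixes \<alpha> u v :: real
  assumes "\<alpha> \<notin> \<rat>" "u < v"
  shows "\<exists>K. \<forall>h. \<exists>k\<le>K. \<exists>m::int. u < h - real k * \<alpha> + of_int m \<and> h - real k * \<alpha> + of_int m < v"
proof -
  define W where "W k = (\<Union>m::int. {u + real k * \<alpha> - of_int m<..<v + real k * \<alpha> - of_int m})" for k
  \<comment> \<open>Forward multiples of \<open>- \<alpha>\<close> are the backward times of the
    rotation by \<open>\<alpha>\<close>.\<close>
  have irr: "- \<alpha> \<notin> \<rat>" using assms(1) by (metis Rats_minus_iff)
  have cov: "\<exists>k. h \<in> W k" for h
  proof -
    have "(v - u) / 2 > 0" using assms by simp
    then obtain m k where "\<bar>of_int (int k) * (- \<alpha>) - of_int m - ((u + v) / 2 - h)\<bar> < (v - u) / 2"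
    proof -
      obtain k where k: "k > 0" "\<bar>frac (real k * (- \<alpha>)) - frac ((u + v) / 2 - h)\<bar> < (v - u) / 2"
        using Kronecker_approx_1_explicit[OF irr, of "frac ((u + v) / 2 - h)" "(v - u) / 2"]
          \<open>(v - u) / 2 > 0\<close> by (metis frac_ge_0 frac_lt_1 less_le)
      then have "\<bar>of_int (int k) * (- \<alpha>) - of_int (\<lfloor>real k * (- \<alpha>)\<rfloor> - \<lfloor>(u + v) / 2 - h\<rfloor>)
          - ((u + v) / 2 - h)\<bar> < (v - u) / 2"
        by (simp add: frac_def algebra_simps)
      then show ?thesis using that by blast
    qed
    then have "h \<in> {u + real k * \<alpha> - of_int (- m)<..<v + real k * \<alpha> - of_int (- m)}"
      by (simp add: abs_less_iff add_divide_distrib diff_divide_distrib)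
    then show ?thesis unfolding W_def by blast
  qed
  have "compact {0..1::real}" by simp
  moreover have "open (W k)" for k unfolding W_def by (intro open_UN ballI open_greaterThanLessThan)
  moreover have "{0..1} \<subseteq> (\<Union>k\<in>UNIV. W k)" using cov by blast
  ultimately obtain C where C: "finite C" "{0..1} \<subseteq> (\<Union>k\<in>C. W k)"
    by (metis compactE_image)
  have "\<exists>k\<le>Max C. \<exists>m::int. u < h - real k * \<alpha> + of_int m \<and> h - real k * \<alpha> + of_int m < v" for h
  proof -
    have "frac h \<in> {0..1}" by (simp add: frac_lt_1 less_imp_le)
    then obtain k m where k: "k \<in> C" "frac h \<in> {u + real k * \<alpha> - of_int m<..<v + real k * \<alpha> - of_int m}"
      using C(2) unfolding W_def by blast
    then have "u < h - real k * \<alpha> + of_int (m - \<lfloor>h\<rfloor>)" "h - real k * \<alpha> + of_int (m - \<lfloor>h\<rfloor>) < v"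
      by (auto simp: frac_def)
    moreover have "k \<le> Max C" using k C by simp
    ultimately show ?thesis by blast
  qed
  then show ?thesis by blast
qed

lemma eventually_nhds_shift:
  fixes h d :: real
  shows "eventually P (nhds (h - d)) \<longleftrightarrow> (\<forall>\<^sub>F h' in nhds h. P (h' - d))"
  by (simp add: filtermap_nhds_shift[symmetric] eventually_filtermap)

lemma eventually_nhds_shift_plus:
  fixes h d :: real
  shows "eventually P (nhds (h + d)) \<longleftrightarrow> (\<forall>\<^sub>F h' in nhds h. P (h' + d))"
  using eventually_nhds_shift[of P h "- d"] by simp

lemma periodic_int:
  fixes g :: "real \<Rightarrow> 'c"
  assumes "\<And>h. g (h + 1) = g h"
  shows "g (h + of_int k) = g h"
proof -
  have nat: "g (h + real n) = g h" for h n
    by (induction n) (use assms in \<open>simp_all add: add.assoc[symmetric] add.commute[of 1]\<close>)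
  show ?thesis
  proof (cases "k \<ge> 0")
    case True
    then show ?thesis using nat[of h "nat k"] by simp
  next
    case False
    then show ?thesis using nat[of "h + of_int k" "nat (- k)"] by simp
  qed
qed

section \<open>Stabilization of iterated images over an irrational rotation\<close>

locale rotation_images =
  fixes \<alpha> :: real and X :: "'s set" and F :: "real \<Rightarrow> 's set \<Rightarrow> 's set" and D :: "real set"
  assumes irrational: "\<alpha> \<notin> \<rat>"
    and finite_X: "finite X"
    and F_into: "A \<subseteq> X \<Longrightarrow> F h A \<subseteq> X"
    and F_mono: "A \<subseteq> B \<Longrightarrow> B \<subseteq> X \<Longrightarrow> F h A \<subseteq> F h B"
    and F_card: "A \<subseteq> X \<Longrightarrow> card (F h A) \<le> card A"
    and F_periodic: "F (h + 1) = F h"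
    and finite_D: "finite D"
    and F_locally_constant: "h \<notin> int_translates D \<Longrightarrow> \<forall>\<^sub>F h' in nhds h. F h' = F h"
begin

text \<open>\<open>F h\<close> leads from the fibre over \<open>h\<close> to the fibre over
  \<open>h + \<alpha>\<close>. Thus \<open>Z n h\<close> is what is left over \<open>h\<close> when
  the full fibre over \<open>h - n \<alpha>\<close> has been moved \<open>n\<close> steps.\<close>

primrec Z :: "nat \<Rightarrow> real \<Rightarrow> 's set" where
  "Z 0 h = X"
| "Z (Suc n) h = F (h - \<alpha>) (Z n (h - \<alpha>))"

lemma Z_into: "Z n h \<subseteq> X"
  by (induction n arbitrary: h) (simp_all add: F_into)

lemma finite_Z: "finite (Z n h)"
  using Z_into finite_X by (rule finite_subset)

lemma Z_Suc_subset: "Z (Suc n) h \<subseteq> Z n h"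
proof (induction n arbitrary: h)
  case 0
  then show ?case by (simp add: F_into)
next
  case (Suc n)
  then show ?case
    by (subst (1 2) Z.simps(2)) (rule F_mono, simp_all only: Z_into)
qed

lemma Z_antimono: "m \<le> n \<Longrightarrow> Z n h \<subseteq> Z m h"
  by (rule lift_Suc_antimono_le[of "\<lambda>n. Z n h"]) (rule Z_Suc_subset)

lemma Z_periodic: "Z n (h + 1) = Z n h"
proof (induction n arbitrary: h)
  case (Suc n)
  have "h + 1 - \<alpha> = h - \<alpha> + 1" by simp
  then show ?case by (simp only: Z.simps Suc F_periodic)
qed simp

lemma Z_int: "Z n (h + of_int k) = Z n h"
  by (rule periodic_int) (rule Z_periodic)

lemma Z_frac: "Z n (frac h) = Z n h"
  using Z_int[of n "frac h" "\<lfloor>h\<rfloor>"] by (simp add: frac_def)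

definition breakpoints :: "nat \<Rightarrow> real set" where
  "breakpoints n = (\<Union>k\<in>{1..n}. (\<lambda>x. x + real k * \<alpha>) ` D)"

lemma finite_breakpoints: "finite (breakpoints n)"
  by (simp add: breakpoints_def finite_D)

lemma Z_locally_constant:
  "h \<notin> int_translates (breakpoints n) \<Longrightarrow> \<forall>\<^sub>F h' in nhds h. Z n h' = Z n h"
proof (induction n arbitrary: h)
  case (Suc n)
  have "h - \<alpha> \<notin> int_translates (breakpoints n)"
  proof
    assume "h - \<alpha> \<in> int_translates (breakpoints n)"
    then obtain x k m where x: "x \<in> D" "k \<in> {1..n}" "h - \<alpha> = x + real k * \<alpha> + of_int m"
      unfolding int_translates_def breakpoints_def by blast
    then have "h = (x + real (Suc k) * \<alpha>) + of_int m" by (simp add: algebra_simps)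
    moreover have "x + real (Suc k) * \<alpha> \<in> breakpoints (Suc n)"
      unfolding breakpoints_def by (rule UN_I[of "Suc k"]) (use x in auto)
    ultimately show False using Suc.prems unfolding int_translates_def by blast
  qed
  from Suc.IH[OF this] have 1: "\<forall>\<^sub>F h' in nhds h. Z n (h' - \<alpha>) = Z n (h - \<alpha>)"
    by (simp add: eventually_nhds_shift)
  have "h - \<alpha> \<notin> int_translates D"
  proof
    assume "h - \<alpha> \<in> int_translates D"
    then obtain x m where x: "x \<in> D" "h - \<alpha> = x + of_int m"
      unfolding int_translates_def by blast
    then have "h = (x + real 1 * \<alpha>) + of_int m" by (simp add: algebra_simps)
    moreover have "x + real 1 * \<alpha> \<in> breakpoints (Suc n)"
      unfolding breakpoints_def by (rule UN_I[of "1"]) (use x in auto)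
    ultimately show False using Suc.prems unfolding int_translates_def by blast
  qed
  from F_locally_constant[OF this] have "\<forall>\<^sub>F h' in nhds h. F (h' - \<alpha>) = F (h - \<alpha>)"
    by (simp add: eventually_nhds_shift)
  with 1 show ?case by eventually_elim simp
qed simp

lemma breakpoints_subset_orbit: "int_translates (breakpoints n) \<subseteq> rotation_orbit \<alpha> D"
proof
  fix y assume "y \<in> int_translates (breakpoints n)"
  then obtain x k m where x: "x \<in> D" "y = x + of_int m + of_int (int k) * \<alpha>"
    unfolding int_translates_def breakpoints_def by (fastforce simp: algebra_simps)
  then show "y \<in> rotation_orbit \<alpha> D" unfolding rotation_orbit_def by blast
qed

lemma card_Z_add: "card (Z (n + k) h) \<le> card (Z n (h - real k * \<alpha>))"
proof (induction k arbitrary: h)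
  case (Suc k)
  have "card (Z (n + Suc k) h) \<le> card (Z (n + k) (h - \<alpha>))"
    by (simp add: F_card Z_into)
  also have "\<dots> \<le> card (Z n (h - real (Suc k) * \<alpha>))"
    using Suc[of "h - \<alpha>"] by (simp add: algebra_simps)
  finally show ?case .
qed simp

text \<open>Some backward orbit point within \<open>K\<close> steps lies where the cardinality is
  the minimum \<open>r\<close>; \<open>F\<close> cannot raise it on the way to \<open>h\<close>, and
  minimality forbids a smaller one. Nested finite sets of equal cardinality coincide. That
  \<open>r\<close> does not depend on the height is what later excludes any loss in a single
  step.\<close>

lemma Z_stabilizes:
  "\<exists>N r. \<forall>h. h \<notin> rotation_orbit \<alpha> D \<longrightarrow> (\<forall>n\<ge>N. Z n h = Z N h) \<and> card (Z N h) = r"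
proof -
  define E where "E = rotation_orbit \<alpha> D"
  have "countable E" unfolding E_def by (rule countable_rotation_orbit) (simp add: finite_D countable_finite)
  then obtain h1 where "h1 \<notin> E" using uncountable_UNIV_real by (metis UNIV_eq_I)
  \<comment> \<open>Depth and generic height are minimized together, so that \<open>r\<close> is a
    lower bound at every generic height and every depth.\<close>
  then obtain p where p: "snd p \<notin> E"
      "\<And>q. snd q \<notin> E \<Longrightarrow> card (Z (fst p) (snd p)) \<le> card (Z (fst q) (snd q))"
    using ex_has_least_nat[of "\<lambda>p. snd p \<notin> E" "(0, h1)" "\<lambda>p. card (Z (fst p) (snd p))"]
    by (metis snd_conv)
  define n0 h0 r where "n0 = fst p" and "h0 = snd p" and "r = card (Z n0 h0)"
  have h0: "h0 \<notin> E" and min: "\<And>n h. h \<notin> E \<Longrightarrow> r \<le> card (Z n h)"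
    using p(1) p(2)[of "(_, _)"] by (simp_all add: n0_def h0_def r_def)
  have "\<forall>\<^sub>F h' in nhds h0. Z n0 h' = Z n0 h0"
    by (rule Z_locally_constant) (use h0 breakpoints_subset_orbit E_def in blast)
  then obtain e where e: "e > 0" "\<And>h'. dist h' h0 < e \<Longrightarrow> Z n0 h' = Z n0 h0"
    unfolding eventually_nhds_metric by blast
  obtain K where K: "\<And>h. \<exists>k\<le>K. \<exists>m::int. h0 - e < h - real k * \<alpha> + of_int m \<and>
      h - real k * \<alpha> + of_int m < h0 + e"
    using uniform_rotation_hits[OF irrational, of "h0 - e" "h0 + e"] e(1) by auto
  have "Z n h = Z (n0 + K) h \<and> card (Z (n0 + K) h) = r" if h: "h \<notin> E" and n: "n \<ge> n0 + K" for h n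
  proof -
    obtain k and m :: int where k: "k \<le> K" "dist (h - real k * \<alpha> + of_int m) h0 < e"
      using K[of h] by (auto simp: dist_real_def abs_less_iff algebra_simps)
    have "card (Z (n0 + K) h) \<le> card (Z (n0 + k) h)"
      by (intro card_mono finite_Z Z_antimono) (use k in simp)
    also have "\<dots> \<le> card (Z n0 (h - real k * \<alpha> + of_int m))"
      using card_Z_add Z_int by simp
    also have "\<dots> = r" using e(2)[OF k(2)] by (simp add: r_def)
    finally have le: "card (Z (n0 + K) h) \<le> r" .
    have "Z n h \<subseteq> Z (n0 + K) h" using n by (rule Z_antimono)
    moreover have "card (Z (n0 + K) h) \<le> card (Z n h)" using le min[OF h, of n] by simp
    ultimately have "Z n h = Z (n0 + K) h" by (intro card_seteq finite_Z)
    with le min[OF h, of n] show ?thesis by simp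
  qed
  then show ?thesis unfolding E_def by blast
qed

end

section \<open>The skew product over the rotation\<close>

lemma floor_locally_constant:
  fixes h :: real
  assumes "h \<notin> \<int>"
  shows "\<forall>\<^sub>F h' in nhds h. \<lfloor>h'\<rfloor> = \<lfloor>h\<rfloor>"
proof -
  have "of_int \<lfloor>h\<rfloor> < h" using assms by (metis Ints_of_int floor_correct less_le)
  then have "h \<in> {of_int \<lfloor>h\<rfloor><..<of_int \<lfloor>h\<rfloor> + 1}" by simp
  then have "\<forall>\<^sub>F h' in nhds h. h' \<in> {of_int \<lfloor>h\<rfloor><..<of_int \<lfloor>h\<rfloor> + 1}"
    by (intro eventually_nhds_in_open) auto
  then show ?thesis by eventually_elim (auto intro!: floor_unique)
qed

lemma exists_generic:
  fixes u v :: real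
  assumes "countable E" "u < v"
  obtains x where "x \<notin> E" "u < x" "x < v"
proof -
  have "\<not> {u<..<v} \<subseteq> E"
    using assms uncountable_open_interval countable_subset by blast
  then obtain x where "x \<in> {u<..<v}" "x \<notin> E" by blast
  then show ?thesis using that by simp
qed

lemma irrational_int_multiple:
  fixes \<alpha> :: real
  assumes "\<alpha> \<notin> \<rat>" "of_int j * \<alpha> \<in> \<int>"
  shows "j = 0"
proof (rule ccontr)
  assume "j \<noteq> 0"
  then have "\<alpha> = (of_int j * \<alpha>) / of_int j" by simp
  moreover have "(of_int j * \<alpha>) / of_int j \<in> \<rat>"
    using assms(2) Ints_subset_Rats by (intro Rats_divide) auto
  ultimately show False using assms(1) by simp
qed

text \<open>The points \<open>c + n \<beta>\<close> are pairwise distinct modulo 1, so finitely many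
  classes cannot contain all of them.\<close>

lemma rotation_leaves_finite_set:
  fixes \<beta> :: real
  assumes "\<beta> \<notin> \<rat>" "finite B"
  shows "\<exists>n. c + real n * \<beta> \<notin> int_translates B"
proof (rule ccontr)
  assume "\<not> ?thesis"
  then have "\<forall>n. \<exists>x\<in>B. \<exists>k. c + real n * \<beta> = x + of_int k"
    unfolding int_translates_def by blast
  then obtain x k where x: "\<And>n. x n \<in> B" "\<And>n. c + real n * \<beta> = x n + of_int (k n)"
    by metis
  have "\<not> inj x"
    using assms(2) x(1) by (meson finite_subset image_subsetI infinite_UNIV_nat inj_on_finite)
  then obtain m n where "m \<noteq> n" "x m = x n" unfolding inj_def by blast
  then have "of_int (int m - int n) * \<beta> = of_int (k m - k n)"
    using x(2)[of m] x(2)[of n] by (simp add: algebra_simps)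
  then have "of_int (int m - int n) * \<beta> \<in> \<int>" by (metis Ints_of_int)
  from irrational_int_multiple[OF assms(1) this] \<open>m \<noteq> n\<close> show False by simp
qed

section \<open>Geodesic steps between left edges as fibre maps over the rotation\<close>

locale polysquare_rotation =
  fixes S :: "'s polysquare" and \<alpha> :: real
  assumes surface: "polysquare_surface S" and pos: "\<alpha> > 0" and irrational: "\<alpha> \<notin> \<rat>"
begin

text \<open>The difference of floors makes this 1-periodic in \<open>h\<close>; for \<open>h\<close>
  in \<open>[0,1)\<close> it is the number of top edges crossed on the way from a left edge to the
  next one.\<close>

definition fib :: "real \<Rightarrow> 's \<Rightarrow> 's" where
  "fib h s = right_of S ((above S ^^ nat (\<lfloor>h + \<alpha>\<rfloor> - \<lfloor>h\<rfloor>)) s)"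

text \<open>Jumps act on arrival only and never at time 0: a line that starts on the barrier leaves
  from its right side. Heights stay on the real line and are reduced modulo 1 only where
  \<open>jmp\<close> reads them.\<close>

primrec cocycle :: "('s \<Rightarrow> real \<Rightarrow> 's) \<Rightarrow> nat \<Rightarrow> real \<Rightarrow> 's \<Rightarrow> 's" where
  "cocycle jmp 0 h s = s"
| "cocycle jmp (Suc n) h s =
     jmp (fib (h + real n * \<alpha>) (cocycle jmp n h s)) (frac (h + real (Suc n) * \<alpha>))"

abbreviation no_jump :: "'s \<Rightarrow> real \<Rightarrow> 's" where
  "no_jump \<equiv> (\<lambda>s h. s)"

lemma cocycle_add: "cocycle jmp (m + n) h s = cocycle jmp m (h + real n * \<alpha>) (cocycle jmp n h s)"
  by (induction m) (simp_all add: algebra_simps)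

lemma finite_squares: "finite (squares S)"
  and bij_right: "bij_betw (right_of S) (squares S) (squares S)"
  and bij_above: "bij_betw (above S) (squares S) (squares S)"
  using surface by (auto simp: polysquare_surface_def)

lemma bij_above_power: "bij_betw (above S ^^ n) (squares S) (squares S)"
proof (induction n)
  case (Suc n)
  then show ?case using bij_betw_trans[OF Suc bij_above] by (simp add: comp_def)
qed (simp add: bij_betw_def)

lemma bij_fib: "bij_betw (fib h) (squares S) (squares S)"
  unfolding fib_def
  using bij_betw_trans[OF bij_above_power bij_right] by (simp add: comp_def)

lemma fib_in: "s \<in> squares S \<Longrightarrow> fib h s \<in> squares S"
  using bij_fib bij_betwE by blast

lemma fib_periodic: "fib (h + 1) = fib h"
proof -
  have "h + 1 + \<alpha> = (h + \<alpha>) + 1" by simp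
  then show ?thesis unfolding fib_def fun_eq_iff by (simp only: one_add_floor[symmetric]) simp
qed

lemma fib_int: "fib (h + of_int k) = fib h"
  by (rule periodic_int) (rule fib_periodic)

lemma fib_locally_constant:
  assumes "h \<notin> \<int>" "h + \<alpha> \<notin> \<int>"
  shows "\<forall>\<^sub>F h' in nhds h. fib h' = fib h"
proof -
  have "\<forall>\<^sub>F h' in nhds h. \<lfloor>h' + \<alpha>\<rfloor> = \<lfloor>h + \<alpha>\<rfloor>"
    using floor_locally_constant[OF assms(2)] by (simp add: eventually_nhds_shift_plus)
  with floor_locally_constant[OF assms(1)] show ?thesis
    by eventually_elim (simp add: fib_def fun_eq_iff)
qed

lemma frac_int: "frac (h + of_int k) = frac (h :: real)"
  by (simp add: frac_def)

lemma cocycle_int: "cocycle jmp n (h + of_int k) s = cocycle jmp n h s"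
proof (induction n)
  case (Suc n)
  have "h + of_int k + real m * \<alpha> = h + real m * \<alpha> + of_int k" for m by simp
  then show ?case by (simp only: cocycle.simps Suc fib_int frac_int)
qed simp

lemma cocycle_frac: "cocycle jmp n (frac h) s = cocycle jmp n h s"
  using cocycle_int[of jmp n "frac h" "\<lfloor>h\<rfloor>"] by (simp add: frac_def)

text \<open>
  The fibre maps may jump where \<open>h\<close> or \<open>h + \<alpha>\<close> is an integer, the barrier acts differently
  on the two sides of \<open>h\<close> if \<open>h + \<alpha>\<close> lies over the frontier of \<open>J\<close>.
\<close>

definition critical :: "real set \<Rightarrow> real set" where
  "critical J = {0, - \<alpha>} \<union> (\<lambda>x. x - \<alpha>) ` frontier J"

text \<open>The two-sided orbit is taken so that genericity is preserved in both directions of time;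
  it remains countable when the frontier of \<open>J\<close> is finite.\<close>

definition exceptional :: "real set \<Rightarrow> real set" where
  "exceptional J = rotation_orbit \<alpha> (critical J)"

lemma not_critical:
  assumes "h \<notin> int_translates (critical J)"
  shows "h \<notin> \<int>" "h + \<alpha> \<notin> \<int>" "frac (h + \<alpha>) \<notin> frontier J"
proof -
  have 1: "x \<in> critical J \<Longrightarrow> h \<noteq> x + of_int k" for x k
    using assms unfolding int_translates_def by blast
  show "h \<notin> \<int>"
    using 1[of 0] by (auto simp: critical_def Ints_def)
  show "h + \<alpha> \<notin> \<int>"
  proof
    assume "h + \<alpha> \<in> \<int>"
    then obtain k where "h = - \<alpha> + of_int k" by (auto elim!: Ints_cases simp: algebra_simps)
    then show False using 1[of "- \<alpha>" k] by (simp add: critical_def)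
  qed
  show "frac (h + \<alpha>) \<notin> frontier J"
  proof
    assume "frac (h + \<alpha>) \<in> frontier J"
    then have "frac (h + \<alpha>) - \<alpha> \<in> critical J" by (simp add: critical_def)
    from 1[OF this, of "\<lfloor>h + \<alpha>\<rfloor>"] show False by (simp add: frac_def)
  qed
qed

lemma countable_exceptional: "finite (frontier J) \<Longrightarrow> countable (exceptional J)"
  unfolding exceptional_def critical_def
  by (intro countable_rotation_orbit) (simp add: countable_finite)

lemma exceptional_diff: "h - real n * \<alpha> \<in> exceptional J \<longleftrightarrow> h \<in> exceptional J"
  and exceptional_add: "h + real n * \<alpha> \<in> exceptional J \<longleftrightarrow> h \<in> exceptional J"
  and exceptional_frac: "frac h \<in> exceptional J \<longleftrightarrow> h \<in> exceptional J"
  by (simp_all only: exceptional_def rotation_orbit_diff rotation_orbit_add rotation_orbit_frac)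

lemma exceptional_diff1: "h - \<alpha> \<in> exceptional J \<longleftrightarrow> h \<in> exceptional J"
  and exceptional_add1: "h + \<alpha> \<in> exceptional J \<longleftrightarrow> h \<in> exceptional J"
  using exceptional_diff[of h 1] exceptional_add[of h 1] by simp_all

lemma generic_not_critical: "h \<notin> exceptional J \<Longrightarrow> h \<notin> int_translates (critical J)"
  using int_translates_subset_orbit unfolding exceptional_def by blast

lemma generic_not_int: "h \<notin> exceptional J \<Longrightarrow> h \<notin> \<int>"
  using not_critical(1) generic_not_critical by blast

lemma member_locally_constant:
  fixes h :: real
  assumes "h \<notin> \<int>" "frac h \<notin> frontier J"
  shows "\<forall>\<^sub>F h' in nhds h. frac h' \<in> J \<longleftrightarrow> frac h \<in> J"
proof -
  have "\<forall>\<^sub>F x in nhds (frac h). x \<in> J \<longleftrightarrow> frac h \<in> J"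
  proof (cases "frac h \<in> J")
    case True
    then have "frac h \<in> interior J" using assms(2) closure_subset by (auto simp: frontier_def)
    then have "\<forall>\<^sub>F x in nhds (frac h). x \<in> interior J" by (intro eventually_nhds_in_open) auto
    then show ?thesis by eventually_elim (use True interior_subset in blast)
  next
    case False
    then have "frac h \<in> - closure J" using assms(2) interior_subset by (auto simp: frontier_def)
    then have "\<forall>\<^sub>F x in nhds (frac h). x \<in> - closure J" by (intro eventually_nhds_in_open) auto
    then show ?thesis by eventually_elim (use False closure_subset in blast)
  qed
  then have "\<forall>\<^sub>F h' in nhds h. h' - of_int \<lfloor>h\<rfloor> \<in> J \<longleftrightarrow> frac h \<in> J"
    unfolding frac_def by (rule eventually_nhds_shift[THEN iffD1])
  with floor_locally_constant[OF assms(1)] show ?thesis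
    by eventually_elim (simp add: frac_def)
qed

end

section \<open>Every geodesic meets a vertical interval in the past\<close>

context polysquare_rotation
begin

lemma equal_images:
  assumes "inj_on g X" "A \<subseteq> X" "B \<subseteq> X" "g ` A = g ` B"
  shows "A = B"
  using assms by (simp add: inj_on_image_eq_iff)

text \<open>Away from the vertices \<open>fib\<close> is locally constant and bijective, so the
  values of \<open>g\<close> near \<open>c\<close> and near \<open>c + \<alpha>\<close> determine
  each other. The common value \<open>W\<close> is quantified separately because \<open>c\<close>
  itself may be in \<open>E\<close>, where invariance is not assumed.\<close>

lemma locally_constant_along_orbit:
  fixes g :: "real \<Rightarrow> 's set" and E :: "real set"
  assumes sub: "\<And>h. g h \<subseteq> squares S"
    and inv: "\<And>h. h \<notin> E \<Longrightarrow> g (h + \<alpha>) = fib h ` g h"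
    and E: "\<And>h. h + \<alpha> \<in> E \<longleftrightarrow> h \<in> E"
    and c: "c \<notin> \<int>" "c + \<alpha> \<notin> \<int>"
  shows "(\<exists>W. \<forall>\<^sub>F x in nhds (c + \<alpha>). x \<notin> E \<longrightarrow> g x = W) \<longleftrightarrow>
    (\<exists>W. \<forall>\<^sub>F x in nhds c. x \<notin> E \<longrightarrow> g x = W)" (is "?L \<longleftrightarrow> ?R")
proof
  assume ?R
  then obtain W where "\<forall>\<^sub>F x in nhds c. x \<notin> E \<longrightarrow> g x = W" ..
  with fib_locally_constant[OF c] have "\<forall>\<^sub>F x in nhds c. x + \<alpha> \<notin> E \<longrightarrow> g (x + \<alpha>) = fib c ` W"
    by eventually_elim (simp add: E inv)
  then show ?L unfolding eventually_nhds_shift_plus by blast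
next
  assume ?L
  then obtain W where "\<forall>\<^sub>F x in nhds c. x + \<alpha> \<notin> E \<longrightarrow> g (x + \<alpha>) = W"
    unfolding eventually_nhds_shift_plus by blast
  with fib_locally_constant[OF c]
  have "\<forall>\<^sub>F x in nhds c. x \<notin> E \<longrightarrow> g x = {s \<in> squares S. fib c s \<in> W}"
  proof eventually_elim
    case (elim x)
    show ?case
    proof
      assume "x \<notin> E"
      then have "fib c ` g x = W" using elim inv[of x] E by simp
      moreover have "inj_on (fib c) (squares S)" using bij_fib by (simp add: bij_betw_def)
      ultimately show "g x = {s \<in> squares S. fib c s \<in> W}"
        using sub[of x] by (auto dest: inj_onD)
    qed
  qed
  then show ?R by blast
qed

lemma locally_constant_forward:
  fixes g :: "real \<Rightarrow> 's set" and E :: "real set"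
  assumes sub: "\<And>h. g h \<subseteq> squares S"
    and inv: "\<And>h. h \<notin> E \<Longrightarrow> g (h + \<alpha>) = fib h ` g h"
    and E: "\<And>h. h + \<alpha> \<in> E \<longleftrightarrow> h \<in> E"
  shows "(\<And>j. c + real j * \<alpha> \<notin> \<int>) \<Longrightarrow>
    \<exists>W. \<forall>\<^sub>F x in nhds (c + real n * \<alpha>). x \<notin> E \<longrightarrow> g x = W \<Longrightarrow>
    \<exists>W. \<forall>\<^sub>F x in nhds c. x \<notin> E \<longrightarrow> g x = W"
proof (induction n)
  case (Suc n)
  have "c + real (Suc n) * \<alpha> = (c + real n * \<alpha>) + \<alpha>" by (simp add: algebra_simps)
  moreover have "(c + real n * \<alpha>) + \<alpha> \<notin> \<int>"
    using Suc.prems(1)[of "Suc n"] by (simp add: algebra_simps)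
  ultimately show ?case
    using Suc.IH Suc.prems locally_constant_along_orbit[of g E "c + real n * \<alpha>", OF sub inv E]
    by metis
qed simp

lemma locally_constant_backward:
  fixes g :: "real \<Rightarrow> 's set" and E :: "real set"
  assumes sub: "\<And>h. g h \<subseteq> squares S"
    and inv: "\<And>h. h \<notin> E \<Longrightarrow> g (h + \<alpha>) = fib h ` g h"
    and E: "\<And>h. h + \<alpha> \<in> E \<longleftrightarrow> h \<in> E"
  shows "(\<And>j. c - real j * \<alpha> \<notin> \<int>) \<Longrightarrow>
    \<exists>W. \<forall>\<^sub>F x in nhds (c - real n * \<alpha>). x \<notin> E \<longrightarrow> g x = W \<Longrightarrow>
    \<exists>W. \<forall>\<^sub>F x in nhds c. x \<notin> E \<longrightarrow> g x = W"
proof (induction n)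
  case (Suc n)
  have "c - real n * \<alpha> = (c - real (Suc n) * \<alpha>) + \<alpha>" by (simp add: algebra_simps)
  moreover have "(c - real (Suc n) * \<alpha>) + \<alpha> \<notin> \<int>"
    using Suc.prems(1)[of "n"] by (simp add: algebra_simps)
  ultimately show ?case
    using Suc.IH Suc.prems locally_constant_along_orbit[of g E "c - real (Suc n) * \<alpha>", OF sub inv E]
    by metis
qed simp

text \<open>
  An invariant family of sets of squares that is piecewise constant can only jump at the vertices:
  any other jump propagates along the forward or the backward orbit, one of which avoids the
  vertices, to infinitely many heights.
\<close>

lemma invariant_sets_locally_constant:
  fixes g :: "real \<Rightarrow> 's set" and E B :: "real set"
  assumes sub: "\<And>h. g h \<subseteq> squares S"
    and inv: "\<And>h. h \<notin> E \<Longrightarrow> g (h + \<alpha>) = fib h ` g h"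
    and E: "\<And>h. h + \<alpha> \<in> E \<longleftrightarrow> h \<in> E"
    and B: "finite B" "\<And>h. h \<notin> int_translates B \<Longrightarrow> \<forall>\<^sub>F h' in nhds h. g h' = g h"
    and c: "c \<notin> \<int>"
  shows "\<exists>W. \<forall>\<^sub>F x in nhds c. x \<notin> E \<longrightarrow> g x = W"
proof (cases "\<exists>j. c + real j * \<alpha> \<in> \<int>")
  case False
  obtain n where "c + real n * \<alpha> \<notin> int_translates B"
    using rotation_leaves_finite_set[OF irrational B(1)] by blast
  then have "\<forall>\<^sub>F x in nhds (c + real n * \<alpha>). x \<notin> E \<longrightarrow> g x = g (c + real n * \<alpha>)"
    by (rule eventually_mono[OF B(2)]) simp
  then show ?thesis
    using locally_constant_forward[of g E c n, OF sub inv E] False by blast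
next
  case True
  then obtain j where j: "c + real j * \<alpha> \<in> \<int>" ..
  have backward_free: "c - real i * \<alpha> \<notin> \<int>" for i
  proof
    assume "c - real i * \<alpha> \<in> \<int>"
    with j have "(c + real j * \<alpha>) - (c - real i * \<alpha>) \<in> \<int>" by (rule Ints_diff)
    then have "of_int (int j + int i) * \<alpha> \<in> \<int>" by (simp add: algebra_simps)
    then have "int j + int i = 0" using irrational_int_multiple irrational by blast
    then have "j = 0" by simp
    with j c show False by simp
  qed
  have "- \<alpha> \<notin> \<rat>" using irrational by (metis Rats_minus_iff)
  then obtain n where "c + real n * (- \<alpha>) \<notin> int_translates B"
    using rotation_leaves_finite_set B(1) by blast
  then have "c - real n * \<alpha> \<notin> int_translates B" by simp
  then have "\<forall>\<^sub>F x in nhds (c - real n * \<alpha>). x \<notin> E \<longrightarrow> g x = g (c - real n * \<alpha>)"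
    by (rule eventually_mono[OF B(2)]) simp
  then show ?thesis
    using locally_constant_backward[of g E c n, OF sub inv E] backward_free by blast
qed

text \<open>Paths of adjacent squares cannot leave \<open>W\<close>. A step along a gluing stays in
  \<open>W\<close> by invariance; a step against it does so because the gluing is injective on all
  squares and already maps \<open>W\<close> onto \<open>W\<close>.\<close>

lemma invariant_set_of_squares:
  assumes "W \<subseteq> squares S" "W \<noteq> {}" "right_of S ` W = W" "above S ` W = W"
  shows "W = squares S"
proof
  obtain w where w: "w \<in> W" using assms(2) by blast
  have step: "y \<in> W" if "x \<in> W" "(x, y) \<in> adjacent S \<union> (adjacent S)\<inverse>" for x y
  proof (cases "(x, y) \<in> adjacent S")
    case True
    then show ?thesis using that assms(3,4) by (auto simp: adjacent_def)
  next
    case False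
    then have y: "y \<in> squares S" "x = right_of S y \<or> x = above S y"
      using that(2) by (auto simp: adjacent_def)
    have "y \<in> W" if "bij_betw f (squares S) (squares S)" "x = f y" "f ` W = W" for f
    proof -
      have "f y \<in> f ` W" using \<open>x \<in> W\<close> \<open>x = f y\<close> \<open>f ` W = W\<close> by simp
      then obtain z where "z \<in> W" "f z = f y" by (metis imageE)
      then show ?thesis using that(1) y(1) assms(1) by (metis bij_betw_def inj_onD subsetD)
    qed
    then show ?thesis using y(2) bij_right bij_above assms(3,4) by blast
  qed
  show "squares S \<subseteq> W"
  proof
    fix t assume "t \<in> squares S"
    with w assms(1) have "(w, t) \<in> (adjacent S \<union> (adjacent S)\<inverse>)\<^sup>*"
      using surface unfolding polysquare_surface_def by blast
    then show "t \<in> W" by (induction) (use w step in blast)+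
  qed
qed (use assms in blast)

text \<open>With possible jumps only at integers, \<open>g\<close> has one generic value
  \<open>W\<close>. Comparing two steps that differ by a single crossing of a top edge isolates
  invariance of \<open>W\<close> under \<open>above\<close>, then under \<open>right_of\<close>, and
  connectedness of the surface decides.\<close>

lemma invariant_sets_trivial:
  fixes g :: "real \<Rightarrow> 's set" and E B :: "real set"
  assumes sub: "\<And>h. g h \<subseteq> squares S"
    and inv: "\<And>h. h \<notin> E \<Longrightarrow> g (h + \<alpha>) = fib h ` g h"
    and E: "\<And>h. h + \<alpha> \<in> E \<longleftrightarrow> h \<in> E" "countable E" "\<And>h. frac h \<in> E \<longleftrightarrow> h \<in> E" "0 \<in> E"
    and B: "finite B" "\<And>h. h \<notin> int_translates B \<Longrightarrow> \<forall>\<^sub>F h' in nhds h. g h' = g h"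
    and per: "\<And>h. g (frac h) = g h"
  shows "(\<forall>h. h \<notin> E \<longrightarrow> g h = {}) \<or> (\<forall>h. h \<notin> E \<longrightarrow> g h = squares S)"
proof -
  have const: "g x = g y" if xy: "x \<in> {0<..<1}" "y \<in> {0<..<1}" "x \<notin> E" "y \<notin> E" for x y
  proof (rule connected_equivalence_relation_gen[of "{0<..<1::real}" x y "\<lambda>x. x \<notin> E"])
    show "\<exists>z. z \<in> T \<and> z \<notin> E" if "openin (top_of_set {0<..<1}) T" "a \<in> T" for T a
    proof -
      have "open T" using that(1) by (simp add: openin_open_eq)
      with that(2) obtain e where "e > 0" "ball a e \<subseteq> T" by (meson openE)
      moreover obtain z where "z \<notin> E" "a - e < z" "z < a + e"
        using exists_generic[OF E(2), of "a - e" "a + e"] \<open>e > 0\<close> by auto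
      ultimately show ?thesis by (auto simp: dist_real_def abs_less_iff intro!: exI[of _ z])
    qed
    fix c :: real assume c: "c \<in> {0<..<1}"
    then have "c \<notin> \<int>" by (auto simp: Ints_def)
    from invariant_sets_locally_constant[of g E B, OF sub inv E(1) B this]
    obtain W where "\<forall>\<^sub>F x in nhds c. x \<notin> E \<longrightarrow> g x = W" by blast
    then obtain T where T: "open T" "c \<in> T" "\<And>x. x \<in> T \<Longrightarrow> x \<notin> E \<Longrightarrow> g x = W"
      unfolding eventually_nhds by blast
    show "\<exists>T. openin (top_of_set {0<..<1}) T \<and> c \<in> T \<and>
        (\<forall>x\<in>T. \<forall>y\<in>T. x \<notin> E \<and> y \<notin> E \<longrightarrow> g x = g y)"
      by (rule exI[of _ "{0<..<1} \<inter> T"]) (use T c in \<open>auto intro!: openin_open_Int\<close>)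
  qed (use xy in auto)
  obtain x0 where x0: "x0 \<notin> E" "0 < x0" "x0 < 1"
    using exists_generic[OF E(2), of 0 1] by auto
  define W where "W = g x0"
  have unit: "g x = W" if "x \<in> {0<..<1}" "x \<notin> E" for x
    unfolding W_def by (rule const) (use that x0 in auto)
  have all: "g h = W" if "h \<notin> E" for h
  proof -
    have "frac h \<notin> E" using that E(3) by simp
    then have "frac h \<noteq> 0" using E(4) by metis
    then have "frac h \<in> {0<..<1}" by (simp add: frac_lt_1 order_less_le[of 0])
    from unit[OF this \<open>frac h \<notin> E\<close>] show ?thesis by (simp only: per)
  qed
  define k where "k = nat \<lfloor>\<alpha>\<rfloor>"
  have fa: "0 < frac \<alpha>" "frac \<alpha> < 1"
    using irrational by (auto simp: frac_lt_1 frac_gt_0_iff) (use Ints_subset_Rats in blast)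
  have fibW: "fib x ` W = W" if "x \<notin> E" for x
  proof -
    have "x + \<alpha> \<notin> E" using that E(1) by simp
    from inv[OF that] show ?thesis unfolding all[OF that] all[OF \<open>x + \<alpha> \<notin> E\<close>] ..
  qed
  \<comment> \<open>One step crosses \<open>k\<close> top edges from below
    \<open>1 - frac \<alpha>\<close> and \<open>k + 1\<close> from above it; a generic height is
    chosen on each side.\<close>
  obtain x1 where x1: "x1 \<notin> E" "0 < x1" "x1 < 1 - frac \<alpha>"
    using exists_generic[OF E(2), of 0 "1 - frac \<alpha>"] fa by auto
  obtain x2 where x2: "x2 \<notin> E" "1 - frac \<alpha> < x2" "x2 < 1"
    using exists_generic[OF E(2), of "1 - frac \<alpha>" 1] fa by auto
  have "\<lfloor>x1\<rfloor> = 0" "\<lfloor>x1 + \<alpha>\<rfloor> = \<lfloor>\<alpha>\<rfloor>" "\<lfloor>x2\<rfloor> = 0" "\<lfloor>x2 + \<alpha>\<rfloor> = \<lfloor>\<alpha>\<rfloor> + 1"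
    using x1 x2 fa unfolding frac_def by (linarith)+
  moreover have "nat (\<lfloor>\<alpha>\<rfloor> + 1) = Suc k" using pos by (simp add: k_def nat_add_distrib)
  ultimately have f1: "right_of S ` (above S ^^ k) ` W = W"
    and f2: "right_of S ` (above S ^^ k) ` above S ` W = W"
    using fibW[OF x1(1)] fibW[OF x2(1)]
    by (simp_all add: fib_def k_def image_image funpow_swap1)
  have Ws: "W \<subseteq> squares S" using sub W_def by simp
  have aW: "above S ` W \<subseteq> squares S" using Ws bij_above by (metis bij_betw_def image_mono)
  have kW: "(above S ^^ k) ` A \<subseteq> squares S" if "A \<subseteq> squares S" for A
    using that bij_above_power[of k] by (metis bij_betw_def image_mono)
  have "(above S ^^ k) ` above S ` W = (above S ^^ k) ` W"
    by (rule equal_images[of "right_of S" "squares S"])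
      (use f1 f2 bij_right kW aW Ws in \<open>simp_all add: bij_betw_def\<close>)
  from equal_images[OF _ aW Ws this] have aW_eq: "above S ` W = W"
    using bij_above_power[of k] by (simp add: bij_betw_def)
  have "(above S ^^ n) ` W = W" for n
  proof (induction n)
    case (Suc n)
    then show ?case using aW_eq by (metis funpow.simps(2) image_comp)
  qed simp
  then have "right_of S ` W = W" using f1 by simp
  then have "W = {} \<or> W = squares S"
    using invariant_set_of_squares Ws aW_eq by blast
  then show ?thesis using all by blast
qed

text \<open>With \<open>a\<close> deleted over \<open>J\<close>, the set \<open>I.Z n h\<close>
  consists of the squares over \<open>h\<close> whose backward geodesic has missed the copy at the
  last \<open>n\<close> crossings, the present one included. Its stable value is an invariant
  family, hence trivial, and the deletion prevents it from being full.\<close>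

lemma backward_orbit_hits:
  assumes J: "finite (frontier J)" "u < v" "{u<..<v} \<subseteq> J" "J \<subseteq> {0..<1}"
    and a: "a \<in> squares S" and s: "s \<in> squares S" and h: "h \<notin> exceptional J"
  shows "\<exists>n. cocycle no_jump n (h - real n * \<alpha>) a = s \<and> frac (h - real n * \<alpha>) \<in> J"
proof -
  define F where "F h A = fib h ` A - (if frac (h + \<alpha>) \<in> J then {a} else {})" for h A
  interpret I: rotation_images \<alpha> "squares S" F "critical J"
  proof
    show "\<alpha> \<notin> \<rat>" "finite (squares S)" using irrational finite_squares .
    show "F h A \<subseteq> squares S" if "A \<subseteq> squares S" for h A
      using that fib_in by (auto simp: F_def)
    show "F h A \<subseteq> F h C" if "A \<subseteq> C" "C \<subseteq> squares S" for h A C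
      using that by (auto simp: F_def)
    show "card (F h A) \<le> card A" if "A \<subseteq> squares S" for h A
    proof -
      have fin: "finite A" using that finite_squares finite_subset by blast
      then have "card (F h A) \<le> card (fib h ` A)" unfolding F_def by (intro card_mono) auto
      also have "\<dots> \<le> card A" using fin by (rule card_image_le)
      finally show ?thesis .
    qed
    show "F (h + 1) = F h" for h
    proof -
      have "frac (h + 1 + \<alpha>) = frac (h + \<alpha>)"
        using frac_int[of "h + \<alpha>" 1] by (simp add: algebra_simps)
      then show ?thesis by (simp add: F_def fun_eq_iff fib_periodic)
    qed
    show "finite (critical J)" using J(1) by (simp add: critical_def)
    show "\<forall>\<^sub>F h' in nhds h. F h' = F h" if "h \<notin> int_translates (critical J)" for h
    proof -
      note nc = not_critical[OF that]
      have "\<forall>\<^sub>F h' in nhds h. frac (h' + \<alpha>) \<in> J \<longleftrightarrow> frac (h + \<alpha>) \<in> J"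
        using member_locally_constant[OF nc(2,3)] by (simp add: eventually_nhds_shift_plus)
      with fib_locally_constant[OF nc(1,2)] show ?thesis
        by eventually_elim (simp add: F_def fun_eq_iff)
    qed
  qed
  define E where "E = exceptional J"
  note E_defs = E_def exceptional_def
  obtain N r where Nr: "\<And>h n. h \<notin> E \<Longrightarrow> n \<ge> N \<Longrightarrow> I.Z n h = I.Z N h"
      "\<And>h. h \<notin> E \<Longrightarrow> card (I.Z N h) = r"
    using I.Z_stabilizes unfolding E_defs by blast
  have step: "I.Z N (h + \<alpha>) = F h (I.Z N h)" if "h \<notin> E" for h
    using Nr(1)[of "h + \<alpha>" "Suc N"] that by (simp add: E_def exceptional_add1)
  \<comment> \<open>Both sides have cardinality at least \<open>r\<close>, and the image has at most
    \<open>r\<close> elements: the deletion removes nothing from a stable family.\<close>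
  have inv: "I.Z N (h + \<alpha>) = fib h ` I.Z N h" if "h \<notin> E" for h
  proof (rule card_seteq)
    show "finite (fib h ` I.Z N h)" by (simp add: I.finite_Z)
    show "I.Z N (h + \<alpha>) \<subseteq> fib h ` I.Z N h" using step[OF that] by (auto simp: F_def)
    have "h + \<alpha> \<notin> E" using that by (simp add: E_def exceptional_add1)
    then show "card (fib h ` I.Z N h) \<le> card (I.Z N (h + \<alpha>))"
      using Nr(2) that card_image_le[OF I.finite_Z] by metis
  qed
  have zero: "0 \<in> E"
    using generic_not_int[of 0 J] unfolding E_def by auto
  have "(\<forall>h. h \<notin> E \<longrightarrow> I.Z N h = {}) \<or> (\<forall>h. h \<notin> E \<longrightarrow> I.Z N h = squares S)"
    by (rule invariant_sets_trivial[of "I.Z N" E "I.breakpoints N"])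
      (use I.Z_into inv zero I.finite_breakpoints I.Z_locally_constant I.Z_frac
        countable_exceptional[OF J(1)] in \<open>simp_all add: E_def exceptional_add1 exceptional_frac\<close>)
  moreover obtain x where x: "x \<notin> E" "u < x" "x < v"
    using exists_generic[OF countable_exceptional[OF J(1)] J(2)] unfolding E_def by blast
  \<comment> \<open>Over a generic height inside \<open>J\<close> the square \<open>a\<close> has
    just been deleted, which rules out the full family.\<close>
  moreover have "a \<notin> I.Z N x"
  proof -
    have "x \<in> J" using x(2,3) J(3) by auto
    moreover have "frac x = x" using calculation J(4) by (auto simp: frac_eq)
    moreover have "I.Z N x = F (x - \<alpha>) (I.Z N (x - \<alpha>))"
      using step[of "x - \<alpha>"] x(1) by (simp add: E_def exceptional_diff1)
    ultimately show ?thesis by (auto simp: F_def)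
  qed
  ultimately have empty: "I.Z N h = {}" using a h unfolding E_def by blast
  \<comment> \<open>A square missing from \<open>I.Z n h\<close> must have been deleted somewhere on
    its backward orbit; the induction traces it back to that place.\<close>
  have "\<exists>k. cocycle no_jump k (h - real k * \<alpha>) a = s \<and> frac (h - real k * \<alpha>) \<in> J"
    if "s \<in> squares S" "s \<notin> I.Z n h" for s n h
    using that
  proof (induction n arbitrary: s h)
    case (Suc n)
    obtain t where t: "t \<in> squares S" "s = fib (h - \<alpha>) t"
      using Suc.prems(1) bij_fib by (metis bij_betw_def imageE)
    show ?case
    proof (cases "s = a \<and> frac h \<in> J")
      case True
      then show ?thesis by (intro exI[of _ 0]) simp
    next
      case False
      then have "t \<notin> I.Z n (h - \<alpha>)"
        using Suc.prems(2) t by (subst (asm) I.Z.simps) (auto simp: F_def split: if_splits)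
      from Suc.IH[OF t(1) this] obtain k where k: "cocycle no_jump k (h - \<alpha> - real k * \<alpha>) a = t"
          "frac (h - \<alpha> - real k * \<alpha>) \<in> J"
        by blast
      have *: "h - real (Suc k) * \<alpha> = h - \<alpha> - real k * \<alpha>" by (simp add: algebra_simps)
      have "cocycle no_jump (Suc k) (h - real (Suc k) * \<alpha>) a = s"
        unfolding * using k(1) t(2) by simp
      with k(2) show ?thesis unfolding * [symmetric] by blast
    qed
  qed simp
  from this[OF s, of N h] empty show ?thesis by simp
qed

end

section \<open>Points of the surface and flow lines\<close>

lemma pt_refl: "z \<in> pt S z"
  by (simp add: pt_def)

lemma pt_eqI:
  assumes "(z, w) \<in> gluing S"
  shows "pt S z = pt S w"
proof -
  let ?r = "gluing S \<union> (gluing S)\<inverse>"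
  have "(z, w) \<in> ?r\<^sup>*" "(w, z) \<in> ?r\<^sup>*" using assms by blast+
  then show ?thesis unfolding pt_def by (auto intro: rtrancl_trans)
qed

lemma pt_right: "s \<in> squares S \<Longrightarrow> y \<in> {0..1} \<Longrightarrow> pt S (s, 1, y) = pt S (right_of S s, 0, y)"
  by (rule pt_eqI) (auto simp: gluing_def)

lemma pt_above: "s \<in> squares S \<Longrightarrow> x \<in> {0..1} \<Longrightarrow> pt S (s, x, 1) = pt S (above S s, x, 0)"
  by (rule pt_eqI) (auto simp: gluing_def)

text \<open>
  A representative with coordinates in \<open>[0,1)\<close>; it is a complete invariant of the glued class away
  from the vertices, where the class may contain several squares.
\<close>

definition normal_form :: "'s polysquare \<Rightarrow> 's local_point \<Rightarrow> 's local_point option" where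
  "normal_form S z = (case z of (s, x, y) \<Rightarrow>
     if x \<in> {0, 1} \<and> y \<in> {0, 1} then None
     else if x = 1 then Some (right_of S s, 0, y)
     else if y = 1 then Some (above S s, x, 0)
     else Some (s, x, y))"

text \<open>Each of the three quantities is unchanged by a single gluing, hence constant on
  classes.\<close>

lemma mem_pt:
  assumes "w \<in> pt S z"
  shows "normal_form S w = normal_form S z"
    and "frac (fst (snd w)) = frac (fst (snd z))" "frac (snd (snd w)) = frac (snd (snd z))"
proof -
  have glue: "normal_form S v = normal_form S u \<and> frac (fst (snd v)) = frac (fst (snd u)) \<and>
      frac (snd (snd v)) = frac (snd (snd u))" if "(u, v) \<in> gluing S" for u v
    using that by (auto simp: gluing_def normal_form_def)
  have "(z, w) \<in> (gluing S \<union> (gluing S)\<inverse>)\<^sup>*" using assms by (simp add: pt_def)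
  then have "normal_form S w = normal_form S z \<and> frac (fst (snd w)) = frac (fst (snd z)) \<and>
      frac (snd (snd w)) = frac (snd (snd z))"
    by induction (use glue in fastforce)+
  then show "normal_form S w = normal_form S z" "frac (fst (snd w)) = frac (fst (snd z))"
    "frac (snd (snd w)) = frac (snd (snd z))" by blast+
qed

lemma not_singular_pt:
  assumes "x \<in> {0..<1}" "y \<in> {0..<1}" "x \<noteq> 0 \<or> y \<noteq> 0"
  shows "\<not> singular (pt S (s, x, y))"
proof
  assume "singular (pt S (s, x, y))"
  then obtain s' where "(s', 0, 0) \<in> pt S (s, x, y)" by (auto simp: singular_def)
  from mem_pt(1)[OF this] assms show False by (auto simp: normal_form_def split: if_splits)
qed

text \<open>Away from the corner the normal form recovers the square; at the corner a second square
  would be a witness of \<open>singular\<close>.\<close>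

lemma pt_inject:
  assumes "pt S (s, x, y) = pt S (s', x', y')" "\<not> singular (pt S (s, x, y))"
    and xy: "x \<in> {0..<1}" "y \<in> {0..<1}" "x' \<in> {0..<1}" "y' \<in> {0..<1}"
  shows "s = s' \<and> x = x' \<and> y = y'"
proof -
  have mem: "(s', x', y') \<in> pt S (s, x, y)" "(s, x, y) \<in> pt S (s, x, y)"
    using pt_refl assms(1) by metis+
  have "x' = x" "y' = y" using mem_pt(2,3)[OF mem(1)] xy by (simp_all add: frac_eq)
  moreover have "s = s'"
  proof (cases "x = 0 \<and> y = 0")
    case True
    with mem assms(2) \<open>x' = x\<close> \<open>y' = y\<close> show ?thesis unfolding singular_def by blast
  next
    case False
    with mem_pt(1)[OF mem(1)] xy \<open>x' = x\<close> \<open>y' = y\<close> show ?thesis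
      by (auto simp: normal_form_def split: if_splits)
  qed
  ultimately show ?thesis by simp
qed

section \<open>The flow in coordinates: entry square, entry height, horizontal displacement\<close>

context polysquare_rotation
begin

text \<open>A point is named by the left edge through which its line entered, not by the square
  containing it. Advancing by horizontal displacement 1 then changes only the first two coordinates,
  through the cocycle.\<close>

definition flow_point :: "'s \<Rightarrow> real \<Rightarrow> real \<Rightarrow> 's point" where
  "flow_point s h d = pt S (develop S \<alpha> (s, 0, h) d)"

lemma flow_point_eq:
  "flow_point s h d = pt S ((above S ^^ nat \<lfloor>h + \<alpha> * d\<rfloor>) s, d, frac (h + \<alpha> * d))"
  by (simp add: flow_point_def develop_def)

lemma flow_point_0: "h \<in> {0..<1} \<Longrightarrow> flow_point s h 0 = pt S (s, 0, h)"
  by (simp add: flow_point_eq floor_eq_iff frac_eq)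

lemma above_power_in: "s \<in> squares S \<Longrightarrow> (above S ^^ n) s \<in> squares S"
  using bij_above_power bij_betwE by blast

lemma not_int_unit:
  fixes h :: real
  assumes "0 < h" "h < 1"
  shows "h \<notin> \<int>"
  using assms by (auto elim!: Ints_cases)

lemma not_singular_flow_point:
  assumes "h \<in> {0..<1}" "d \<in> {0..<1}" "d \<noteq> 0 \<or> h \<noteq> 0"
  shows "\<not> singular (flow_point s h d)"
  unfolding flow_point_eq
  by (rule not_singular_pt) (use assms in \<open>auto simp: frac_lt_1 not_int_unit\<close>)

lemma frac_inject_unit:
  fixes h h' :: real
  assumes "frac (h + e) = frac (h' + e)" "h \<in> {0..<1}" "h' \<in> {0..<1}"
  shows "h = h'"
proof -
  have "h - h' = of_int (\<lfloor>h + e\<rfloor> - \<lfloor>h' + e\<rfloor>)" using assms(1) by (simp add: frac_def)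
  moreover have "\<bar>h - h'\<bar> < 1" using assms(2,3) by (auto simp: abs_less_iff)
  ultimately have "\<bar>\<lfloor>h + e\<rfloor> - \<lfloor>h' + e\<rfloor>\<bar> < 1" by (metis of_int_abs of_int_less_1_iff)
  with \<open>h - h' = _\<close> show ?thesis by simp
qed

text \<open>The displacement is visible as the first coordinate; the second then fixes the entry
  height modulo 1. Equal numbers of crossed top edges and injectivity of \<open>above\<close> give
  the entry square.\<close>

lemma flow_point_inject:
  assumes "flow_point s h d = flow_point s' h' d'" "\<not> singular (flow_point s h d)"
    and "s \<in> squares S" "s' \<in> squares S"
    and h: "h \<in> {0..<1}" "d \<in> {0..<1}" "h' \<in> {0..<1}" "d' \<in> {0..<1}"
  shows "s = s' \<and> h = h' \<and> d = d'"
proof -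
  have *: "(above S ^^ nat \<lfloor>h + \<alpha> * d\<rfloor>) s = (above S ^^ nat \<lfloor>h' + \<alpha> * d'\<rfloor>) s' \<and> d = d' \<and>
      frac (h + \<alpha> * d) = frac (h' + \<alpha> * d')"
    by (rule pt_inject) (use assms in \<open>auto simp: flow_point_eq frac_lt_1\<close>)
  then have "h = h'" using frac_inject_unit h by blast
  with * show ?thesis
    using bij_above_power assms(3,4) by (auto simp: bij_betw_def dest: inj_onD)
qed

text \<open>Going back along the slope to the left edge crosses
  \<open>- \<lfloor>y - \<alpha> * x\<rfloor>\<close> horizontal edges, and surjectivity of the
  power of \<open>above\<close> supplies the square in which this ends.\<close>

lemma flow_point_surj:
  assumes "s \<in> squares S" "x \<in> {0..<1}" "y \<in> {0..<1}"
  shows "\<exists>s0\<in>squares S. \<exists>h\<in>{0..<1}. develop S \<alpha> (s0, 0, h) x = (s, x, y) \<and> h = frac (y - \<alpha> * x)"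
proof -
  define h where "h = frac (y - \<alpha> * x)"
  obtain s0 where s0: "s0 \<in> squares S" "(above S ^^ nat (- \<lfloor>y - \<alpha> * x\<rfloor>)) s0 = s"
    using bij_above_power assms(1) by (metis bij_betw_def imageE)
  have hx: "h + \<alpha> * x = y + of_int (- \<lfloor>y - \<alpha> * x\<rfloor>)" by (simp add: h_def frac_def)
  have "\<lfloor>h + \<alpha> * x\<rfloor> = - \<lfloor>y - \<alpha> * x\<rfloor>" unfolding hx
    using assms(3) by (intro floor_unique) auto
  moreover have "frac (h + \<alpha> * x) = y" unfolding hx frac_int using assms(3) by (simp add: frac_eq)
  ultimately have "develop S \<alpha> (s0, 0, h) x = (s, x, y)" using s0 by (simp add: develop_def)
  moreover have "h \<in> {0..<1}" by (simp add: h_def frac_lt_1)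
  ultimately show ?thesis using s0(1) h_def by blast
qed

lemma develop_develop:
  assumes "h \<ge> 0" "x \<ge> 0" "d \<ge> 0"
  shows "develop S \<alpha> (develop S \<alpha> (s, 0, h) x) d = develop S \<alpha> (s, 0, h) (x + d)"
proof -
  define y where "y = h + \<alpha> * x"
  have y: "y \<ge> 0" "\<alpha> * d \<ge> 0" using assms pos by (simp_all add: y_def)
  have *: "frac y + \<alpha> * d = y + \<alpha> * d + of_int (- \<lfloor>y\<rfloor>)" by (simp add: frac_def)
  have f: "\<lfloor>frac y + \<alpha> * d\<rfloor> = \<lfloor>y + \<alpha> * d\<rfloor> - \<lfloor>y\<rfloor>" unfolding * by simp
  have le: "0 \<le> \<lfloor>y\<rfloor>" "\<lfloor>y\<rfloor> \<le> \<lfloor>y + \<alpha> * d\<rfloor>" using y by (auto intro: floor_mono)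
  then have "nat (\<lfloor>y + \<alpha> * d\<rfloor> - \<lfloor>y\<rfloor>) + nat \<lfloor>y\<rfloor> = nat \<lfloor>y + \<alpha> * d\<rfloor>" by linarith
  then have "(above S ^^ nat \<lfloor>frac y + \<alpha> * d\<rfloor>) ((above S ^^ nat \<lfloor>y\<rfloor>) s) =
      (above S ^^ nat \<lfloor>y + \<alpha> * d\<rfloor>) s"
    unfolding f by (metis comp_apply funpow_add)
  moreover have "frac (frac y + \<alpha> * d) = frac (y + \<alpha> * d)" unfolding * by (rule frac_int)
  moreover have "h + \<alpha> * (x + d) = y + \<alpha> * d" by (simp add: y_def algebra_simps)
  ultimately show ?thesis by (simp only: develop_def y_def[symmetric] prod.case add_0)
qed

lemma develop_full:
  assumes "h \<in> {0..<1}"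
  shows "develop S \<alpha> (s, 0, h) 1 = ((above S ^^ nat \<lfloor>h + \<alpha>\<rfloor>) s, 1, frac (h + \<alpha>))"
    and "right_of S ((above S ^^ nat \<lfloor>h + \<alpha>\<rfloor>) s) = fib h s"
proof -
  have "\<lfloor>h\<rfloor> = 0" using assms by (simp add: floor_eq_iff)
  then show "right_of S ((above S ^^ nat \<lfloor>h + \<alpha>\<rfloor>) s) = fib h s" by (simp add: fib_def)
qed (simp add: develop_def)

abbreviation speed :: real where "speed \<equiv> sqrt (1 + \<alpha>\<^sup>2)"

lemma speed_pos: "speed > 0"
  by (simp add: add_pos_nonneg)

lemma cocycle_in:
  assumes "\<And>s h. s \<in> squares S \<Longrightarrow> jmp s h \<in> squares S"
  shows "s \<in> squares S \<Longrightarrow> cocycle jmp n h s \<in> squares S"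
  by (induction n) (simp_all add: fib_in assms)

lemma cocycle_Suc_shift:
  "cocycle jmp (Suc n) h s =
     cocycle jmp n (frac (h + \<alpha>)) (jmp (fib h s) (frac (h + \<alpha>)))"
  using cocycle_add[of jmp n 1 h s] by (simp add: cocycle_frac)

lemma frac_Suc_shift: "frac (h + real (Suc n) * \<alpha>) = frac (frac (h + \<alpha>) + real n * \<alpha>)"
proof -
  have "frac (h + \<alpha>) + real n * \<alpha> = h + real (Suc n) * \<alpha> + of_int (- \<lfloor>h + \<alpha>\<rfloor>)"
    by (simp add: frac_def algebra_simps)
  then show ?thesis by (metis frac_int)
qed

text \<open>Each use of \<open>cross\<close> contributes one step of the cocycle; the
  non-singularity premises of the rules make the representative of the starting point unique. The
  result covers every flow line that exists, so also those at exceptional heights in a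
  neighbourhood.\<close>

lemma flows_decode:
  assumes "flows S \<alpha> jmp p t q"
    and jmp: "\<And>s h. s \<in> squares S \<Longrightarrow> jmp s h \<in> squares S"
    and "p = flow_point s h x" "s \<in> squares S" "h \<in> {0..<1}" "x \<in> {0..<1}"
  shows "\<exists>n d. d \<in> {0..<1} \<and> t = speed * (real n + d - x) \<and> (n = 0 \<longrightarrow> x \<le> d) \<and>
     q = flow_point (cocycle jmp n h s) (frac (h + real n * \<alpha>)) d"
  using assms(1,3-)
proof (induction arbitrary: s h x rule: flows.induct)
  case (within s0 x0 y0 d)
  have *: "(s0, x0, y0) = develop S \<alpha> (s, 0, h) x"
    using pt_inject[of S s0 x0 y0 "(above S ^^ nat \<lfloor>h + \<alpha> * x\<rfloor>) s" x "frac (h + \<alpha> * x)"] within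
    by (simp add: flow_point_eq develop_def frac_lt_1)
  then have "x0 = x" by (simp add: develop_def)
  have "develop S \<alpha> (s0, x0, y0) d = develop S \<alpha> (s, 0, h) (x + d)"
    unfolding * using within by (intro develop_develop) auto
  then show ?case
    by (intro exI[of _ 0] exI[of _ "x + d"])
      (use within \<open>x0 = x\<close> in \<open>auto simp: flow_point_def frac_eq\<close>)
next
  case (cross s0 x0 y0 s' h' t q)
  have *: "(s0, x0, y0) = develop S \<alpha> (s, 0, h) x"
    using pt_inject[of S s0 x0 y0 "(above S ^^ nat \<lfloor>h + \<alpha> * x\<rfloor>) s" x "frac (h + \<alpha> * x)"] cross
    by (simp add: flow_point_eq develop_def frac_lt_1)
  then have "x0 = x" by (simp add: develop_def)
  have "develop S \<alpha> (s0, x0, y0) (1 - x0) = develop S \<alpha> (s, 0, h) 1"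
    unfolding * using cross.prems \<open>x0 = x\<close> by (subst develop_develop) auto
  with cross.hyps(5) cross.prems have s': "right_of S s' = fib h s" "h' = frac (h + \<alpha>)"
    by (auto simp: develop_full)
  let ?s = "jmp (fib h s) (frac (h + \<alpha>))"
  have s: "?s \<in> squares S" using jmp fib_in cross.prems by blast
  have "pt S (jmp (right_of S s') h', 0, h') = flow_point ?s (frac (h + \<alpha>)) 0"
    using s' by (simp add: flow_point_0 frac_lt_1)
  from cross.IH[OF this s] obtain n d where nd: "d \<in> {0..<1}" "t = speed * (real n + d)"
      "q = flow_point (cocycle jmp n (frac (h + \<alpha>)) ?s) (frac (frac (h + \<alpha>) + real n * \<alpha>)) d"
    by (auto simp: frac_lt_1)
  show ?case
    by (intro exI[of _ "Suc n"] exI[of _ d])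
      (use nd \<open>x0 = x\<close> in \<open>simp only: cocycle_Suc_shift frac_Suc_shift, simp add: algebra_simps\<close>)
qed

text \<open>Converse of \<open>flows_decode\<close>: vertices occur only at integer heights of left
  edges, so a line whose forward heights avoid the integers never ends.\<close>

lemma flows_exist:
  assumes jmp: "\<And>s h. s \<in> squares S \<Longrightarrow> jmp s h \<in> squares S"
    and "d \<in> {0..<1}"
  shows "s \<in> squares S \<Longrightarrow> h \<in> {0..<1} \<Longrightarrow> x \<in> {0..<1} \<Longrightarrow> (n = 0 \<Longrightarrow> x \<le> d) \<Longrightarrow>
    (\<And>k. h + real k * \<alpha> \<notin> \<int>) \<Longrightarrow>
    flows S \<alpha> jmp (flow_point s h x) (speed * (real n + d - x))
      (flow_point (cocycle jmp n h s) (frac (h + real n * \<alpha>)) d)"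
proof (induction n arbitrary: s h x)
  case 0
  let ?z = "((above S ^^ nat \<lfloor>h + \<alpha> * x\<rfloor>) s, x, frac (h + \<alpha> * x))"
  have "h \<notin> \<int>" using 0(5)[of 0] by simp
  then have "h \<noteq> 0" by auto
  have "flows S \<alpha> jmp (pt S ?z) (speed * (d - x)) (pt S (develop S \<alpha> ?z (d - x)))"
    by (rule flows.within)
      (use 0 assms(2) not_singular_flow_point[of h x s] \<open>h \<noteq> 0\<close> above_power_in in
        \<open>auto simp: frac_lt_1 flow_point_eq\<close>)
  moreover have "develop S \<alpha> ?z (d - x) = develop S \<alpha> (s, 0, h) d"
    using develop_develop[of h x "d - x" s] 0 by (simp add: develop_def)
  moreover have "frac h = h" using 0 by (simp add: frac_eq)
  ultimately show ?case by (simp add: flow_point_def) (simp add: develop_def)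
next
  case (Suc n)
  let ?z = "((above S ^^ nat \<lfloor>h + \<alpha> * x\<rfloor>) s, x, frac (h + \<alpha> * x))"
  let ?s' = "(above S ^^ nat \<lfloor>h + \<alpha>\<rfloor>) s" and ?h' = "frac (h + \<alpha>)"
  have "h \<notin> \<int>" using Suc(6)[of 0] by simp
  then have "h \<noteq> 0" by auto
  have h': "?h' \<in> {0..<1}" "?h' \<noteq> 0" using Suc(6)[of 1] by (simp_all add: frac_lt_1)
  have R: "right_of S ?s' = fib h s" using develop_full(2) Suc(3) by simp
  have IH: "flows S \<alpha> jmp (flow_point (jmp (right_of S ?s') ?h') ?h' 0) (speed * (real n + d - 0))
      (flow_point (cocycle jmp n ?h' (jmp (right_of S ?s') ?h')) (frac (?h' + real n * \<alpha>)) d)"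
  proof (rule Suc.IH)
    show "jmp (right_of S ?s') ?h' \<in> squares S" using jmp R fib_in Suc(2) by simp
    show "?h' + real k * \<alpha> \<notin> \<int>" for k
      using Suc(6)[of "Suc k"] by (metis frac_Suc_shift frac_eq_0_iff)
  qed (use h' assms(2) in auto)
  have dev: "develop S \<alpha> ?z (1 - x) = (?s', 1, ?h')"
    using develop_develop[of h x "1 - x" s] Suc.prems develop_full(1)[of h s]
    by (simp add: develop_def)
  have "flows S \<alpha> jmp (pt S ?z) (speed * (1 - x) + speed * (real n + d - 0))
      (flow_point (cocycle jmp n ?h' (jmp (right_of S ?s') ?h')) (frac (?h' + real n * \<alpha>)) d)"
  proof (rule flows.cross[where s' = ?s' and h = ?h'])
    show "flows S \<alpha> jmp (pt S (jmp (right_of S ?s') ?h', 0, ?h')) (speed * (real n + d - 0))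
      (flow_point (cocycle jmp n ?h' (jmp (right_of S ?s') ?h')) (frac (?h' + real n * \<alpha>)) d)"
      using IH unfolding flow_point_0[OF h'(1)] .
    show "\<not> singular (pt S ?z)"
      using not_singular_flow_point[of h x s] Suc.prems \<open>h \<noteq> 0\<close> by (simp add: flow_point_eq)
    show "\<not> singular (pt S (right_of S ?s', 0, ?h'))"
      by (rule not_singular_pt) (use h' in auto)
  qed (use Suc.prems dev above_power_in in \<open>auto simp: frac_lt_1\<close>)
  then show ?case
    unfolding cocycle_Suc_shift frac_Suc_shift R flow_point_eq by (simp add: algebra_simps)
qed

text \<open>The points left unchecked lie on the edges of the squares or on countably many lines of
  slope \<open>\<alpha>\<close>, which together are negligible.\<close>

lemma equal_ae_generic:
  assumes "countable E" and E: "\<And>h. frac h \<in> E \<longleftrightarrow> h \<in> E"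
    and eq: "\<And>s h x. s \<in> squares S \<Longrightarrow> h \<in> {0..<1} \<Longrightarrow> h \<notin> E \<Longrightarrow> 0 < x \<Longrightarrow> x < 1 \<Longrightarrow>
      h + \<alpha> * x \<notin> \<int> \<Longrightarrow> flow_point s h x \<in> M \<longleftrightarrow> flow_point s h x \<in> N"
  shows "equal_ae S M N"
  unfolding equal_ae_def surface_null_def
proof
  fix s assume s: "s \<in> squares S"
  \<comment> \<open>\<open>?L a b e\<close> is the line where \<open>a\<close> times the first plus
    \<open>b\<close> times the second coordinate is \<open>e\<close>; for \<open>- \<alpha>\<close>
    and 1 it consists of the points whose line entered at height \<open>e\<close> modulo 1.\<close>
  let ?L = "\<lambda>a b e :: real. {z :: real \<times> real. (a, b) \<bullet> z = e}"
  have neg: "negligible (?L 1 0 0 \<union> ?L 1 0 1 \<union> ?L 0 1 0 \<union> ?L 0 1 1 \<union> (\<Union>e\<in>E. ?L (- \<alpha>) 1 e))"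
    using assms(1)
    by (intro negligible_Un negligible_countable_Union negligible_hyperplane countable_image)
      (auto simp: zero_prod_def intro!: negligible_hyperplane)
  show "negligible {(x, y). x \<in> {0..1} \<and> y \<in> {0..1} \<and> pt S (s, x, y) \<in> M - N \<union> (N - M)}"
  proof (rule negligible_subset[OF neg], rule subsetI, rule ccontr)
    fix z
    assume "z \<in> {(x, y). x \<in> {0..1} \<and> y \<in> {0..1} \<and> pt S (s, x, y) \<in> M - N \<union> (N - M)}"
      and n: "z \<notin> ?L 1 0 0 \<union> ?L 1 0 1 \<union> ?L 0 1 0 \<union> ?L 0 1 1 \<union> (\<Union>e\<in>E. ?L (- \<alpha>) 1 e)"
    then obtain x y where z: "z = (x, y)"
      and xy: "x \<in> {0..1}" "y \<in> {0..1}" and *: "pt S (s, x, y) \<in> M - N \<union> (N - M)"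
      by blast
    from n xy have xy': "0 < x" "x < 1" "0 < y" "y < 1" unfolding z by auto
    have "y - \<alpha> * x \<notin> E" using n unfolding z by auto
    obtain s0 h where s0: "s0 \<in> squares S" "h \<in> {0..<1}" "develop S \<alpha> (s0, 0, h) x = (s, x, y)"
        "h = frac (y - \<alpha> * x)"
      using flow_point_surj[of s x y] s xy' by auto
    then have "flow_point s0 h x = pt S (s, x, y)" "frac (h + \<alpha> * x) = y"
      by (auto simp: flow_point_def develop_def)
    moreover have "h \<notin> E" using \<open>y - \<alpha> * x \<notin> E\<close> s0(4) E by simp
    moreover have "h + \<alpha> * x \<notin> \<int>" using calculation(2) xy' by (auto simp flip: frac_eq_0_iff)
    ultimately show False using eq[of s0 h x] s0 xy' * by auto
  qed
qed

end

section \<open>Wandering points\<close>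

lemma finite_frontier_interval:
  fixes I :: "real set"
  assumes "is_interval I" "I \<subseteq> {c..d}"
  shows "finite (frontier I)"
proof (cases "I = {}")
  case False
  have bdd: "bdd_above I" "bdd_below I" 
    by (meson assms(2) bdd_above_Icc bdd_above_mono, meson assms(2) bdd_below_Icc bdd_below_mono)
  have "I \<subseteq> {Inf I..Sup I}" using bdd by (auto intro: cInf_lower cSup_upper)
  then have "closure I \<subseteq> {Inf I..Sup I}" by (simp add: closure_minimal)
  moreover have "{Inf I<..<Sup I} \<subseteq> I"
  proof
    fix x assume "x \<in> {Inf I<..<Sup I}"
    then obtain p q where "p \<in> I" "p < x" "q \<in> I" "x < q"
      using False bdd by (auto simp: cInf_less_iff less_cSup_iff)
    then show "x \<in> I" using assms(1) by (meson is_interval_1 less_imp_le)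
  qed
  then have "{Inf I<..<Sup I} \<subseteq> interior I" by (simp add: interior_maximal)
  ultimately have "frontier I \<subseteq> {Inf I, Sup I}"
    unfolding frontier_def by force
  then show ?thesis by (rule finite_subset) simp
qed simp

lemma finite_frontier_Union:
  assumes "finite \<I>" "\<And>I. I \<in> \<I> \<Longrightarrow> finite (frontier I)"
  shows "finite (frontier (\<Union>\<I>))"
  using assms
proof (induction \<I>)
  case (insert I \<I>)
  have "frontier (I \<union> \<Union>\<I>) \<subseteq> frontier I \<union> frontier (\<Union>\<I>)" by (rule frontier_Un_subset)
  with insert show ?case by (auto intro: finite_subset)
qed simp

section \<open>The dissipative step, its core, and the wandering points\<close>

locale barrier = polysquare_rotation S \<alpha> for S :: "'s polysquare" and \<alpha> :: real +
  fixes a b :: 's and J :: "real set"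
  assumes barrier: "one_sided_barrier S a b J"
begin

definition jump :: "'s \<Rightarrow> real \<Rightarrow> 's" where
  "jump s h = (if s = b \<and> h \<in> J then a else s)"

lemma a_in: "a \<in> squares S" and b_in: "b \<in> squares S" and a_neq_b: "a \<noteq> b"
  using barrier by (simp_all add: one_sided_barrier_def)

lemma J_subset: "J \<subseteq> {0..<1}"
  using barrier unfolding one_sided_barrier_def by blast

lemma J_interval: "\<exists>u v. u < v \<and> {u<..<v} \<subseteq> J"
proof -
  obtain \<I> where \<I>: "\<I> \<noteq> {}" "J = \<Union>\<I>"
      "\<forall>I\<in>\<I>. is_interval I \<and> I \<subseteq> {0..<1} \<and> (\<exists>u\<in>I. \<exists>v\<in>I. u < v)"
    using barrier unfolding one_sided_barrier_def by blast
  then obtain I u v where I: "I \<in> \<I>" "is_interval I" "u \<in> I" "v \<in> I" "u < v" by blast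
  have "{u<..<v} \<subseteq> I"
  proof
    fix x assume "x \<in> {u<..<v}"
    then show "x \<in> I" using I(2-4) by (meson greaterThanLessThan_iff is_interval_1 less_imp_le)
  qed
  then have "{u<..<v} \<subseteq> J" using I(1) \<I>(2) by blast
  with \<open>u < v\<close> show ?thesis by blast
qed

lemma finite_frontier_J: "finite (frontier J)"
proof -
  obtain \<I> where \<I>: "finite \<I>" "J = \<Union>\<I>" "\<And>I. I \<in> \<I> \<Longrightarrow> is_interval I \<and> I \<subseteq> {0..<1}"
    using barrier unfolding one_sided_barrier_def by blast
  have "finite (frontier I)" if "I \<in> \<I>" for I
  proof (rule finite_frontier_interval)
    show "I \<subseteq> {0..1}" using \<I>(3)[OF that] by force
  qed (use \<I>(3)[OF that] in blast)
  with \<I>(1,2) show ?thesis by (simp add: finite_frontier_Union)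
qed

lemma jump_in: "s \<in> squares S \<Longrightarrow> jump s h \<in> squares S"
  by (simp add: jump_def a_in)

abbreviation E :: "real set" where "E \<equiv> exceptional J"

lemma countable_E: "countable E"
  by (rule countable_exceptional) (rule finite_frontier_J)

definition step :: "real \<Rightarrow> 's \<Rightarrow> 's" where
  "step h s = jump (fib h s) (frac (h + \<alpha>))"

sublocale I: rotation_images \<alpha> "squares S" "\<lambda>h A. step h ` A" "critical J"
proof
  show "\<alpha> \<notin> \<rat>" "finite (squares S)" using irrational finite_squares .
  show "step h ` A \<subseteq> squares S" if "A \<subseteq> squares S" for h A
    using that fib_in jump_in by (auto simp: step_def)
  show "step h ` A \<subseteq> step h ` C" if "A \<subseteq> C" "C \<subseteq> squares S" for h A C
    using that by auto
  show "card (step h ` A) \<le> card A" if "A \<subseteq> squares S" for h A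
    using that finite_squares finite_subset by (blast intro: card_image_le)
  show "(`) (step (h + 1)) = (`) (step h)" for h
  proof -
    have "frac (h + 1 + \<alpha>) = frac (h + \<alpha>)"
      using frac_int[of "h + \<alpha>" 1] by (simp add: algebra_simps)
    then have "step (h + 1) = step h" by (simp add: step_def fun_eq_iff fib_periodic)
    then show ?thesis by simp
  qed
  show "finite (critical J)" using finite_frontier_J by (simp add: critical_def)
  show "\<forall>\<^sub>F h' in nhds h. (`) (step h') = (`) (step h)" if "h \<notin> int_translates (critical J)" for h
  proof -
    note nc = not_critical[OF that]
    have "\<forall>\<^sub>F h' in nhds h. frac (h' + \<alpha>) \<in> J \<longleftrightarrow> frac (h + \<alpha>) \<in> J"
      using member_locally_constant[OF nc(2,3)] by (simp add: eventually_nhds_shift_plus)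
    with fib_locally_constant[OF nc(1,2)] have "\<forall>\<^sub>F h' in nhds h. step h' = step h"
      by eventually_elim (simp add: step_def jump_def fun_eq_iff)
    then show ?thesis by eventually_elim simp
  qed
qed

text \<open>A stabilization depth uniform in the generic heights; its existence is
  \<open>Z_stabilizes\<close>.\<close>

definition N :: nat where
  "N = (SOME N. \<forall>h. h \<notin> E \<longrightarrow> (\<forall>n\<ge>N. I.Z n h = I.Z N h))"

definition core :: "real \<Rightarrow> 's set" where
  "core h = I.Z N h"

lemma Z_core: "h \<notin> E \<Longrightarrow> n \<ge> N \<Longrightarrow> I.Z n h = core h"
proof -
  have "\<exists>N. \<forall>h. h \<notin> E \<longrightarrow> (\<forall>n\<ge>N. I.Z n h = I.Z N h)"
    using I.Z_stabilizes unfolding exceptional_def by blast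
  from someI_ex[OF this] show "h \<notin> E \<Longrightarrow> n \<ge> N \<Longrightarrow> I.Z n h = core h"
    unfolding core_def N_def[symmetric] by blast
qed

text \<open>The image of the core is the set of depth \<open>Suc N\<close>, which stability
  identifies with the core over the next height.\<close>

lemma core_step: "h \<notin> E \<Longrightarrow> core (h + \<alpha>) = step h ` core h"
  using Z_core[of "h + \<alpha>" "Suc N"] by (simp add: exceptional_add1 core_def)

lemma core_frac: "core (frac h) = core h"
  by (simp add: core_def I.Z_frac)

lemma core_subset: "core h \<subseteq> squares S"
  by (simp add: core_def I.Z_into)

lemma core_locally_constant: "h \<notin> E \<Longrightarrow> \<forall>\<^sub>F h' in nhds h. core h' = core h"
  unfolding core_def
  by (rule I.Z_locally_constant) (use I.breakpoints_subset_orbit exceptional_def in blast)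

lemma cocycle_Suc_step: "cocycle jump (Suc n) h s = step (h + real n * \<alpha>) (cocycle jump n h s)"
  by (simp add: step_def algebra_simps)

text \<open>Available at every height; this is what makes it applicable to arbitrary points of a
  neighbourhood.\<close>

lemma cocycle_in_Z: "s \<in> squares S \<Longrightarrow> cocycle jump n h s \<in> I.Z n (h + real n * \<alpha>)"
proof (induction n)
  case (Suc n)
  have "h + real (Suc n) * \<alpha> - \<alpha> = h + real n * \<alpha>" by (simp add: algebra_simps)
  with Suc show ?case by (simp only: I.Z.simps cocycle_Suc_step) blast
qed simp

lemma core_cocycle: "h \<notin> E \<Longrightarrow> core (h + real n * \<alpha>) = cocycle jump n h ` core h"
proof (induction n)
  case (Suc n)
  have "h + real (Suc n) * \<alpha> = (h + real n * \<alpha>) + \<alpha>" by (simp add: algebra_simps)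
  moreover have "h + real n * \<alpha> \<notin> E" using Suc.prems by (simp add: exceptional_add)
  ultimately have "core (h + real (Suc n) * \<alpha>) = step (h + real n * \<alpha>) ` core (h + real n * \<alpha>)"
    using core_step by metis
  with Suc show ?case by (simp add: cocycle_Suc_step image_image del: cocycle.simps)
qed simp

lemma generic_unit: "h \<in> {0..<1} \<Longrightarrow> h \<notin> E \<Longrightarrow> 0 < h \<and> h < 1"
  using generic_not_int[of h J] by (auto simp: less_le)

lemma generic_orbit_not_int: "h \<notin> E \<Longrightarrow> h + real k * \<alpha> \<notin> \<int>"
  using generic_not_int[of "h + real k * \<alpha>" J] by (simp add: exceptional_add)

lemma dissipative_eq: "dissipative S \<alpha> a b J = flows S \<alpha> jump"
  by (simp add: dissipative_def jump_def[abs_def])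

text \<open>The class of an interior point of a square has a single representative, so the set is
  saturated for the gluing.\<close>

lemma open_square_neighbourhood:
  assumes s: "s \<in> squares S" and U: "open U" "U \<subseteq> {0<..<1} \<times> {0<..<1}"
  shows "openin (surface_topology S) (pt S ` ({s} \<times> U))"
proof -
  have U': "U \<subseteq> {0..1} \<times> {0..1}"
    by (rule subset_trans[OF U(2)]) auto
  then have sub: "{s} \<times> U \<subseteq> local_points S"
    using s unfolding local_points_def by blast
  have "z \<in> {s} \<times> U" if z: "pt S z \<in> pt S ` ({s} \<times> U)" for z
  proof -
    obtain x y where xy: "(x, y) \<in> U" "pt S z = pt S (s, x, y)" using z by auto
    then have "0 < x" "x < 1" "0 < y" "y < 1" using U(2) by auto
    moreover have "normal_form S z = normal_form S (s, x, y)"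
      using mem_pt(1)[of z S "(s, x, y)"] pt_refl[of z S] xy(2) by simp
    ultimately show ?thesis
      using xy(1) by (cases z) (auto simp: normal_form_def split: if_splits)
  qed
  then have "{z \<in> local_points S. pt S z \<in> pt S ` ({s} \<times> U)} = {s} \<times> U"
    using sub by blast
  moreover have "openin (local_topology S) ({s} \<times> U)"
    unfolding local_topology_def openin_prod_Times_iff
    using s open_subset[OF U' U(1)] by simp
  moreover have "pt S ` ({s} \<times> U) \<subseteq> surface S"
    unfolding surface_def using sub by (rule image_mono)
  ultimately show ?thesis by (simp only: openin_surface_topology)
qed

text \<open>The number of crossed top edges is constant near \<open>h\<close>, so changing only the
  entry height moves the point inside one square, where a product neighbourhood is
  available.\<close>

lemma open_contains_nearby:
  assumes D: "openin (surface_topology S) D" "flow_point s h x \<in> D"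
    and s: "s \<in> squares S" and x: "0 < x" "x < 1" and n: "h + \<alpha> * x \<notin> \<int>"
  shows "\<forall>\<^sub>F h' in nhds h. flow_point s h' x \<in> D"
proof -
  define k s' where "k = \<lfloor>h + \<alpha> * x\<rfloor>" and "s' = (above S ^^ nat k) s"
  let ?V = "{z \<in> local_points S. pt S z \<in> D}"
  have s': "s' \<in> squares S" using s above_power_in by (simp add: s'_def)
  have y: "frac (h + \<alpha> * x) = h + \<alpha> * x - of_int k" by (simp add: frac_def k_def)
  have "openin (local_topology S) ?V" using D(1) openin_surface_topology by blast
  then have V: "openin (prod_topology (discrete_topology (squares S)) (top_of_set ({0..1} \<times> {0..1}))) ?V"
    by (simp add: local_topology_def)
  have "pt S (s', x, frac (h + \<alpha> * x)) \<in> D"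
    using D(2) by (simp add: flow_point_eq s'_def k_def)
  then have mem: "(s', x, frac (h + \<alpha> * x)) \<in> ?V"
    using s' x by (simp add: local_points_def less_imp_le frac_lt_1)
  obtain A W where W: "s' \<in> A" "openin (top_of_set ({0..1} \<times> {0..1})) W"
      "(x, frac (h + \<alpha> * x)) \<in> W" "A \<times> W \<subseteq> ?V"
    using V[unfolded openin_prod_topology_alt, rule_format, OF mem] by (elim exE conjE)
  obtain W' where W': "open W'" "W = ({0..1} \<times> {0..1}) \<inter> W'"
    using W(2) by (auto simp: openin_open)
  have "((\<lambda>h'. (x, h' + \<alpha> * x - of_int k)) \<longlongrightarrow> (x, h + \<alpha> * x - of_int k)) (nhds h)"
    by (intro tendsto_intros filterlim_ident)
  moreover have "(x, h + \<alpha> * x - of_int k) \<in> W'" using W(3) W'(2) y by simp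
  ultimately have "\<forall>\<^sub>F h' in nhds h. (x, h' + \<alpha> * x - of_int k) \<in> W'"
    using W'(1) by (metis topological_tendstoD)
  moreover have "\<forall>\<^sub>F h' in nhds h. \<lfloor>h' + \<alpha> * x\<rfloor> = k"
    using floor_locally_constant[OF n] by (simp add: eventually_nhds_shift_plus k_def)
  ultimately show ?thesis
  proof eventually_elim
    case (elim h')
    then have fr: "frac (h' + \<alpha> * x) = h' + \<alpha> * x - of_int k" by (simp add: frac_def)
    then have "(x, frac (h' + \<alpha> * x)) \<in> W"
      using elim x W'(2) frac_lt_1[of "h' + \<alpha> * x"] frac_ge_0[of "h' + \<alpha> * x"]
      by (simp add: less_imp_le)
    then have "(s', x, frac (h' + \<alpha> * x)) \<in> ?V" using W by blast
    then show ?case using elim by (simp add: flow_point_eq s'_def)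
  qed
qed

text \<open>A late return would put \<open>s\<close> into \<open>I.Z n\<close>, hence into the core,
  at a height near \<open>h\<close>, where the core is the same as at \<open>h\<close>.\<close>

lemma wandering_outside_core:
  assumes s: "s \<in> squares S" "s \<notin> core h" and h: "h \<in> {0..<1}" "h \<notin> E"
    and x: "0 < x" "x < 1" and n: "h + \<alpha> * x \<notin> \<int>"
  shows "wandering S \<alpha> a b J (flow_point s h x)"
proof -
  obtain e where e: "e > 0" "\<And>h'. \<bar>h' - h\<bar> < e \<Longrightarrow> core h' = core h"
    using core_locally_constant[OF h(2)] unfolding eventually_nhds_metric dist_real_def by blast
  define k s' where "k = \<lfloor>h + \<alpha> * x\<rfloor>" and "s' = (above S ^^ nat k) s"
  \<comment> \<open>For a point \<open>(x, y)\<close> of \<open>s'\<close>, the quantity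
    \<open>y + k - \<alpha> x\<close> is its entry height into \<open>s\<close>. Keeping it near
    \<open>h\<close> and inside the unit interval makes every point of \<open>D\<close> a flow point
    with the one entry square \<open>s\<close>.\<close>
  define U where "U = ({0<..<1} \<times> {0<..<1}) \<inter>
    {z. \<bar>snd z + of_int k - \<alpha> * fst z - h\<bar> < e} \<inter>
    {z. 0 < snd z + of_int k - \<alpha> * fst z} \<inter> {z :: real \<times> real. snd z + of_int k - \<alpha> * fst z < 1}"
  define D where "D = pt S ` ({s'} \<times> U)"
  have s': "s' \<in> squares S" using s above_power_in by (simp add: s'_def)
  have "open U" unfolding U_def
    by (intro open_Int open_Times open_greaterThanLessThan open_Collect_less continuous_intros)
  then have "openin (surface_topology S) D"
    unfolding D_def by (intro open_square_neighbourhood s') (auto simp: U_def)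
  moreover have "flow_point s h x \<in> D"
  proof -
    have "0 < frac (h + \<alpha> * x)" using n by (simp add: frac_gt_0_iff)
    then have "(x, frac (h + \<alpha> * x)) \<in> U"
      using x e(1) generic_unit[OF h] frac_lt_1[of "h + \<alpha> * x"]
      by (auto simp: U_def frac_def k_def)
    then show ?thesis by (auto simp: D_def flow_point_eq s'_def k_def)
  qed
  moreover have D_mem: "\<exists>h' x'. 0 < h' \<and> h' < 1 \<and> \<bar>h' - h\<bar> < e \<and> 0 < x' \<and> x' < 1 \<and>
      p = flow_point s h' x'" if p: "p \<in> D" for p
  proof -
    obtain x' y' where xy: "(x', y') \<in> U" "p = pt S (s', x', y')"
      using p by (auto simp: D_def)
    define h' where "h' = y' + of_int k - \<alpha> * x'"
    have "\<lfloor>h' + \<alpha> * x'\<rfloor> = k" "frac (h' + \<alpha> * x') = y'"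
      using xy(1) by (auto simp: h'_def U_def frac_def floor_eq_iff)
    then have "p = flow_point s h' x'" using xy(2) by (simp add: flow_point_eq s'_def)
    with xy(1) show ?thesis by (intro exI[of _ h'] exI[of _ x']) (auto simp: h'_def U_def)
  qed
  \<comment> \<open>A time \<open>t\<close> corresponds to displacement \<open>n + d - x1\<close>
    with \<open>d < 1\<close> and \<open>x1 > 0\<close>, so the extra 1 in the bound ensures
    \<open>n \<ge> N\<close>.\<close>
  moreover have "D \<inter> dissipative_image S \<alpha> a b J t D = {}" if t: "t > speed * real (N + 1)" for t
  proof (rule ccontr)
    assume "D \<inter> dissipative_image S \<alpha> a b J t D \<noteq> {}"
    then obtain p q where pq: "p \<in> D" "q \<in> D" "flows S \<alpha> jump p t q"
      by (auto simp: dissipative_image_def dissipative_eq)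
    obtain h1 x1 where p: "0 < h1" "h1 < 1" "0 < x1" "x1 < 1" "p = flow_point s h1 x1"
      using D_mem[OF pq(1)] by blast
    obtain h2 x2 where q: "0 < h2" "h2 < 1" "\<bar>h2 - h\<bar> < e" "0 < x2" "x2 < 1" "q = flow_point s h2 x2"
      using D_mem[OF pq(2)] by blast
    obtain n d where nd: "d \<in> {0..<1}" "t = speed * (real n + d - x1)"
        "q = flow_point (cocycle jump n h1 s) (frac (h1 + real n * \<alpha>)) d"
      using flows_decode[OF pq(3) jump_in p(5) s(1)] p by auto
    have "real n + d - x1 > real (N + 1)"
      using t speed_pos unfolding nd(2) by (simp only: mult_less_cancel_left_pos)
    then have "n \<ge> N" using nd(1) p by simp
    have "s = cocycle jump n h1 s \<and> h2 = frac (h1 + real n * \<alpha>) \<and> x2 = d"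
      by (rule flow_point_inject)
        (use q nd s cocycle_in[OF jump_in] not_singular_flow_point[of h2 x2 s] in
          \<open>auto simp: frac_lt_1\<close>)
    then have "s \<in> I.Z n h2" using cocycle_in_Z[OF s(1), of n h1] by (metis I.Z_frac)
    then have "s \<in> core h2" using I.Z_antimono[OF \<open>n \<ge> N\<close>] by (auto simp: core_def)
    then show False using e(2)[OF q(3)] s(2) by simp
  qed
  moreover have "0 \<le> speed * real (N + 1)" by simp
  ultimately show ?thesis unfolding wandering_def by blast
qed

text \<open>The visiting time is bounded uniformly in the height; starting from
  \<open>- (M + 1) \<alpha>\<close> it yields a close return later than any given
  \<open>M\<close>.\<close>

lemma infinite_return_times:
  assumes "e > 0"
  shows "infinite {n :: nat. \<exists>m :: int. \<bar>real n * \<alpha> - of_int m\<bar> < e}" (is "infinite ?G")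
proof -
  obtain K where K: "\<And>h. \<exists>k\<le>K. \<exists>m::int. - e < h - real k * \<alpha> + of_int m \<and>
      h - real k * \<alpha> + of_int m < e"
    using uniform_rotation_hits[OF irrational, of "- e" e] assms by auto
  have "\<exists>n>M. n \<in> ?G" for M
  proof -
    obtain k m where "- e < - real (Suc M) * \<alpha> - real k * \<alpha> + of_int m"
        "- real (Suc M) * \<alpha> - real k * \<alpha> + of_int m < e"
      using K[of "- real (Suc M) * \<alpha>"] by blast
    then have "Suc M + k \<in> ?G" by (auto simp: abs_less_iff algebra_simps intro!: exI[of _ m])
    then show ?thesis by (intro exI[of _ "Suc M + k"]) simp
  qed
  then show ?thesis unfolding infinite_nat_iff_unbounded by blast
qed

text \<open>
  Along infinitely many close returns the fibre maps permute the core; two returns that carry the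
  same square to \<open>s\<close> give an orbit from near \<open>(s, h)\<close> back to near \<open>(s, h)\<close>.
\<close>

lemma not_wandering_core:
  assumes s: "s \<in> core h" and h: "h \<in> {0..<1}" "h \<notin> E"
    and x: "0 < x" "x < 1" and n: "h + \<alpha> * x \<notin> \<int>"
  shows "\<not> wandering S \<alpha> a b J (flow_point s h x)"
proof
  assume "wandering S \<alpha> a b J (flow_point s h x)"
  then obtain D t0 where D: "openin (surface_topology S) D" "flow_point s h x \<in> D" "t0 \<ge> 0"
      "\<And>t. t > t0 \<Longrightarrow> D \<inter> dissipative_image S \<alpha> a b J t D = {}"
    unfolding wandering_def by blast
  have sS: "s \<in> squares S" using s core_subset by blast
  have "\<forall>\<^sub>F h' in nhds h. h' \<in> {0<..<1}"
    by (rule eventually_nhds_in_open) (use generic_unit[OF h] in auto)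
  with open_contains_nearby[OF D(1,2) sS x n] core_locally_constant[OF h(2)]
  have "\<forall>\<^sub>F h' in nhds h. flow_point s h' x \<in> D \<and> core h' = core h \<and> 0 < h' \<and> h' < 1"
    by eventually_elim auto
  then obtain e where e: "e > 0" "\<And>h'. \<bar>h' - h\<bar> < e \<Longrightarrow>
      flow_point s h' x \<in> D \<and> core h' = core h \<and> 0 < h' \<and> h' < 1"
    unfolding eventually_nhds_metric dist_real_def by blast
  define G where "G = {n :: nat. \<exists>m :: int. \<bar>real n * \<alpha> - of_int m\<bar> < e}"
  have ret: "flow_point s (frac (h + real n * \<alpha>)) x \<in> D \<and> core (h + real n * \<alpha>) = core h"
    if "n \<in> G" for n
  proof -
    obtain m :: int where "\<bar>real n * \<alpha> - of_int m\<bar> < e" using \<open>n \<in> G\<close> G_def by blast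
    then have "\<bar>(h + real n * \<alpha> - of_int m) - h\<bar> < e" by simp
    note near = e(2)[OF this]
    have "frac (h + real n * \<alpha>) = h + real n * \<alpha> - of_int m"
      using near frac_int[of "h + real n * \<alpha>" "- m"] by (simp add: frac_eq)
    with near show ?thesis by (metis core_frac)
  qed
  have "\<forall>n\<in>G. \<exists>r\<in>core h. cocycle jump n h r = s"
  proof
    fix n assume "n \<in> G"
    then have "s \<in> cocycle jump n h ` core h" using ret s core_cocycle[OF h(2)] by metis
    then show "\<exists>r\<in>core h. cocycle jump n h r = s" by blast
  qed
  then obtain r where r: "\<And>n. n \<in> G \<Longrightarrow> r n \<in> core h" "\<And>n. n \<in> G \<Longrightarrow> cocycle jump n h (r n) = s"
    by metis
  have "finite (r ` G)"
    using r(1) core_subset finite_squares by (meson finite_subset image_subsetI subset_trans)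
  then obtain n where n: "n \<in> G" "infinite {m \<in> G. r m = r n}"
    using pigeonhole_infinite infinite_return_times[OF e(1)] G_def by blast
  obtain M :: nat where M: "t0 / speed < real M" using reals_Archimedean2 by blast
  obtain m where m: "m > n + M" "m \<in> G" "r m = r n"
    using n(2) unfolding infinite_nat_iff_unbounded by blast
  define h1 where "h1 = frac (h + real n * \<alpha>)"
  have mn: "m = (m - n) + n" using m(1) by simp
  have "s = cocycle jump (m - n) h1 s"
    using r(2)[OF m(2)] r(2)[OF n(1)] m(3) cocycle_add[of jump "m - n" n h "r n"] mn
    by (simp add: h1_def cocycle_frac)
  moreover have "frac (h1 + real (m - n) * \<alpha>) = frac (h + real m * \<alpha>)"
  proof -
    have "h1 + real (m - n) * \<alpha> = h + real m * \<alpha> + of_int (- \<lfloor>h + real n * \<alpha>\<rfloor>)"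
      using m(1) by (simp add: h1_def frac_def of_nat_diff algebra_simps)
    then show ?thesis by (simp only: frac_int)
  qed
  moreover have "h1 \<notin> E" using h(2) by (simp add: h1_def exceptional_frac exceptional_add)
  ultimately have "flows S \<alpha> jump (flow_point s h1 x) (speed * (real (m - n) + x - x))
      (flow_point s (frac (h + real m * \<alpha>)) x)"
    using flows_exist[of jump x s h1 x "m - n", OF jump_in _ sS] x generic_orbit_not_int[of h1]
    by (simp add: h1_def frac_lt_1)
  moreover have "speed * (real (m - n) + x - x) > t0"
  proof -
    have "t0 / speed < real (m - n)" using M m(1) by linarith
    then show ?thesis using speed_pos by (simp add: divide_less_eq mult.commute)
  qed
  ultimately have "flow_point s (frac (h + real m * \<alpha>)) x \<in>
      D \<inter> dissipative_image S \<alpha> a b J (speed * (real (m - n) + x - x)) D"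
    using ret[OF n(1)] ret[OF m(2)] unfolding dissipative_image_def dissipative_eq h1_def by blast
  with D(4)[OF \<open>speed * _ > t0\<close>] show False by blast
qed

lemma wandering_iff:
  assumes "s \<in> squares S" "h \<in> {0..<1}" "h \<notin> E" "0 < x" "x < 1" "h + \<alpha> * x \<notin> \<int>"
  shows "wandering S \<alpha> a b J (flow_point s h x) \<longleftrightarrow> s \<notin> core h"
  using assms wandering_outside_core not_wandering_core by blast

end

section \<open>First return strips and the extension process\<close>

context polysquare_rotation
begin

lemma inj_cocycle: "inj_on (cocycle no_jump n h) (squares S)"
proof (induction n)
  case (Suc n)
  show ?case
  proof (rule inj_onI)
    fix s s' assume *: "s \<in> squares S" "s' \<in> squares S" "cocycle no_jump (Suc n) h s = cocycle no_jump (Suc n) h s'"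
    have "inj_on (fib (h + real n * \<alpha>)) (squares S)" using bij_fib by (simp add: bij_betw_def)
    then have "cocycle no_jump n h s = cocycle no_jump n h s'"
      using * cocycle_in[of no_jump] by (auto dest: inj_onD)
    then show "s = s'" using Suc * by (auto dest: inj_onD)
  qed
qed simp

lemma left_edge_point: "s \<in> squares S \<Longrightarrow> h \<in> {0..<1} \<Longrightarrow> flow_point s h 0 \<in> left_edges S"
  by (auto simp: left_edges_def flow_point_0)

lemma not_left_edge:
  assumes "flow_point s h d \<in> left_edges S" "d \<in> {0..<1}"
  shows "d = 0"
proof -
  obtain s' h' where "flow_point s h d = pt S (s', 0, h')" using assms(1) by (auto simp: left_edges_def)
  then have "((above S ^^ nat \<lfloor>h + \<alpha> * d\<rfloor>) s, d, frac (h + \<alpha> * d)) \<in> pt S (s', 0, h')"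
    using pt_refl unfolding flow_point_eq by metis
  from mem_pt(2)[OF this] show ?thesis using assms(2) not_int_unit[of d] by (cases "d = 0") auto
qed

lemma geodesic_decode:
  assumes "geodesic S \<alpha> (pt S (s, 0, h)) t q" "s \<in> squares S" "h \<in> {0..<1}"
  shows "\<exists>n d. d \<in> {0..<1} \<and> t = speed * (real n + d) \<and>
     q = flow_point (cocycle no_jump n h s) (frac (h + real n * \<alpha>)) d"
proof -
  have "\<exists>n d. d \<in> {0..<1} \<and> t = speed * (real n + d - 0) \<and> (n = 0 \<longrightarrow> 0 \<le> d) \<and>
     q = flow_point (cocycle no_jump n h s) (frac (h + real n * \<alpha>)) d"
    by (rule flows_decode[OF assms(1)[unfolded geodesic_def]])
      (simp_all add: assms(2) assms(3)[simplified] flow_point_0)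
  then show ?thesis unfolding diff_0_right by blast
qed

lemma geodesic_exists:
  assumes "s \<in> squares S" "h \<in> {0..<1}" "\<And>k. h + real k * \<alpha> \<notin> \<int>" "d \<in> {0..<1}"
  shows "geodesic S \<alpha> (pt S (s, 0, h)) (speed * (real n + d))
    (flow_point (cocycle no_jump n h s) (frac (h + real n * \<alpha>)) d)"
proof -
  have "flows S \<alpha> no_jump (flow_point s h 0) (speed * (real n + d - 0))
      (flow_point (cocycle no_jump n h s) (frac (h + real n * \<alpha>)) d)"
    by (rule flows_exist) (use assms in simp_all)
  then show ?thesis unfolding geodesic_def flow_point_0[OF assms(2)] diff_0_right .
qed

lemma discretization_decode:
  assumes "discretization S \<alpha> (pt S (s, 0, h)) q" "s \<in> squares S" "h \<in> {0..<1}"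
  shows "\<exists>n\<ge>1. q = pt S (cocycle no_jump n h s, 0, frac (h + real n * \<alpha>))"
proof -
  obtain t where t: "t > 0" "geodesic S \<alpha> (pt S (s, 0, h)) t q" "q \<in> left_edges S"
    using assms(1) unfolding discretization_def by blast
  obtain n d where nd: "d \<in> {0..<1}" "t = speed * (real n + d)"
      "q = flow_point (cocycle no_jump n h s) (frac (h + real n * \<alpha>)) d"
    using geodesic_decode[OF t(2) assms(2,3)] by blast
  have "d = 0" using not_left_edge nd t(3) by blast
  moreover have "n \<ge> 1" using t(1) nd(2) \<open>d = 0\<close> by (cases n) auto
  ultimately show ?thesis using nd(3) by (auto simp: flow_point_0 frac_lt_1)
qed

text \<open>Points of left edges occur only at integral displacement, and the first of them is never
  blocked by a vertex.\<close>

lemma discretization_generic: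
  assumes s: "s \<in> squares S" and h: "h \<in> {0..<1}" and gen: "\<And>k. h + real k * \<alpha> \<notin> \<int>"
  shows "discretization S \<alpha> (pt S (s, 0, h)) q \<longleftrightarrow> q = pt S (fib h s, 0, frac (h + \<alpha>))"
proof
  assume d: "discretization S \<alpha> (pt S (s, 0, h)) q"
  then obtain t where t: "t > 0" "geodesic S \<alpha> (pt S (s, 0, h)) t q" "q \<in> left_edges S"
    "\<And>u r. 0 < u \<Longrightarrow> u < t \<Longrightarrow> geodesic S \<alpha> (pt S (s, 0, h)) u r \<Longrightarrow> r \<notin> left_edges S"
    unfolding discretization_def by blast
  obtain n d where nd: "d \<in> {0..<1}" "t = speed * (real n + d)"
      "q = flow_point (cocycle no_jump n h s) (frac (h + real n * \<alpha>)) d"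
    using geodesic_decode[OF t(2) s h] by blast
  have d0: "d = 0" using not_left_edge nd t(3) by blast
  have "n \<noteq> 0" using t(1) nd(2) d0 by (cases n) auto
  moreover have "\<not> n > 1"
  proof
    assume "n > 1"
    then have "speed * (real 1 + 0) < t"
      unfolding nd(2) d0 using speed_pos by (intro mult_strict_left_mono) auto
    moreover have "0 < speed * (real 1 + 0)" using speed_pos by simp
    moreover have "geodesic S \<alpha> (pt S (s, 0, h)) (speed * (real 1 + 0))
        (flow_point (cocycle no_jump 1 h s) (frac (h + real 1 * \<alpha>)) 0)"
      by (rule geodesic_exists[OF s h gen]) simp
    moreover have "flow_point (cocycle no_jump 1 h s) (frac (h + real 1 * \<alpha>)) 0 \<in> left_edges S"
      by (rule left_edge_point) (use s cocycle_in[of no_jump s 1] in \<open>auto simp: frac_lt_1\<close>)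
    ultimately show False using t(4) by blast
  qed
  ultimately have "n = 1" by simp
  then show "q = pt S (fib h s, 0, frac (h + \<alpha>))"
    using nd(3) d0 by (simp add: flow_point_0 frac_lt_1)
next
  assume q: "q = pt S (fib h s, 0, frac (h + \<alpha>))"
  show "discretization S \<alpha> (pt S (s, 0, h)) q"
    unfolding discretization_def
  proof (intro conjI exI[of _ speed] allI impI)
    show "pt S (s, 0, h) \<in> left_edges S" using s h by (auto simp: left_edges_def)
    show "q \<in> left_edges S"
      unfolding left_edges_def q using fib_in[OF s] frac_lt_1[of "h + \<alpha>"] by force
    show "geodesic S \<alpha> (pt S (s, 0, h)) speed q"
      using geodesic_exists[OF s h gen, of 0 1] by (simp add: q flow_point_0 frac_lt_1)
    show "r \<notin> left_edges S" if u: "0 < u \<and> u < speed \<and> geodesic S \<alpha> (pt S (s, 0, h)) u r" for u r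
    proof
      assume "r \<in> left_edges S"
      obtain n d where nd: "d \<in> {0..<1}" "u = speed * (real n + d)"
          "r = flow_point (cocycle no_jump n h s) (frac (h + real n * \<alpha>)) d"
        using geodesic_decode s h u by blast
      then have "d = 0" using not_left_edge \<open>r \<in> left_edges S\<close> by blast
      then have "0 < real n" "real n < 1" using u speed_pos unfolding nd(2)
        by (auto simp: zero_less_mult_iff)
      then show False by simp
    qed
  qed (rule speed_pos)
qed

text \<open>Only the form of the height matters here: it shows that an exceptional start can reach
  exceptional heights only.\<close>

lemma discretization_power_decode:
  assumes "s \<in> squares S" "h \<in> {0..<1}"
  shows "(discretization S \<alpha> ^^ k) (pt S (s, 0, h)) q \<Longrightarrow>
    \<exists>n. q = pt S (cocycle no_jump n h s, 0, frac (h + real n * \<alpha>))"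
proof (induction k arbitrary: q)
  case 0
  then show ?case using assms by (intro exI[of _ 0]) (simp add: frac_eq)
next
  case (Suc k)
  then obtain r where "(discretization S \<alpha> ^^ k) (pt S (s, 0, h)) r" "discretization S \<alpha> r q"
    by auto
  with Suc.IH obtain n where r: "r = pt S (cocycle no_jump n h s, 0, frac (h + real n * \<alpha>))"
      "discretization S \<alpha> r q"
    by blast
  obtain m where "q = pt S (cocycle no_jump m (frac (h + real n * \<alpha>)) (cocycle no_jump n h s), 0,
      frac (frac (h + real n * \<alpha>) + real m * \<alpha>))"
    using discretization_decode[of "cocycle no_jump n h s" "frac (h + real n * \<alpha>)" q]
      r assms cocycle_in[of no_jump s n h] by (auto simp: frac_lt_1)
  moreover have "frac (frac (h + real n * \<alpha>) + real m * \<alpha>) = frac (h + real (m + n) * \<alpha>)"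
  proof -
    have "frac (h + real n * \<alpha>) + real m * \<alpha> = h + real (m + n) * \<alpha> + of_int (- \<lfloor>h + real n * \<alpha>\<rfloor>)"
      by (simp add: frac_def algebra_simps)
    then show ?thesis by (simp only: frac_int)
  qed
  ultimately show ?case
    by (intro exI[of _ "m + n"]) (simp add: cocycle_add cocycle_frac)
qed

lemma discretization_power_generic:
  assumes s: "s \<in> squares S" and h: "h \<in> {0..<1}" and gen: "\<And>k. h + real k * \<alpha> \<notin> \<int>"
  shows "(discretization S \<alpha> ^^ n) (pt S (s, 0, h)) q \<longleftrightarrow>
    q = pt S (cocycle no_jump n h s, 0, frac (h + real n * \<alpha>))"
proof (induction n arbitrary: q)
  case 0
  then show ?case using h by (auto simp: frac_eq)
next
  case (Suc n)
  let ?s = "cocycle no_jump n h s" and ?h = "frac (h + real n * \<alpha>)"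
  have s': "?s \<in> squares S" using cocycle_in[of no_jump] s by blast
  have h': "?h \<in> {0..<1}" by (simp add: frac_lt_1)
  have fr: "frac (?h + real k * \<alpha>) = frac (h + real (k + n) * \<alpha>)" for k
  proof -
    have "?h + real k * \<alpha> = h + real (k + n) * \<alpha> + of_int (- \<lfloor>h + real n * \<alpha>\<rfloor>)"
      by (simp add: frac_def algebra_simps)
    then show ?thesis by (simp only: frac_int)
  qed
  have gen': "?h + real k * \<alpha> \<notin> \<int>" for k
    using gen[of "k + n"] fr[of k] by (metis frac_eq_0_iff)
  have "(discretization S \<alpha> ^^ Suc n) (pt S (s, 0, h)) q \<longleftrightarrow>
      discretization S \<alpha> (pt S (?s, 0, ?h)) q"
    by (auto simp: Suc)
  also have "\<dots> \<longleftrightarrow> q = pt S (fib ?h ?s, 0, frac (?h + \<alpha>))"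
    by (rule discretization_generic[OF s' h' gen'])
  also have "fib ?h ?s = cocycle no_jump (Suc n) h s"
    using cocycle_add[of no_jump 1 n h s] cocycle_frac[of no_jump 1 "h + real n * \<alpha>"] by simp
  also have "frac (?h + \<alpha>) = frac (h + real (Suc n) * \<alpha>)" using fr[of 1] by simp
  finally show ?case .
qed

end

section \<open>Last visits to the barrier and its copy\<close>

context barrier
begin

abbreviation C :: "'s point set" where "C \<equiv> barrier_and_copy S a b J"

definition on_barrier :: "'s \<Rightarrow> real \<Rightarrow> bool" where
  "on_barrier s h \<longleftrightarrow> (s = a \<or> s = b) \<and> h \<in> J"

lemma edge_part_generic:
  assumes "h \<in> {0..<1}" "h \<notin> E" "K \<subseteq> {0..<1}"
  shows "pt S (s, 0, h) \<in> edge_part S c K \<longleftrightarrow> s = c \<and> h \<in> K"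
proof
  assume "pt S (s, 0, h) \<in> edge_part S c K"
  then obtain h' where h': "h' \<in> K" "pt S (s, 0, h) = pt S (c, 0, h')" by (auto simp: edge_part_def)
  have "s = c \<and> (0 :: real) = 0 \<and> h = h'"
    by (rule pt_inject[OF h'(2)])
      (use assms generic_unit[OF assms(1,2)] h'(1) not_singular_pt[of 0 h S s] in auto)
  then show "s = c \<and> h \<in> K" using h'(1) by simp
qed (auto simp: edge_part_def)

lemma C_generic:
  assumes "h \<in> {0..<1}" "h \<notin> E"
  shows "pt S (s, 0, h) \<in> C \<longleftrightarrow> on_barrier s h"
  using edge_part_generic[OF assms J_subset] by (auto simp: barrier_and_copy_def on_barrier_def)

lemma C_subset_left_edges: "C \<subseteq> left_edges S"
  using J_subset a_in b_in
  by (fastforce simp: barrier_and_copy_def edge_part_def left_edges_def)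

text \<open>For \<open>n = 0\<close> the point \<open>(s, h)\<close> itself lies on the barrier or
  its copy. The forbidden times include \<open>n\<close>, so the visit at the start really is the
  latest one.\<close>

definition last_visit :: "nat \<Rightarrow> 's \<Rightarrow> real \<Rightarrow> 's \<Rightarrow> bool" where
  "last_visit n s0 h s \<longleftrightarrow> s0 \<in> squares S \<and> cocycle no_jump n (h - real n * \<alpha>) s0 = s \<and>
     on_barrier s0 (frac (h - real n * \<alpha>)) \<and>
     (\<forall>m\<in>{1..n}. \<not> on_barrier (cocycle no_jump m (h - real n * \<alpha>) s0)
        (frac (h - real n * \<alpha> + real m * \<alpha>)))"

text \<open>The geodesic has met the copy in the past; the least backward time of a visit to either
  edge works, as a visit in between would have a smaller backward time.\<close>

lemma last_visit_exists:
  assumes "s \<in> squares S" "h \<notin> E"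
  shows "\<exists>n s0. last_visit n s0 h s"
proof -
  obtain u v where uv: "u < v" "{u<..<v} \<subseteq> J" using J_interval by blast
  define P where "P n \<longleftrightarrow> (\<exists>s0\<in>squares S. cocycle no_jump n (h - real n * \<alpha>) s0 = s \<and>
    on_barrier s0 (frac (h - real n * \<alpha>)))" for n
  have ex: "\<exists>n. P n"
    using backward_orbit_hits[OF finite_frontier_J uv J_subset a_in assms] a_in
    unfolding P_def on_barrier_def by blast
  define n where "n = (LEAST n. P n)"
  have least: "P n" "\<And>m. m < n \<Longrightarrow> \<not> P m"
    unfolding n_def using LeastI_ex[OF ex] not_less_Least by blast+
  obtain s0 where s0: "s0 \<in> squares S" "cocycle no_jump n (h - real n * \<alpha>) s0 = s"
      "on_barrier s0 (frac (h - real n * \<alpha>))"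
    using least(1) unfolding P_def by blast
  have "\<not> on_barrier (cocycle no_jump m (h - real n * \<alpha>) s0) (frac (h - real n * \<alpha> + real m * \<alpha>))"
    if m: "m \<in> {1..n}" for m
  proof
    assume *: "on_barrier (cocycle no_jump m (h - real n * \<alpha>) s0) (frac (h - real n * \<alpha> + real m * \<alpha>))"
    have e: "h - real n * \<alpha> + real m * \<alpha> = h - real (n - m) * \<alpha>"
      using m by (simp add: of_nat_diff algebra_simps)
    have "cocycle no_jump (n - m) (h - real n * \<alpha> + real m * \<alpha>)
        (cocycle no_jump m (h - real n * \<alpha>) s0) = s"
      using cocycle_add[of no_jump "n - m" m "h - real n * \<alpha>" s0] s0(2) m by simp
    then have "P (n - m)"
      unfolding P_def using * cocycle_in[of no_jump s0 m] s0(1) e by auto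
    moreover have "n - m < n" using m by auto
    ultimately show False using least(2) by blast
  qed
  then show ?thesis unfolding last_visit_def using s0 by blast
qed

text \<open>Geodesic steps are injective, so the longer of two backward orbits passes through the
  start of the shorter one, which would be a forbidden visit.\<close>

lemma last_visit_unique:
  assumes "last_visit n s0 h s" "last_visit n' s0' h s"
  shows "n = n' \<and> s0 = s0'"
proof -
  have not_less: "\<not> n < n'" if l: "last_visit n s0 h s" "last_visit n' s0' h s" for n n' s0 s0'
  proof
    assume "n < n'"
    have e: "h - real n' * \<alpha> + real (n' - n) * \<alpha> = h - real n * \<alpha>"
      using \<open>n < n'\<close> by (simp add: of_nat_diff algebra_simps)
    have "cocycle no_jump n (h - real n * \<alpha>) (cocycle no_jump (n' - n) (h - real n' * \<alpha>) s0') = s"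
      using cocycle_add[of no_jump n "n' - n" "h - real n' * \<alpha>" s0', unfolded e] l(2) \<open>n < n'\<close>
      by (simp add: last_visit_def)
    then have "cocycle no_jump (n' - n) (h - real n' * \<alpha>) s0' = s0"
      using inj_cocycle[of n "h - real n * \<alpha>"] l cocycle_in[of no_jump s0' "n' - n"]
      by (auto simp: last_visit_def dest: inj_onD)
    moreover have "n' - n \<in> {1..n'}" using \<open>n < n'\<close> by auto
    ultimately show False using l e unfolding last_visit_def by metis
  qed
  from not_less[OF assms] not_less[OF assms(2,1)] have "n = n'" by simp
  then show ?thesis
    using assms inj_cocycle[of n "h - real n * \<alpha>"] by (auto simp: last_visit_def dest: inj_onD)
qed

lemma frac_back: "frac (frac (h - real n * \<alpha>) + real m * \<alpha>) = frac (h - real n * \<alpha> + real m * \<alpha>)"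
proof -
  have "frac (h - real n * \<alpha>) + real m * \<alpha> = h - real n * \<alpha> + real m * \<alpha> + of_int (- \<lfloor>h - real n * \<alpha>\<rfloor>)"
    by (simp add: frac_def)
  then show ?thesis by (simp only: frac_int)
qed

text \<open>A line from \<open>H\<close> that reaches the point without meeting \<open>C\<close> in
  between starts at a last visit, and the last visit is unique.\<close>

lemma strip_iff:
  assumes H: "H \<subseteq> C" and l: "last_visit n s0 h s"
    and h: "h \<in> {0..<1}" "h \<notin> E" and x: "0 < x" "x < 1" and s: "s \<in> squares S"
  shows "flow_point s h x \<in> first_return_strip S \<alpha> C H \<longleftrightarrow> pt S (s0, 0, frac (h - real n * \<alpha>)) \<in> H"
proof
  assume "flow_point s h x \<in> first_return_strip S \<alpha> C H"
  then obtain p t where p: "p \<in> H" "geodesic S \<alpha> p t (flow_point s h x)"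
      "\<And>u r. 0 < u \<Longrightarrow> u < t \<Longrightarrow> geodesic S \<alpha> p u r \<Longrightarrow> r \<notin> C"
    unfolding first_return_strip_def by blast
  obtain s1 h1 where s1: "p = pt S (s1, 0, h1)" "s1 = a \<or> s1 = b" "h1 \<in> J"
    using p(1) H by (auto simp: barrier_and_copy_def edge_part_def)
  have s1': "s1 \<in> squares S" "h1 \<in> {0..<1}" using s1 a_in b_in J_subset by auto
  obtain k d where kd: "d \<in> {0..<1}" "t = speed * (real k + d)"
      "flow_point s h x = flow_point (cocycle no_jump k h1 s1) (frac (h1 + real k * \<alpha>)) d"
    using geodesic_decode[OF p(2)[unfolded s1(1)] s1'] by blast
  have eq: "s = cocycle no_jump k h1 s1 \<and> h = frac (h1 + real k * \<alpha>) \<and> x = d"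
    by (rule flow_point_inject)
      (use kd s s1' h x not_singular_flow_point[of h x s] cocycle_in[of no_jump s1 k] in
        \<open>auto simp: frac_lt_1\<close>)
  have h1: "h1 = frac (h - real k * \<alpha>)"
  proof -
    have "h - real k * \<alpha> = h1 + of_int (- \<lfloor>h1 + real k * \<alpha>\<rfloor>)" using eq by (simp add: frac_def)
    then have "frac (h - real k * \<alpha>) = frac h1" by (simp only: frac_int)
    then show ?thesis using s1'(2) by (simp add: frac_eq)
  qed
  have gen: "h1 \<notin> E" using h(2) by (simp add: h1 exceptional_frac exceptional_diff)
  have "\<not> on_barrier (cocycle no_jump m h1 s1) (frac (h1 + real m * \<alpha>))" if m: "m \<in> {1..k}" for m
  proof
    assume "on_barrier (cocycle no_jump m h1 s1) (frac (h1 + real m * \<alpha>))"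
    then have "flow_point (cocycle no_jump m h1 s1) (frac (h1 + real m * \<alpha>)) 0 \<in> C"
      using C_generic[of "frac (h1 + real m * \<alpha>)"] gen
      by (simp add: flow_point_0 frac_lt_1 exceptional_frac exceptional_add)
    moreover have "geodesic S \<alpha> p (speed * (real m + 0))
        (flow_point (cocycle no_jump m h1 s1) (frac (h1 + real m * \<alpha>)) 0)"
      unfolding s1(1) by (rule geodesic_exists[OF s1' generic_orbit_not_int[OF gen]]) simp
    \<comment> \<open>Because \<open>x > 0\<close>, the crossing number \<open>k\<close> also
      happens strictly before \<open>t\<close> and is excluded like the earlier ones.\<close>
    moreover have "0 < speed * (real m + 0)" "speed * (real m + 0) < t"
      using m x eq speed_pos unfolding kd(2)
      by (auto intro!: mult_pos_pos mult_strict_left_mono simp del: add_0_right)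
    ultimately show False using p(3) by blast
  qed
  then have "last_visit k s1 h s"
    using s1' s1 eq frac_back[of h k] unfolding last_visit_def h1 on_barrier_def
    by (simp add: cocycle_frac)
  with l have "k = n" "s1 = s0" using last_visit_unique by blast+
  then show "pt S (s0, 0, frac (h - real n * \<alpha>)) \<in> H" using p(1) s1(1) h1 by simp
next
  assume mem: "pt S (s0, 0, frac (h - real n * \<alpha>)) \<in> H"
  define h1 where "h1 = frac (h - real n * \<alpha>)"
  have s0: "s0 \<in> squares S" using l by (simp add: last_visit_def)
  have h1: "h1 \<in> {0..<1}" "h1 \<notin> E" using h(2)
    by (simp_all add: h1_def exceptional_frac exceptional_diff frac_lt_1)
  have "frac (h1 + real n * \<alpha>) = h" using frac_back[of h n n] h(1) by (simp add: h1_def frac_eq)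
  moreover have "cocycle no_jump n h1 s0 = s" using l by (simp add: last_visit_def h1_def cocycle_frac)
  ultimately have g: "geodesic S \<alpha> (pt S (s0, 0, h1)) (speed * (real n + x)) (flow_point s h x)"
    using geodesic_exists[OF s0 h1(1) generic_orbit_not_int[OF h1(2)], of x n] x by simp
  have "r \<notin> C" if u: "0 < u" "u < speed * (real n + x)" "geodesic S \<alpha> (pt S (s0, 0, h1)) u r" for u r
  proof
    assume "r \<in> C"
    obtain m d where md: "d \<in> {0..<1}" "u = speed * (real m + d)"
        "r = flow_point (cocycle no_jump m h1 s0) (frac (h1 + real m * \<alpha>)) d"
      using geodesic_decode[OF u(3) s0 h1(1)] by blast
    have "d = 0" using not_left_edge md \<open>r \<in> C\<close> C_subset_left_edges by blast
    then have "on_barrier (cocycle no_jump m h1 s0) (frac (h1 + real m * \<alpha>))"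
      using \<open>r \<in> C\<close> md(3) C_generic[of "frac (h1 + real m * \<alpha>)"] h1(2)
      by (simp add: flow_point_0 frac_lt_1 exceptional_frac exceptional_add)
    moreover have "m \<in> {1..n}"
    proof -
      have "real m < real n + x" "0 < real m"
        using u(1,2) speed_pos \<open>d = 0\<close> unfolding md(2) by (auto simp: zero_less_mult_iff)
      then show ?thesis using x by auto
    qed
    ultimately show False using l frac_back[of h n m] unfolding last_visit_def h1_def
      by (simp add: cocycle_frac)
  qed
  then show "flow_point s h x \<in> first_return_strip S \<alpha> C H"
    unfolding first_return_strip_def using mem g x speed_pos h1_def
    by (intro CollectI bexI[of _ "pt S (s0, 0, h1)"] exI[of _ "speed * (real n + x)"]) auto
qed

text \<open>Core squares are ends of dissipative steps, and over \<open>J\<close> every arrival at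
  \<open>b\<close> is diverted to \<open>a\<close>.\<close>

lemma b_notin_core:
  assumes "h \<notin> E" "frac h \<in> J"
  shows "b \<notin> core h"
proof
  assume "b \<in> core h"
  moreover have "core h = step (h - \<alpha>) ` core (h - \<alpha>)"
    using core_step[of "h - \<alpha>"] assms(1) by (simp add: exceptional_diff1)
  ultimately show False using assms(2) a_neq_b by (auto simp: step_def jump_def split: if_splits)
qed

text \<open>Off the two edges the dissipative step is the injective map \<open>fib\<close>. The copy
  has to be avoided too: over \<open>J\<close>, the square \<open>a\<close> can also be reached by a
  jump from another predecessor.\<close>

lemma core_step_iff:
  assumes "z \<in> squares S" "h \<notin> E" "\<not> on_barrier (fib h z) (frac (h + \<alpha>))"
  shows "fib h z \<in> core (h + \<alpha>) \<longleftrightarrow> z \<in> core h"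
proof
  assume "fib h z \<in> core (h + \<alpha>)"
  then obtain z' where z': "z' \<in> core h" "fib h z = step h z'" using core_step assms(2) by auto
  then have "fib h z = fib h z'"
    using assms(3) by (auto simp: step_def jump_def on_barrier_def split: if_splits)
  then show "z \<in> core h"
    using z'(1) assms(1) core_subset bij_fib[of h] by (metis bij_betw_def inj_onD subsetD)
next
  assume "z \<in> core h"
  moreover have "step h z = fib h z" using assms(3) by (auto simp: step_def jump_def on_barrier_def)
  ultimately show "fib h z \<in> core (h + \<alpha>)" using core_step[OF assms(2)] by (metis imageI)
qed

lemma core_last_visit:
  assumes l: "last_visit n s0 h s" and h: "h \<notin> E"
  shows "s \<in> core h \<longleftrightarrow> s0 \<in> core (h - real n * \<alpha>)"
proof -
  define k where "k = h - real n * \<alpha>"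
  have "m \<le> n \<Longrightarrow> cocycle no_jump m k s0 \<in> core (k + real m * \<alpha>) \<longleftrightarrow> s0 \<in> core k" for m
  proof (induction m)
    case (Suc m)
    have e: "k + real (Suc m) * \<alpha> = (k + real m * \<alpha>) + \<alpha>" by (simp add: algebra_simps)
    have "\<not> on_barrier (cocycle no_jump (Suc m) k s0) (frac (k + real (Suc m) * \<alpha>))"
      using l[unfolded last_visit_def, folded k_def] Suc.prems
      by (elim conjE) (erule bspec, simp)
    then have "fib (k + real m * \<alpha>) (cocycle no_jump m k s0) \<in> core ((k + real m * \<alpha>) + \<alpha>) \<longleftrightarrow>
        cocycle no_jump m k s0 \<in> core (k + real m * \<alpha>)"
      using l h cocycle_in[of no_jump s0 m k] unfolding e
      by (intro core_step_iff)
        (simp_all add: last_visit_def k_def exceptional_add exceptional_diff)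
    with Suc show ?case unfolding e by simp
  qed simp
  from this[of n] l show ?thesis by (simp add: last_visit_def k_def)
qed

section \<open>The extension process as a decreasing sequence of sets of heights\<close>

primrec K :: "nat \<Rightarrow> real set" where
  "K 0 = J"
| "K (Suc i) = J \<inter> heights S {q. \<exists>p\<in>edge_part S a (K i). first_return S \<alpha> C p q}"

lemma extension_sets_eq: "extension_sets S \<alpha> a b J i = edge_part S a (K i)"
  by (induction i) simp_all

lemma K_subset_J: "K i \<subseteq> J"
  by (cases i) auto

lemma K_unit: "K i \<subseteq> {0..<1}"
  using K_subset_J J_subset by blast

text \<open>Only the end height is required to be generic. An exceptional start leads to exceptional
  heights only, so then both sides fail.\<close>

lemma first_return_generic:
  assumes h: "h \<in> {0..<1}" "h \<notin> E" and s: "s \<in> squares S"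
    and h0: "h0 \<in> {0..<1}" and s0: "s0 \<in> squares S"
  shows "first_return S \<alpha> C (pt S (s0, 0, h0)) (pt S (s, 0, h)) \<longleftrightarrow>
    on_barrier s0 h0 \<and> on_barrier s h \<and>
    (\<exists>n\<ge>1. h0 = frac (h - real n * \<alpha>) \<and> cocycle no_jump n h0 s0 = s \<and>
      (\<forall>m\<in>{1..<n}. \<not> on_barrier (cocycle no_jump m h0 s0) (frac (h0 + real m * \<alpha>))))"
    (is "?L \<longleftrightarrow> ?R")
proof -
  have h0_eq: "h0 = frac (h - real n * \<alpha>)" if "h = frac (h0 + real n * \<alpha>)" for n
  proof -
    have "h - real n * \<alpha> = h0 + of_int (- \<lfloor>h0 + real n * \<alpha>\<rfloor>)" using that by (simp add: frac_def)
    then have "frac (h - real n * \<alpha>) = frac h0" by (simp only: frac_int)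
    then show ?thesis using h0 by (simp add: frac_eq)
  qed
  have inj: "cocycle no_jump n h0 s0 = s \<and> frac (h0 + real n * \<alpha>) = h"
    if "pt S (s, 0, h) = pt S (cocycle no_jump n h0 s0, 0, frac (h0 + real n * \<alpha>))" for n
  proof -
    have "s = cocycle no_jump n h0 s0 \<and> (0 :: real) = 0 \<and> h = frac (h0 + real n * \<alpha>)"
      by (rule pt_inject[OF that])
        (use h generic_unit[OF h] not_singular_pt[of 0 h S s] in \<open>auto simp: frac_lt_1\<close>)
    then show ?thesis by simp
  qed
  show ?thesis
  proof (cases "h0 \<in> E")
    case True
    have "\<not> ?L"
    proof
      assume ?L
      then obtain n where "(discretization S \<alpha> ^^ n) (pt S (s0, 0, h0)) (pt S (s, 0, h))"
        unfolding first_return_def by blast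
      from discretization_power_decode[OF s0 h0 this] inj obtain n where "h = frac (h0 + real n * \<alpha>)"
        by metis
      then show False using True h(2) by (simp add: exceptional_frac exceptional_add)
    qed
    moreover have "\<not> ?R" using True h(2) by (auto simp: exceptional_frac exceptional_diff)
    ultimately show ?thesis by blast
  next
    case False
    have *: "(discretization S \<alpha> ^^ n) (pt S (s0, 0, h0)) q \<longleftrightarrow>
        q = pt S (cocycle no_jump n h0 s0, 0, frac (h0 + real n * \<alpha>))" for n q
      by (rule discretization_power_generic[OF s0 h0 generic_orbit_not_int[OF False]])
    have C: "pt S (cocycle no_jump m h0 s0, 0, frac (h0 + real m * \<alpha>)) \<in> C \<longleftrightarrow>
        on_barrier (cocycle no_jump m h0 s0) (frac (h0 + real m * \<alpha>))" for m
      by (rule C_generic) (use False in \<open>simp_all add: frac_lt_1 exceptional_frac exceptional_add\<close>)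
    have eq: "pt S (s, 0, h) = pt S (cocycle no_jump n h0 s0, 0, frac (h0 + real n * \<alpha>)) \<longleftrightarrow>
        h0 = frac (h - real n * \<alpha>) \<and> cocycle no_jump n h0 s0 = s" for n
    proof
      assume "pt S (s, 0, h) = pt S (cocycle no_jump n h0 s0, 0, frac (h0 + real n * \<alpha>))"
      from inj[OF this] h0_eq[of n] show "h0 = frac (h - real n * \<alpha>) \<and> cocycle no_jump n h0 s0 = s"
        by simp
    next
      assume *: "h0 = frac (h - real n * \<alpha>) \<and> cocycle no_jump n h0 s0 = s"
      then have "frac (h0 + real n * \<alpha>) = h" using frac_back[of h n n] h(1) by (simp add: frac_eq)
      with conjunct2[OF *]
      show "pt S (s, 0, h) = pt S (cocycle no_jump n h0 s0, 0, frac (h0 + real n * \<alpha>))" by simp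
    qed
    show ?thesis
      unfolding first_return_def * eq C_generic[OF h] C_generic[OF h0 False]
      using C by (auto simp: Ball_def)
  qed
qed

text \<open>Passing to heights merges arrivals at \<open>b\<close> with arrivals at
  \<open>a\<close>; this is the effect of the jump, after which both continue from the copy.\<close>

lemma K_Suc_iff:
  assumes "h \<in> J" "h \<notin> E"
  shows "h \<in> K (Suc i) \<longleftrightarrow> (\<exists>h0\<in>K i. \<exists>n\<ge>1. h0 = frac (h - real n * \<alpha>) \<and>
     (cocycle no_jump n h0 a = a \<or> cocycle no_jump n h0 a = b) \<and>
     (\<forall>m\<in>{1..<n}. \<not> on_barrier (cocycle no_jump m h0 a) (frac (h0 + real m * \<alpha>))))"
proof -
  have h: "h \<in> {0..<1}" using assms(1) J_subset by blast
  have "h \<in> K (Suc i) \<longleftrightarrow> (\<exists>h0\<in>K i. \<exists>s\<in>squares S. first_return S \<alpha> C (pt S (a, 0, h0)) (pt S (s, 0, h)))"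
    using assms(1) h by (auto simp: heights_def edge_part_def)
  also have "\<dots> \<longleftrightarrow> (\<exists>h0\<in>K i. \<exists>s\<in>squares S. on_barrier a h0 \<and> on_barrier s h \<and>
    (\<exists>n\<ge>1. h0 = frac (h - real n * \<alpha>) \<and> cocycle no_jump n h0 a = s \<and>
      (\<forall>m\<in>{1..<n}. \<not> on_barrier (cocycle no_jump m h0 a) (frac (h0 + real m * \<alpha>)))))"
    by (intro bex_cong refl first_return_generic h assms(2) a_in) (use K_unit in blast)+
  also have "\<dots> \<longleftrightarrow> (\<exists>h0\<in>K i. \<exists>n\<ge>1. h0 = frac (h - real n * \<alpha>) \<and>
     (cocycle no_jump n h0 a = a \<or> cocycle no_jump n h0 a = b) \<and>
     (\<forall>m\<in>{1..<n}. \<not> on_barrier (cocycle no_jump m h0 a) (frac (h0 + real m * \<alpha>))))"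
    using assms(1) K_subset_J[of i] a_in b_in unfolding on_barrier_def by blast
  finally show ?thesis .
qed

text \<open>A core point of the copy has a predecessor in the core, whose last visit is again in the
  core and so cannot be on the barrier. The \<open>n\<close> steps since that visit and one more
  step form a first return, and induction applies to its start.\<close>

lemma core_subset_K:
  "h \<in> J \<Longrightarrow> h \<notin> E \<Longrightarrow> a \<in> core h \<Longrightarrow> h \<in> K i"
proof (induction i arbitrary: h)
  case (Suc i)
  have h: "h - \<alpha> \<notin> E" using Suc.prems(2) by (simp add: exceptional_diff1)
  obtain z where z: "z \<in> core (h - \<alpha>)" "step (h - \<alpha>) z = a"
    using core_step[OF h] Suc.prems(3) by auto
  then have z': "z \<in> squares S" "fib (h - \<alpha>) z = a \<or> fib (h - \<alpha>) z = b"
    using core_subset by (auto simp: step_def jump_def split: if_splits)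
  obtain n s0 where l: "last_visit n s0 (h - \<alpha>) z" using last_visit_exists[OF z'(1) h] by blast
  define h0 where "h0 = frac (h - \<alpha> - real n * \<alpha>)"
  have h0: "h0 \<notin> E" using h by (simp add: h0_def exceptional_frac exceptional_diff)
  have core: "s0 \<in> core h0" using core_last_visit[OF l h] z(1) by (simp add: h0_def core_frac)
  have "h0 \<in> J" "s0 = a \<or> s0 = b" using l by (auto simp: last_visit_def on_barrier_def h0_def)
  moreover have "s0 \<noteq> b"
    using b_notin_core[OF h0] core \<open>h0 \<in> J\<close> J_subset by (auto simp: frac_eq)
  ultimately have s0: "s0 = a" by simp
  have "h0 \<in> K i" using Suc.IH \<open>h0 \<in> J\<close> h0 core s0 by blast
  moreover have h0': "h0 = frac (h - real (Suc n) * \<alpha>)" by (simp add: h0_def algebra_simps)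
  moreover have "cocycle no_jump (Suc n) h0 a = a \<or> cocycle no_jump (Suc n) h0 a = b"
  proof -
    have "cocycle no_jump (Suc n) h0 a = cocycle no_jump (Suc n) (h - real (Suc n) * \<alpha>) a"
      unfolding h0' by (rule cocycle_frac)
    also have "h - real (Suc n) * \<alpha> = h - \<alpha> - real n * \<alpha>" by (simp add: algebra_simps)
    finally show ?thesis using l s0 z'(2) by (simp add: last_visit_def)
  qed
  moreover have "\<not> on_barrier (cocycle no_jump m h0 a) (frac (h0 + real m * \<alpha>))"
    if "m \<in> {1..<Suc n}" for m
    using l that s0 frac_back[of "h - \<alpha>" n m] unfolding last_visit_def h0_def
    by (simp add: cocycle_frac)
  ultimately show ?case using K_Suc_iff[OF Suc.prems(1,2)] by (metis le_add1 plus_1_eq_Suc)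
qed simp

lemma cocycle_Z_add: "z \<in> I.Z m k \<Longrightarrow> cocycle jump n k z \<in> I.Z (n + m) (k + real n * \<alpha>)"
proof (induction n)
  case (Suc n)
  have "k + real (Suc n) * \<alpha> - \<alpha> = k + real n * \<alpha>" by (simp add: algebra_simps)
  with Suc show ?case by (simp only: I.Z.simps cocycle_Suc_step add_Suc) blast
qed simp

text \<open>Both flows agree until an edge is met, so a jump can occur only at the final step
  \<open>n\<close>, which the hypothesis leaves free.\<close>

lemma cocycle_jump_eq:
  assumes "\<And>m. m \<in> {1..<n} \<Longrightarrow> \<not> on_barrier (cocycle no_jump m h s) (frac (h + real m * \<alpha>))" "n \<ge> 1"
  shows "cocycle jump n h s = jump (cocycle no_jump n h s) (frac (h + real n * \<alpha>))"
proof -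
  have "m < n \<Longrightarrow> cocycle jump m h s = cocycle no_jump m h s" for m
  proof (induction m)
    case (Suc m)
    then show ?case using assms(1)[of "Suc m"] by (auto simp: jump_def on_barrier_def)
  qed simp
  with assms(2) show ?thesis by (cases n) simp_all
qed

text \<open>For the dissipative flow each first return ends at \<open>a\<close>, an arrival at
  \<open>b\<close> being diverted there. It takes at least one step, so \<open>i\<close> of them
  give depth at least \<open>i\<close>.\<close>

lemma K_in_Z: "h \<in> J \<Longrightarrow> h \<notin> E \<Longrightarrow> h \<in> K i \<Longrightarrow> \<exists>m\<ge>i. a \<in> I.Z m h"
proof (induction i arbitrary: h)
  case 0
  show ?case by (rule exI[of _ 0]) (simp add: a_in)
next
  case (Suc i)
  obtain h0 n where h0: "h0 \<in> K i" "n \<ge> 1" "h0 = frac (h - real n * \<alpha>)"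
    "cocycle no_jump n h0 a = a \<or> cocycle no_jump n h0 a = b"
    "\<And>m. m \<in> {1..<n} \<Longrightarrow> \<not> on_barrier (cocycle no_jump m h0 a) (frac (h0 + real m * \<alpha>))"
    using Suc.prems(3) unfolding K_Suc_iff[OF Suc.prems(1,2)] by blast
  have "h0 \<in> J" using h0(1) K_subset_J by blast
  moreover have "h0 \<notin> E" using Suc.prems(2) by (simp add: h0(3) exceptional_frac exceptional_diff)
  ultimately obtain m where m: "m \<ge> i" "a \<in> I.Z m h0" using Suc.IH h0(1) by blast
  have hh: "frac (h0 + real n * \<alpha>) = h"
    using frac_back[of h n n] Suc.prems(1) J_subset unfolding h0(3) by (auto simp: frac_eq)
  have "cocycle jump n h0 a = a"
    using cocycle_jump_eq[OF h0(5,2)] h0(4) Suc.prems(1) hh by (auto simp: jump_def)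
  then have "a \<in> I.Z (n + m) (h0 + real n * \<alpha>)" using cocycle_Z_add[OF m(2)] by metis
  then have "a \<in> I.Z (n + m) h" using I.Z_frac[of "n + m" "h0 + real n * \<alpha>"] hh by simp
  moreover have "n + m \<ge> Suc i" using m(1) h0(2) by simp
  ultimately show ?case by blast
qed

text \<open>One inclusion holds for all \<open>i\<close>; for the other, depth at least
  \<open>N\<close> already means membership in the core.\<close>

lemma K_eq_core: "h \<in> J \<Longrightarrow> h \<notin> E \<Longrightarrow> i \<ge> N \<Longrightarrow> h \<in> K i \<longleftrightarrow> a \<in> core h"
  using core_subset_K K_in_Z Z_core by (metis le_trans)

lemma recurrent_iff:
  assumes "s \<in> squares S" "h \<in> {0..<1}" "h \<notin> E" "0 < x" "x < 1" "h + \<alpha> * x \<notin> \<int>"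
  shows "flow_point s h x \<in> recurrent_set S \<alpha> a b J \<longleftrightarrow> s \<in> core h"
    and "flow_point s h x \<in> transient_set S \<alpha> a b J \<longleftrightarrow> s \<notin> core h"
proof -
  have "flow_point s h x \<in> surface S"
    unfolding surface_def flow_point_eq
    by (rule imageI) (use assms above_power_in in \<open>simp add: local_points_def frac_lt_1 less_imp_le\<close>)
  then show "flow_point s h x \<in> recurrent_set S \<alpha> a b J \<longleftrightarrow> s \<in> core h"
    "flow_point s h x \<in> transient_set S \<alpha> a b J \<longleftrightarrow> s \<notin> core h"
    using wandering_iff[OF assms] by (simp_all add: recurrent_set_def transient_set_def)
qed

text \<open>Core membership does not change after the last visit. There the barrier is excluded, and
  on the copy it means surviving all stages.\<close>

lemma core_iff_K:
  assumes l: "last_visit n s0 h s" and h: "h \<notin> E"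
  shows "s \<in> core h \<longleftrightarrow> s0 = a \<and> (\<forall>i. frac (h - real n * \<alpha>) \<in> K i)"
proof -
  define h0 where "h0 = frac (h - real n * \<alpha>)"
  have h0: "h0 \<notin> E" using h by (simp add: h0_def exceptional_frac exceptional_diff)
  have J: "h0 \<in> J" "s0 = a \<or> s0 = b" using l by (auto simp: last_visit_def on_barrier_def h0_def)
  then have "frac h0 \<in> J" using J_subset by (auto simp: frac_eq)
  have "s \<in> core h \<longleftrightarrow> s0 \<in> core h0" using core_last_visit[OF l h] by (simp add: h0_def core_frac)
  also have "\<dots> \<longleftrightarrow> s0 = a \<and> a \<in> core h0" using J(2) b_notin_core[OF h0 \<open>frac h0 \<in> J\<close>] by auto
  also have "\<dots> \<longleftrightarrow> s0 = a \<and> (\<forall>i. h0 \<in> K i)"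
    using core_subset_K[OF J(1) h0] K_eq_core[OF J(1) h0, of N] by blast
  finally show ?thesis by (simp add: h0_def)
qed

lemma extension_sets_generic:
  assumes "h \<in> {0..<1}" "h \<notin> E"
  shows "pt S (s, 0, h) \<in> extension_sets S \<alpha> a b J i \<longleftrightarrow> s = a \<and> h \<in> K i"
  unfolding extension_sets_eq by (rule edge_part_generic[OF assms K_unit])

lemma extension_sets_subset_C: "extension_sets S \<alpha> a b J i \<subseteq> C"
  using K_subset_J by (auto simp: extension_sets_eq barrier_and_copy_def edge_part_def)

lemma K_Suc_subset: "K (Suc i) \<subseteq> K i"
proof (induction i)
  case (Suc i)
  then show ?case
    by (subst (1 2) K.simps(2)) (unfold heights_def edge_part_def, blast)
qed simp

lemma recurrent_set_strip:
  "equal_ae S (recurrent_set S \<alpha> a b J) (first_return_strip S \<alpha> C (limit_set S \<alpha> a b J))"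
proof (rule equal_ae_generic[OF countable_E exceptional_frac])
  fix s h x
  assume *: "s \<in> squares S" "h \<in> {0..<1}" "h \<notin> E" "0 < x" "x < 1" "h + \<alpha> * x \<notin> \<int>"
  obtain n s0 where l: "last_visit n s0 h s" using last_visit_exists *(1,3) by blast
  let ?h0 = "frac (h - real n * \<alpha>)"
  have h0: "?h0 \<in> {0..<1}" "?h0 \<notin> E"
    using *(3) by (simp_all add: exceptional_frac exceptional_diff frac_lt_1)
  have C: "limit_set S \<alpha> a b J \<subseteq> C"
    unfolding limit_set_def by (rule subset_trans[OF _ extension_sets_subset_C[of 1]], rule INF_lower) simp
  have "flow_point s h x \<in> recurrent_set S \<alpha> a b J \<longleftrightarrow> s \<in> core h"
    by (rule recurrent_iff(1)[OF *])
  also have "\<dots> \<longleftrightarrow> s0 = a \<and> (\<forall>i\<in>{1..}. ?h0 \<in> K i)"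
  proof -
    \<comment> \<open>\<open>limit_set\<close> starts at index 1; index 0 imposes nothing further
      because the sets decrease.\<close>
    have "(\<forall>i. ?h0 \<in> K i) \<longleftrightarrow> (\<forall>i\<in>{1..}. ?h0 \<in> K i)"
    proof (intro iffI allI ballI)
      fix i assume "\<forall>i\<in>{1..}. ?h0 \<in> K i"
      then have "\<forall>j. ?h0 \<in> K (Suc j)" by (simp del: K.simps)
      then show "?h0 \<in> K i" using K_Suc_subset[of 0] by (cases i) blast+
    qed blast
    then show ?thesis using core_iff_K[OF l *(3)] by simp
  qed
  also have "\<dots> \<longleftrightarrow> pt S (s0, 0, ?h0) \<in> limit_set S \<alpha> a b J"
    unfolding limit_set_def using extension_sets_generic[OF h0] by auto
  also have "\<dots> \<longleftrightarrow> flow_point s h x \<in> first_return_strip S \<alpha> C (limit_set S \<alpha> a b J)"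
    using strip_iff[OF C l] * by simp
  finally show "flow_point s h x \<in> recurrent_set S \<alpha> a b J \<longleftrightarrow>
      flow_point s h x \<in> first_return_strip S \<alpha> C (limit_set S \<alpha> a b J)" .
qed

lemma transient_set_strips:
  "equal_ae S (transient_set S \<alpha> a b J)
     (first_return_strip S \<alpha> C (edge_part S b J) \<union>
      (\<Union>i\<in>{1..}. first_return_strip S \<alpha> C
         (extension_sets S \<alpha> a b J (i - 1) - extension_sets S \<alpha> a b J i)))"
    (is "equal_ae S _ ?F")
proof (rule equal_ae_generic[OF countable_E exceptional_frac])
  fix s h x
  assume *: "s \<in> squares S" "h \<in> {0..<1}" "h \<notin> E" "0 < x" "x < 1" "h + \<alpha> * x \<notin> \<int>"
  obtain n s0 where l: "last_visit n s0 h s" using last_visit_exists *(1,3) by blast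
  let ?h0 = "frac (h - real n * \<alpha>)"
  have h0: "?h0 \<in> {0..<1}" "?h0 \<notin> E"
    using *(3) by (simp_all add: exceptional_frac exceptional_diff frac_lt_1)
  have J: "?h0 \<in> J" "s0 = a \<or> s0 = b" using l by (auto simp: last_visit_def on_barrier_def)
  have strip: "flow_point s h x \<in> first_return_strip S \<alpha> C H \<longleftrightarrow> pt S (s0, 0, ?h0) \<in> H"
    if "H \<subseteq> C" for H
    using strip_iff[OF that l] * by simp
  have 1: "flow_point s h x \<in> first_return_strip S \<alpha> C (edge_part S b J) \<longleftrightarrow> s0 = b"
    using strip[of "edge_part S b J"] edge_part_generic[OF h0 J_subset, of s0 b] J(1)
    by (auto simp: barrier_and_copy_def)
  have 2: "flow_point s h x \<in> first_return_strip S \<alpha> C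
      (extension_sets S \<alpha> a b J (i - 1) - extension_sets S \<alpha> a b J i) \<longleftrightarrow>
      s0 = a \<and> ?h0 \<in> K (i - 1) \<and> ?h0 \<notin> K i" for i
    using strip[of "extension_sets S \<alpha> a b J (i - 1) - extension_sets S \<alpha> a b J i"]
      extension_sets_subset_C[of "i - 1"] extension_sets_generic[OF h0] by auto
  \<comment> \<open>A height is dropped at the least index that misses it, which is positive because
    \<open>K 0\<close> is \<open>J\<close>.\<close>
  have 3: "(\<exists>i\<in>{1..}. ?h0 \<in> K (i - 1) \<and> ?h0 \<notin> K i) \<longleftrightarrow> \<not> (\<forall>i. ?h0 \<in> K i)"
  proof
    assume "\<not> (\<forall>i. ?h0 \<in> K i)"
    then have ex: "\<exists>i. ?h0 \<notin> K i" by blast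
    define i where "i = (LEAST i. ?h0 \<notin> K i)"
    have i: "?h0 \<notin> K i" "\<And>j. j < i \<Longrightarrow> ?h0 \<in> K j"
      using LeastI_ex[OF ex] not_less_Least unfolding i_def by blast+
    then have "i \<noteq> 0" using J(1) by (cases i) auto
    then show "\<exists>i\<in>{1..}. ?h0 \<in> K (i - 1) \<and> ?h0 \<notin> K i" using i by (intro bexI[of _ i]) auto
  qed blast
  have "flow_point s h x \<in> transient_set S \<alpha> a b J \<longleftrightarrow> s \<notin> core h"
    by (rule recurrent_iff(2)[OF *])
  also have "\<dots> \<longleftrightarrow> s0 = b \<or> s0 = a \<and> \<not> (\<forall>i. ?h0 \<in> K i)"
    using core_iff_K[OF l *(3)] J(2) a_neq_b by auto
  also have "\<dots> \<longleftrightarrow> flow_point s h x \<in> ?F"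
    unfolding Un_iff UN_iff 1 2 3[symmetric] by blast
  finally show "flow_point s h x \<in> transient_set S \<alpha> a b J \<longleftrightarrow> flow_point s h x \<in> ?F" .
qed

text \<open>Stages \<open>N\<close> and \<open>Suc N\<close> both describe the core on the copy
  except at countably many heights.\<close>

lemma extension_process_finite: "finite_process S \<alpha> a b J"
  unfolding finite_process_def
proof (intro exI[of _ "Suc N"] conjI)
  show "edge_null S (extension_sets S \<alpha> a b J (Suc N - 1) - extension_sets S \<alpha> a b J (Suc N))"
    unfolding edge_null_def
  proof
    fix s assume "s \<in> squares S"
    have "{h \<in> {0..<1}. pt S (s, 0, h) \<in>
        extension_sets S \<alpha> a b J (Suc N - 1) - extension_sets S \<alpha> a b J (Suc N)} \<subseteq> E"
    proof (rule subsetI, rule ccontr)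
      fix h
      assume h: "h \<in> {h \<in> {0..<1}. pt S (s, 0, h) \<in>
        extension_sets S \<alpha> a b J (Suc N - 1) - extension_sets S \<alpha> a b J (Suc N)}" "h \<notin> E"
      then have "h \<in> K N" "h \<notin> K (Suc N)"
        using extension_sets_generic[of h s] by (auto simp del: K.simps extension_sets.simps)
      then show False
        using K_eq_core[of h N] K_eq_core[of h "Suc N"] K_subset_J h(2) by auto
    qed
    moreover have "negligible (\<Union>((\<lambda>x. {x}) ` E))"
      using countable_E by (intro negligible_countable_Union) auto
    ultimately show "negligible {h \<in> {0..<1}. pt S (s, 0, h) \<in>
        extension_sets S \<alpha> a b J (Suc N - 1) - extension_sets S \<alpha> a b J (Suc N)}"
      using negligible_subset by simp
  qed
qed simp

end

section \<open>Strips as polygons\<close>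

definition strip :: "real \<Rightarrow> real \<Rightarrow> real \<Rightarrow> (real \<times> real) set" where
  "strip \<alpha> u v = {(x, y). 0 \<le> x \<and> x \<le> 1 \<and> u \<le> y - \<alpha> * x \<and> y - \<alpha> * x \<le> v}"

definition open_strip :: "real \<Rightarrow> real \<Rightarrow> real \<Rightarrow> (real \<times> real) set" where
  "open_strip \<alpha> u v = {(x, y). 0 < x \<and> x < 1 \<and> u < y - \<alpha> * x \<and> y - \<alpha> * x < v}"

text \<open>The source is the complex plane because \<open>rectpath\<close> lives there; vertical
  edges stay vertical and horizontal ones get slope \<open>\<alpha>\<close>.\<close>

definition shear :: "real \<Rightarrow> complex \<Rightarrow> real \<times> real" where
  "shear \<alpha> z = (Re z, Im z + \<alpha> * Re z)"

lemma linear_shear: "linear (shear \<alpha>)"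
  by (rule linearI) (simp_all add: shear_def algebra_simps)

lemma inj_shear: "inj (shear \<alpha>)"
  by (rule injI) (auto simp: shear_def complex_eq_iff)

lemma shear_box:
  "shear \<alpha> ` cbox (Complex 0 u) (Complex 1 v) = strip \<alpha> u v"
  "shear \<alpha> ` box (Complex 0 u) (Complex 1 v) = open_strip \<alpha> u v"
proof -
  have eq: "(x, y) = shear \<alpha> (Complex x (y - \<alpha> * x))" for x y by (simp add: shear_def)
  show "shear \<alpha> ` cbox (Complex 0 u) (Complex 1 v) = strip \<alpha> u v"
  proof
    show "shear \<alpha> ` cbox (Complex 0 u) (Complex 1 v) \<subseteq> strip \<alpha> u v"
      by (auto simp: strip_def shear_def in_cbox_complex_iff)
    show "strip \<alpha> u v \<subseteq> shear \<alpha> ` cbox (Complex 0 u) (Complex 1 v)"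
      by (clarsimp simp: strip_def, subst eq, rule imageI) (simp add: in_cbox_complex_iff)
  qed
  show "shear \<alpha> ` box (Complex 0 u) (Complex 1 v) = open_strip \<alpha> u v"
  proof
    show "shear \<alpha> ` box (Complex 0 u) (Complex 1 v) \<subseteq> open_strip \<alpha> u v"
      by (auto simp: open_strip_def shear_def in_box_complex_iff)
    show "open_strip \<alpha> u v \<subseteq> shear \<alpha> ` box (Complex 0 u) (Complex 1 v)"
      by (clarsimp simp: open_strip_def, subst eq, rule imageI) (simp add: in_box_complex_iff)
  qed
qed

lemma closure_open_strip:
  assumes "u < v"
  shows "closure (open_strip \<alpha> u v) = strip \<alpha> u v"
proof -
  have "Complex (1 / 2) ((u + v) / 2) \<in> box (Complex 0 u) (Complex 1 v)"
    using assms by (simp add: in_box_complex_iff)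
  then have "closure (box (Complex 0 u) (Complex 1 v)) = cbox (Complex 0 u) (Complex 1 v)"
    by (intro closure_box) blast
  then show ?thesis
    using closure_injective_linear_image[OF linear_shear inj_shear, of \<alpha>] shear_box by metis
qed

lemma open_open_strip: "open (open_strip \<alpha> u v)"
proof -
  have "open_strip \<alpha> u v = {z. 0 < fst z} \<inter> {z. fst z < 1} \<inter> {z. u < snd z - \<alpha> * fst z} \<inter>
      {z. snd z - \<alpha> * fst z < v}"
    by (auto simp: open_strip_def)
  then show ?thesis
    by (auto intro!: open_Int open_Collect_less continuous_intros)
qed

lemma convex_open_strip: "convex (open_strip \<alpha> u v)"
  unfolding shear_box(2)[symmetric] by (intro convex_linear_image linear_shear convex_box)

lemma bounded_open_strip: "bounded (open_strip \<alpha> u v)"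
  unfolding shear_box(2)[symmetric]
  by (intro bounded_linear_image bounded_box)
    (rule linear_conv_bounded_linear[THEN iffD1, OF linear_shear])

lemma interior_strip: "u < v \<Longrightarrow> interior (strip \<alpha> u v) = open_strip \<alpha> u v"
  using convex_interior_closure[OF convex_open_strip, of \<alpha> u v] closure_open_strip[of u v \<alpha>]
  by (simp add: interior_open open_open_strip)

lemma linear_comp_linepath:
  assumes "linear f"
  shows "f \<circ> linepath p q = linepath (f p) (f q)"
  by (simp add: linepath_def fun_eq_iff linear_add[OF assms] linear_scale[OF assms])

text \<open>The boundary is a sheared \<open>rectpath\<close>. Its image is the frontier of a
  bounded convex open set, which identifies the inside without further topology.\<close>

lemma planar_polygon_strip:
  assumes "u < v"
  shows "planar_polygon \<alpha> (strip \<alpha> u v)"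
proof -
  define vs :: "(real \<times> real) list" where "vs = [(0, u), (1, u + \<alpha>), (1, v + \<alpha>), (0, v), (0, u)]"
  let ?r = "rectpath (Complex 0 u) (Complex 1 v)"
  have path: "poly_path vs = shear \<alpha> \<circ> ?r"
    by (simp add: vs_def rectpath_def Let_def path_compose_join linear_comp_linepath[OF linear_shear] shear_def)
  have "simple_path (poly_path vs)"
    unfolding path simple_path_linear_image_eq[OF linear_shear inj_shear]
    using assms by (intro simple_path_rectpath) auto
  moreover have "pathfinish (poly_path vs) = pathstart (poly_path vs)"
    unfolding path by (simp add: pathfinish_compose pathstart_compose)
  moreover have "strip \<alpha> u v = path_image (poly_path vs) \<union> inside (path_image (poly_path vs))"
  proof -
    have "path_image (poly_path vs) = shear \<alpha> ` (cbox (Complex 0 u) (Complex 1 v) - box (Complex 0 u) (Complex 1 v))"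
      unfolding path path_image_compose
      using path_image_rectpath_cbox_minus_box[of "Complex 0 u" "Complex 1 v"] assms by simp
    also have "\<dots> = strip \<alpha> u v - open_strip \<alpha> u v"
      by (simp only: image_set_diff[OF inj_shear] shear_box)
    finally have image: "path_image (poly_path vs) = strip \<alpha> u v - open_strip \<alpha> u v" .
    have "frontier (open_strip \<alpha> u v) = strip \<alpha> u v - open_strip \<alpha> u v"
      using closure_open_strip[OF assms] by (simp add: frontier_def interior_open open_open_strip)
    then have "inside (path_image (poly_path vs)) = open_strip \<alpha> u v"
      using inside_frontier_eq_interior[OF bounded_open_strip convex_open_strip, of \<alpha> u v] image
      by (simp add: interior_open open_open_strip)
    moreover have "open_strip \<alpha> u v \<subseteq> strip \<alpha> u v" by (auto simp: open_strip_def strip_def)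
    ultimately show ?thesis using image by blast
  qed
  moreover have "\<forall>i. Suc i < length vs \<longrightarrow>
      fst (vs ! Suc i) = fst (vs ! i) \<or>
      snd (vs ! Suc i) - snd (vs ! i) = \<alpha> * (fst (vs ! Suc i) - fst (vs ! i))"
    by (auto simp: vs_def less_Suc_eq)
  ultimately show ?thesis unfolding planar_polygon_def by blast
qed

context polysquare_rotation
begin

definition plane_point :: "'s \<Rightarrow> real \<times> real \<Rightarrow> 's point" where
  "plane_point s z = pt S ((above S ^^ nat \<lfloor>snd z\<rfloor>) s, fst z, frac (snd z))"

lemma plane_point_flow_point: "plane_point s (x, h + \<alpha> * x) = flow_point s h x"
  by (simp add: plane_point_def flow_point_eq)

text \<open>On each closed slab of height 1 the map is a translation followed by \<open>pt\<close>;
  on the line between two slabs the formulas agree by the gluing of top edges.\<close>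

lemma continuous_plane_point:
  assumes s: "s \<in> squares S" and Q: "Q \<subseteq> {0..1} \<times> {0..real M}"
  shows "continuous_map (top_of_set Q) (surface_topology S) (plane_point s)"
proof (rule pasting_lemma_closed)
  define T where "T k = Q \<inter> (UNIV \<times> {real k..real k + 1})" for k
  define f where "f k z = pt S ((above S ^^ k) s, fst z, snd z - real k)" for k and z :: "real \<times> real"
  show "finite {..M}" by simp
  show "closedin (top_of_set Q) (T k)" for k
    unfolding T_def by (intro closedin_closed_Int closed_Times) auto
  show "continuous_map (subtopology (top_of_set Q) (T k)) (surface_topology S) (f k)" for k
  proof -
    have "continuous_map (subtopology (top_of_set Q) (T k)) (local_topology S)
        (\<lambda>z. ((above S ^^ k) s, fst z, snd z - real k))"
      unfolding local_topology_def
    proof (intro continuous_map_pairedI)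
      show "continuous_map (subtopology (top_of_set Q) (T k)) (discrete_topology (squares S))
          (\<lambda>z. (above S ^^ k) s)"
        using s above_power_in by simp
      show "continuous_map (subtopology (top_of_set Q) (T k)) (top_of_set ({0..1} \<times> {0..1}))
          (\<lambda>z. (fst z, snd z - real k))"
        unfolding subtopology_subtopology continuous_map_in_subtopology
        using Q by (auto simp: T_def intro!: continuous_intros)
    qed
    from continuous_map_compose[OF this quotient_imp_continuous_map[OF quotient_map_pt]]
    show ?thesis by (simp add: comp_def f_def[abs_def])
  qed
  have floor_piece: "f k z = plane_point s z" if "z \<in> T k" for k z
  proof -
    obtain x y where z: "z = (x, y)" by (cases z)
    have xy: "0 \<le> x" "x \<le> 1" "real k \<le> y" "y \<le> real k + 1" using that Q by (auto simp: T_def z)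
    show ?thesis
    proof (cases "y = real k + 1")
      case True
      then have "nat \<lfloor>y\<rfloor> = Suc k" "frac y = 0" by (simp_all add: nat_add_distrib frac_def)
      then show ?thesis
        using pt_above[of "(above S ^^ k) s" S x] s above_power_in xy True
        by (simp only: z f_def plane_point_def fst_conv snd_conv \<open>nat \<lfloor>y\<rfloor> = Suc k\<close> \<open>frac y = 0\<close>)
          simp
    next
      case False
      then have "\<lfloor>y\<rfloor> = int k" using xy by (simp add: floor_eq_iff)
      then show ?thesis by (simp add: z f_def plane_point_def frac_def)
    qed
  qed
  show "f i z = f j z" if "z \<in> topspace (top_of_set Q) \<inter> T i \<inter> T j" for i j z
    using that floor_piece by auto
  show "\<exists>j. j \<in> {..M} \<and> z \<in> T j \<and> plane_point s z = f j z" if z: "z \<in> topspace (top_of_set Q)" for z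
  proof -
    have "z \<in> Q" "0 \<le> snd z" "snd z \<le> real M" using z Q by auto
    then have "nat \<lfloor>snd z\<rfloor> \<le> M" "real (nat \<lfloor>snd z\<rfloor>) \<le> snd z" "snd z \<le> real (nat \<lfloor>snd z\<rfloor>) + 1"
      by linarith+
    then have "z \<in> T (nat \<lfloor>snd z\<rfloor>)" using \<open>z \<in> Q\<close> by (cases z) (auto simp: T_def)
    with \<open>nat \<lfloor>snd z\<rfloor> \<le> M\<close> floor_piece[OF this] show ?thesis
      by (intro exI[of _ "nat \<lfloor>snd z\<rfloor>"]) simp
  qed
qed

text \<open>Interior points have entry height and displacement strictly between 0 and 1, where the
  flow coordinates are injective.\<close>

lemma surface_polygon_strip:
  assumes s: "s \<in> squares S" and uv: "0 \<le> u" "u < v" "v \<le> 1"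
  shows "surface_polygon S \<alpha> {flow_point s h x | h x. h \<in> {u..v} \<and> x \<in> {0..1}}"
  unfolding surface_polygon_def
proof (intro exI[of _ "strip \<alpha> u v"] exI[of _ "plane_point s"] conjI)
  show "planar_polygon \<alpha> (strip \<alpha> u v)" using uv(2) by (rule planar_polygon_strip)
  \<comment> \<open>Second coordinates do not exceed \<open>v + \<alpha> \<le> 1 + \<alpha>\<close>,
    which bounds the number of slabs.\<close>
  have y: "0 \<le> y" "y \<le> real (nat \<lceil>\<alpha> + 1\<rceil>)" if "(x, y) \<in> strip \<alpha> u v" for x y
  proof -
    have "0 \<le> \<alpha> * x" "\<alpha> * x \<le> \<alpha> * 1" using that pos by (auto simp: strip_def)
    then have "0 \<le> y" "y \<le> \<alpha> + 1" using that uv by (auto simp: strip_def)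
    moreover have "\<alpha> + 1 \<le> real (nat \<lceil>\<alpha> + 1\<rceil>)" by linarith
    ultimately show "0 \<le> y" "y \<le> real (nat \<lceil>\<alpha> + 1\<rceil>)" by linarith+
  qed
  have "strip \<alpha> u v \<subseteq> {0..1} \<times> {0..real (nat \<lceil>\<alpha> + 1\<rceil>)}"
  proof
    fix z assume "z \<in> strip \<alpha> u v"
    then show "z \<in> {0..1} \<times> {0..real (nat \<lceil>\<alpha> + 1\<rceil>)}"
      using y[of "fst z" "snd z"] by (cases z) (auto simp: strip_def)
  qed
  then show "continuous_map (top_of_set (strip \<alpha> u v)) (surface_topology S) (plane_point s)"
    by (rule continuous_plane_point[OF s])
  show "\<forall>(x, y)\<in>strip \<alpha> u v. \<exists>s'\<in>squares S. plane_point s (x, y) = pt S (s', frac x, frac y)"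
  proof clarify
    fix x y assume xy: "(x, y) \<in> strip \<alpha> u v"
    let ?s = "(above S ^^ nat \<lfloor>y\<rfloor>) s"
    have s': "?s \<in> squares S" using s above_power_in by blast
    show "\<exists>s'\<in>squares S. plane_point s (x, y) = pt S (s', frac x, frac y)"
    proof (cases "x = 1")
      case True
      then have "plane_point s (x, y) = pt S (right_of S ?s, 0, frac y)"
        using pt_right[OF s', of "frac y"] by (simp add: plane_point_def frac_lt_1 less_imp_le)
      then show ?thesis using True bij_right s' by (auto intro!: bexI[of _ "right_of S ?s"] dest: bij_betwE)
    next
      case False
      then have "frac x = x" using xy by (auto simp: strip_def frac_eq)
      then show ?thesis using s' by (auto simp: plane_point_def)
    qed
  qed
  show "inj_on (plane_point s) (interior (strip \<alpha> u v))"
    unfolding interior_strip[OF uv(2)]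
  proof (rule inj_onI)
    fix z z' assume z: "z \<in> open_strip \<alpha> u v" "z' \<in> open_strip \<alpha> u v" "plane_point s z = plane_point s z'"
    define h h' x x' where defs: "h = snd z - \<alpha> * fst z" "h' = snd z' - \<alpha> * fst z'" "x = fst z" "x' = fst z'"
    have z_eq: "z = (x, h + \<alpha> * x)" "z' = (x', h' + \<alpha> * x')" by (simp_all add: defs)
    have "h \<in> {0..<1}" "h' \<in> {0..<1}" "x \<in> {0<..<1}" "x' \<in> {0<..<1}"
      using z(1,2) uv by (auto simp: z_eq open_strip_def)
    then have "h = h' \<and> x = x'"
      using flow_point_inject[of s h x s h' x'] not_singular_flow_point[of h x s] z(3) s
      by (auto simp: z_eq plane_point_flow_point)
    then show "z = z'" by (simp add: z_eq)
  qed
  show "{flow_point s h x | h x. h \<in> {u..v} \<and> x \<in> {0..1}} = plane_point s ` strip \<alpha> u v"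
  proof (intro subset_antisym subsetI)
    fix p assume "p \<in> {flow_point s h x | h x. h \<in> {u..v} \<and> x \<in> {0..1}}"
    then obtain h x where "p = plane_point s (x, h + \<alpha> * x)" "h \<in> {u..v}" "x \<in> {0..1}"
      by (auto simp: plane_point_flow_point)
    moreover from this have "(x, h + \<alpha> * x) \<in> strip \<alpha> u v" by (simp add: strip_def)
    ultimately show "p \<in> plane_point s ` strip \<alpha> u v" by blast
  next
    fix p assume "p \<in> plane_point s ` strip \<alpha> u v"
    then obtain x y where "p = plane_point s (x, y)" "(x, y) \<in> strip \<alpha> u v" by auto
    then have "p = flow_point s (y - \<alpha> * x) x" "y - \<alpha> * x \<in> {u..v}" "x \<in> {0..1}"
      using plane_point_flow_point[of s x "y - \<alpha> * x"] by (auto simp: strip_def)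
    then show "p \<in> {flow_point s h x | h x. h \<in> {u..v} \<and> x \<in> {0..1}}" by blast
  qed
qed

lemma finite_int_translates_unit:
  assumes "finite B"
  shows "finite ({0..1} \<inter> int_translates B)"
proof -
  have "{0..1} \<inter> int_translates B \<subseteq> insert 1 (frac ` B)"
  proof
    fix y assume "y \<in> {0..1} \<inter> int_translates B"
    then obtain x k where x: "x \<in> B" "y = x + of_int k" "0 \<le> y" "y \<le> 1"
      unfolding int_translates_def by auto
    then have "frac y = frac x" using frac_int by simp
    moreover have "frac y = y" if "y \<noteq> 1" unfolding frac_eq using x(3,4) that by simp
    ultimately show "y \<in> insert 1 (frac ` B)" using x(1) by (metis image_eqI insert_iff)
  qed
  then show ?thesis by (rule finite_subset) (simp add: assms)
qed

text \<open>Closed strips also contain points with \<open>h' = 1\<close> or \<open>x' = 1\<close>;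
  comparing coordinates modulo 1 shows that these never meet a generic point.\<close>

lemma flow_point_in_strip:
  assumes "flow_point s h x = flow_point s' h' x'" "s \<in> squares S" "s' \<in> squares S"
    and h: "0 < h" "h < 1" "0 < x" "x < 1" "h' \<in> {0..1}" "x' \<in> {0..1}" and n: "h + \<alpha> * x \<notin> \<int>"
  shows "s = s' \<and> h = h' \<and> x = x'"
proof -
  have mem: "((above S ^^ nat \<lfloor>h + \<alpha> * x\<rfloor>) s, x, frac (h + \<alpha> * x)) \<in>
      pt S ((above S ^^ nat \<lfloor>h' + \<alpha> * x'\<rfloor>) s', x', frac (h' + \<alpha> * x'))"
    using assms(1) pt_refl unfolding flow_point_eq by metis
  have fx: "frac x = frac x'" and fy: "frac (h + \<alpha> * x) = frac (h' + \<alpha> * x')"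
    using mem_pt(2,3)[OF mem] by simp_all
  have "x' \<noteq> 1"
  proof
    assume "x' = 1"
    then have "x \<in> \<int>" using fx by (metis frac_eq_0_iff Ints_1)
    then show False using not_int_unit h by blast
  qed
  then have x: "x = x'" using fx h by (simp add: frac_eq)
  have "h' \<noteq> 1"
  proof
    assume "h' = 1"
    then have "frac (h + \<alpha> * x) = frac (0 + \<alpha> * x)"
      using fy x frac_int[of "\<alpha> * x" 1] by (simp add: add.commute)
    then have "h = 0" by (rule frac_inject_unit) (use h in auto)
    with h show False by simp
  qed
  then have "h = h'" using frac_inject_unit[of h "\<alpha> * x" h'] fy x h by simp
  moreover have "s = s'"
    using flow_point_inject[OF assms(1) not_singular_flow_point assms(2,3)] h x \<open>h = h'\<close> by simp
  ultimately show ?thesis using x by simp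
qed

text \<open>The jumps of \<open>g\<close> cut the unit interval into finitely many gaps. Over each
  gap \<open>g\<close> is constant, and every square in its value contributes one
  parallelogram.\<close>

lemma finite_union_of_strips:
  fixes g :: "real \<Rightarrow> 's set"
  assumes E: "countable E" "\<And>h. frac h \<in> E \<longleftrightarrow> h \<in> E" "0 \<in> E" "int_translates B \<subseteq> E"
    and g: "\<And>h. g h \<subseteq> squares S" "finite B"
      "\<And>h. h \<notin> int_translates B \<Longrightarrow> \<forall>\<^sub>F h' in nhds h. g h' = g h"
    and M: "\<And>s h x. s \<in> squares S \<Longrightarrow> h \<in> {0..<1} \<Longrightarrow> h \<notin> E \<Longrightarrow> 0 < x \<Longrightarrow> x < 1 \<Longrightarrow>
      h + \<alpha> * x \<notin> \<int> \<Longrightarrow> flow_point s h x \<in> M \<longleftrightarrow> s \<in> g h"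
  shows "finite_union_of_polygons S \<alpha> M"
proof -
  \<comment> \<open>The endpoints 0 and 1 are included so that every generic height has a cut point
    on either side.\<close>
  define P where "P = {0, 1} \<union> ({0..1} \<inter> int_translates B)"
  have P: "finite P" "P \<subseteq> {0..1}" using finite_int_translates_unit[OF g(2)] by (auto simp: P_def)
  have P_E: "P \<subseteq> E"
    using E(3,4) E(2)[of 1] by (auto simp: P_def)
  \<comment> \<open>The midpoint serves as a sample of the constant value of \<open>g\<close> on the
    gap.\<close>
  define G where "G = {(s, u, v). s \<in> squares S \<and> u \<in> P \<and> v \<in> P \<and> u < v \<and> P \<inter> {u<..<v} = {} \<and>
    s \<in> g ((u + v) / 2)}"
  define piece where "piece = (\<lambda>(s, u, v). {flow_point s h x | h x. h \<in> {u..v} \<and> x \<in> {0..1}})"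
  have const: "g h = g h'" if "P \<inter> {u<..<v} = {}" "0 \<le> u" "v \<le> 1" "h \<in> {u<..<v}" "h' \<in> {u<..<v}" for u v h h'
  proof (rule connected_equivalence_relation[of "{u<..<v}" h h' "\<lambda>x y. g x = g y"])
    fix c assume c: "c \<in> {u<..<v}"
    then have "c \<notin> P" "c \<in> {0..1}" using that(1-3) by auto
    then have "c \<notin> int_translates B" by (simp add: P_def)
    then have "\<forall>\<^sub>F h' in nhds c. g h' = g c" by (rule g(3))
    then obtain W where W: "open W" "c \<in> W" "\<And>x. x \<in> W \<Longrightarrow> g x = g c" unfolding eventually_nhds by blast
    show "\<exists>T. openin (top_of_set {u<..<v}) T \<and> c \<in> T \<and> (\<forall>x\<in>T. g c = g x)"
    proof (intro exI conjI)
      show "openin (top_of_set {u<..<v}) ({u<..<v} \<inter> W)" using W(1) by (rule openin_open_Int)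
      show "c \<in> {u<..<v} \<inter> W" using c W(2) by simp
      show "\<forall>x\<in>{u<..<v} \<inter> W. g c = g x" using W(3) by (metis IntD2)
    qed
  qed (use that in auto)
  have "finite G"
    by (rule finite_subset[of _ "squares S \<times> P \<times> P"]) (auto simp: G_def finite_squares P)
  moreover have "surface_polygon S \<alpha> N" if N: "N \<in> piece ` G" for N
  proof -
    obtain s u v where "(s, u, v) \<in> G" "N = {flow_point s h x | h x. h \<in> {u..v} \<and> x \<in> {0..1}}"
      using N by (auto simp: piece_def)
    moreover from this have "0 \<le> u" "v \<le> 1" using P(2) by (auto simp: G_def)
    ultimately show ?thesis using surface_polygon_strip[of s u v] by (simp add: G_def)
  qed
  moreover have "equal_ae S M (\<Union>(piece ` G))"
  proof (rule equal_ae_generic[OF E(1,2)])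
    fix s h x
    assume *: "s \<in> squares S" "h \<in> {0..<1}" "h \<notin> E" "0 < x" "x < 1" "h + \<alpha> * x \<notin> \<int>"
    then have h: "0 < h" "h < 1" "h \<notin> P" using E(3) P_E by (auto simp: less_le)
    have "s \<in> g h \<longleftrightarrow> flow_point s h x \<in> \<Union>(piece ` G)"
    proof
      assume sg: "s \<in> g h"
      define u v where "u = Max {p \<in> P. p < h}" and "v = Min {p \<in> P. h < p}"
      have fin: "finite {p \<in> P. p < h}" "finite {p \<in> P. h < p}" using P(1) by auto
      have ne: "{p \<in> P. p < h} \<noteq> {}" "{p \<in> P. h < p} \<noteq> {}" using h by (auto simp: P_def)
      have u: "u \<in> P" "u < h" and v: "v \<in> P" "h < v"
        using Max_in[OF fin(1) ne(1)] Min_in[OF fin(2) ne(2)] by (auto simp: u_def v_def)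
      have gap: "P \<inter> {u<..<v} = {}"
      proof (rule ccontr)
        assume "P \<inter> {u<..<v} \<noteq> {}"
        then obtain p where p: "p \<in> P" "u < p" "p < v" by auto
        have "p \<noteq> h" using p(1) h(3) by blast
        then consider "p < h" | "h < p" by linarith
        then show False
        proof cases
          case 1
          then have "p \<le> u" unfolding u_def using p(1) fin(1) by (intro Max_ge) auto
          with p(2) show False by simp
        next
          case 2
          then have "v \<le> p" unfolding v_def using p(1) fin(2) by (intro Min_le) auto
          with p(3) show False by simp
        qed
      qed
      have "g h = g ((u + v) / 2)"
        by (rule const[OF gap]) (use u v P(2) in \<open>auto simp: field_simps\<close>)
      then have "(s, u, v) \<in> G" using sg u v gap *(1) by (simp add: G_def)
      moreover have "flow_point s h x \<in> piece (s, u, v)"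
        unfolding piece_def using u v * by force
      ultimately show "flow_point s h x \<in> \<Union>(piece ` G)" by blast
    next
      assume "flow_point s h x \<in> \<Union>(piece ` G)"
      then obtain s' u v h' x' where G: "(s', u, v) \<in> G" "flow_point s h x = flow_point s' h' x'"
          "h' \<in> {u..v}" "x' \<in> {0..1}"
        by (auto simp: piece_def)
      then have uv: "s' \<in> squares S" "u \<in> P" "v \<in> P" "u < v" "P \<inter> {u<..<v} = {}" "s' \<in> g ((u + v) / 2)"
        by (auto simp: G_def)
      have "0 \<le> u" "v \<le> 1" using uv P(2) by auto
      then have "s = s' \<and> h = h' \<and> x = x'"
        using G * uv h by (intro flow_point_in_strip) auto
      moreover have "h \<in> {u<..<v}"
        using calculation G(3) uv(2,3) h(3) by (auto simp: less_le)
      moreover have "(u + v) / 2 \<in> {u<..<v}" using uv(4) by (auto simp: field_simps)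
      ultimately show "s \<in> g h" using const[OF uv(5) \<open>0 \<le> u\<close> \<open>v \<le> 1\<close>] uv(6) by blast
    qed
    with M[OF *] show "flow_point s h x \<in> M \<longleftrightarrow> flow_point s h x \<in> \<Union>(piece ` G)" by simp
  qed
  ultimately show ?thesis unfolding finite_union_of_polygons_def by blast
qed

end

context barrier
begin

lemma zero_exceptional: "0 \<in> E"
  using generic_not_int[of 0 J] by auto

lemma breakpoints_exceptional: "int_translates (I.breakpoints N) \<subseteq> E"
  using I.breakpoints_subset_orbit by (simp add: exceptional_def)

lemma core_locally_constant_breakpoints:
  "h \<notin> int_translates (I.breakpoints N) \<Longrightarrow> \<forall>\<^sub>F h' in nhds h. core h' = core h"
  unfolding core_def by (rule I.Z_locally_constant)

lemma recurrent_set_polygons: "finite_union_of_polygons S \<alpha> (recurrent_set S \<alpha> a b J)"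
  by (rule finite_union_of_strips[OF countable_E exceptional_frac zero_exceptional
        breakpoints_exceptional core_subset I.finite_breakpoints])
    (rule core_locally_constant_breakpoints, assumption, rule recurrent_iff(1))

lemma transient_set_polygons: "finite_union_of_polygons S \<alpha> (transient_set S \<alpha> a b J)"
proof (rule finite_union_of_strips[OF countable_E exceptional_frac zero_exceptional
        breakpoints_exceptional _ I.finite_breakpoints, where g = "\<lambda>h. squares S - core h"])
  show "\<forall>\<^sub>F h' in nhds h. squares S - core h' = squares S - core h"
    if "h \<notin> int_translates (I.breakpoints N)" for h
    using core_locally_constant_breakpoints[OF that] by eventually_elim simp
  show "flow_point s h x \<in> transient_set S \<alpha> a b J \<longleftrightarrow> s \<in> squares S - core h"
    if "s \<in> squares S" "h \<in> {0..<1}" "h \<notin> E" "0 < x" "x < 1" "h + \<alpha> * x \<notin> \<int>" for s h x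
    using recurrent_iff(2)[OF that] that(1) by simp
qed blast

end

theorem theorem7:
  fixes S :: "'s polysquare" and \<alpha> :: real and a b :: 's and J :: "real set"
  assumes "polysquare_surface S"
    and "\<alpha> > 0" and "\<alpha> \<notin> \<rat>"
    and "one_sided_barrier S a b J"
  shows
    "equal_ae S (recurrent_set S \<alpha> a b J)
       (first_return_strip S \<alpha> (barrier_and_copy S a b J) (limit_set S \<alpha> a b J)) \<and>
     equal_ae S (transient_set S \<alpha> a b J)
       (first_return_strip S \<alpha> (barrier_and_copy S a b J) (edge_part S b J) \<union>
        (\<Union>i\<in>{1..}. first_return_strip S \<alpha> (barrier_and_copy S a b J)
           (extension_sets S \<alpha> a b J (i - 1) - extension_sets S \<alpha> a b J i))) \<and>
     finite_process S \<alpha> a b J \<and>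
     finite_union_of_polygons S \<alpha> (recurrent_set S \<alpha> a b J) \<and>
     finite_union_of_polygons S \<alpha> (transient_set S \<alpha> a b J)"
proof -
  interpret barrier S \<alpha> a b J
    by unfold_locales (use assms in auto)
  show ?thesis
    using recurrent_set_strip transient_set_strips extension_process_finite
      recurrent_set_polygons transient_set_polygons by blast
qed

end
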